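(* Let $\Gamma$ be a distance-regular graph with diameter $d\geqslant 3$, $Q$-polynomial with respect to a fixed ordering of its primitive idempotents, and let $Y$ be a nontrivial descendent of $\Gamma$ with width $w$. Suppose the induced subgraph $\Gamma_Y$ is distance-regular. Then (for given $d$ and $w$) $\Phi(\Gamma_Y)$ is uniquely determined by $\Phi(\Gamma)$ up to isomorphism of Leonard systems. Conversely, if $w\geqslant 3$ then $\Phi(\Gamma_Y)$ uniquely determines $\Phi(\Gamma)$ up to isomorphism. Explicitly: let $\tilde\Gamma$ be another $Q$-polynomial distance-regular graph with the same diameter $d$, and $\tilde Y$ a nontrivial descendent of $\tilde\Gamma$ with the same width $w$ such that $\tilde\Gamma_{\tilde Y}$ is distance-regular. If $\Phi(\Gamma)$ and $\Phi(\tilde\Gamma)$ are isomorphic then $\Phi(\Gamma_Y)$ and $\Phi(\tilde\Gamma_{\tilde Y})$ are isomorphic; and if $w\geqslant 3$ and $\Phi(\Gamma_Y)$ and $\Phi(\tilde\Gamma_{\tilde Y})$ are isomorphic, then $\Phi(\Gamma)$ and $\Phi(\tilde\Gamma)$ are isomorphic.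
   Context: All graphs are finite, simple and undirected. Let $\Gamma$ be a connected graph with vertex set $X$, path-length distance $\partial$ and diameter $d$; let $A_i\in\mathbb{C}^{X\times X}$ be the adjacency matrix of the distance-$i$ graph ($A_0=I$), $A=A_1$. $\Gamma$ is distance-regular if there are integers $b_i,c_i$ such that whenever $\partial(x,y)=i$, $y$ has exactly $b_i$ (resp. $c_i$) neighbours at distance $i+1$ (resp. $i-1$) from $x$. Then the Bose--Mesner algebra $\boldsymbol{A}=\langle A_0,\dots,A_d\rangle$ (complex span) is a commutative semisimple algebra with a basis of primitive idempotents $E_0=|X|^{-1}J,E_1,\dots,E_d$. $\Gamma$ is $Q$-polynomial with respect to the ordering $\{E_i\}_{i=0}^d$ if there are scalars $a_i^*,b_i^*,c_i^*$ with $b_d^*=c_0^*=0$, $b_{i-1}^*c_i^*\neq 0$ $(1\leqslant i\leqslant d)$ and $E_1\circ E_i=|X|^{-1}(b_{i-1}^*E_{i-1}+a_i^*E_i+c_{i+1}^*E_{i+1})$ $(0\leqslant i\leqslant d)$, where $\circ$ is the entrywise product, $E_{-1}=E_{d+1}=0$, $b_{-1}^*=c_{d+1}^*=0$. For a nonempty $Y\subseteq X$ with characteristic vector $\hat Y$, the width is $w=\max\{i:\hat Y^{\mathsf T}A_i\hat Y\neq 0\}$ and the dual width is $w^*=\max\{i:\hat Y^{\mathsf T}E_i\hat Y\neq 0\}$. One always has $w+w^*\geqslant d$; $Y$ is a descendent of $\Gamma$ if $w+w^*=d$, trivial if moreover $w=0$ or $w=d$, nontrivial otherwise. $\Gamma_Y$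 is the induced subgraph on $Y$. For a descendent $Y$ the relations $\{(x,y)\in Y\times Y:\partial(x,y)=i\}$ $(0\leqslant i\leqslant w)$ form an association scheme with $w$ classes on $Y$, whose primitive idempotents have a $Q$-polynomial ordering $E_0',\dots,E_w'$ determined by $\langle E_0',\dots,E_i'\rangle=\langle\breve E_0,\dots,\breve E_i\rangle$ $(0\leqslant i\leqslant w)$, where $\breve B$ is the principal submatrix of $B$ on $Y$. If $\Gamma_Y$ is connected (equivalently, distance-regular) it has diameter $w$ and is regarded as $Q$-polynomial with respect to this ordering. Let $\mathfrak A\cong\mathbb{C}^{(d+1)\times(d+1)}$ be a $\mathbb{C}$-algebra. A Leonard system in $\mathfrak A$ of diameter $d$ is $\Phi=(\mathfrak a;\mathfrak a^*;\{\mathfrak e_i\}_{i=0}^d;\{\mathfrak e_i^*\}_{i=0}^d)$ where $\mathfrak a,\mathfrak a^*$ each have $d+1$ distinct eigenvalues, $\{\mathfrak e_i\}$ (resp. $\{\mathfrak e_i^*\}$) is an ordering of the primitive idempotents of $\mathfrak a$ (resp. $\mathfrak a^*$), and for $0\leqslant i,j\leqslant d$ both $\mathfrak e_i^*\mathfrak a\mathfrak e_j^*$ and $\mathfrak e_i\mathfrak a^*\mathfrak e_j$ are $0$ if $|i-j|>1$ and nonzero if $|i-j|=1$. Two Leonard systems are isomorphic if a $\mathbb{C}$-algebra isomorphism carries one, term by term, to the other. For $x\in X$, with $\hat x$ the unit coordinate vector at $x$, put $A^*=|X|\,\mathrm{diag}(E_1\hat x)$, $E_i^*=\mathrm{diag}(A_i\hat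 x)$, $W=\boldsymbol{A}\hat x$; then $\Phi(\Gamma)=\Phi(\Gamma;x)=(A|_W;A^*|_W;\{E_i|_W\};\{E_i^*|_W\})$ is a Leonard system (in the algebra of linear operators on $W$) which does not depend on $x$ up to isomorphism. $\Phi(\Gamma_Y)$ is defined likewise from $\Gamma_Y$ with the ordering $\{E_i'\}_{i=0}^w$. *)

theory Defs
  imports
    Complex_Main
    "HOL-Library.FuncSet"
    "HOL-Algebra.Subrings"
    "HOL-Algebra.QuotRing"
    "Graph_Theory.Graph_Theory"
    "Jordan_Normal_Form.Char_Poly"
    "Jordan_Normal_Form.VS_Connect"
begin

section \<open>Complex algebras\<close>

text \<open>The locale algebra of HOL-Algebra is restricted to commutative algebras, hence the
  following definition. The records of type module also carry a multiplication and a unit.\<close>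

definition complex_algebra :: "(complex, 'm) module \<Rightarrow> bool" where
  "complex_algebra \<AA> \<longleftrightarrow> ring \<AA> \<and> module (class_ring :: complex ring) \<AA> \<and>
     (\<forall>c. \<forall>x\<in>carrier \<AA>. \<forall>y\<in>carrier \<AA>.
        (c \<odot>\<^bsub>\<AA>\<^esub> x) \<otimes>\<^bsub>\<AA>\<^esub> y = c \<odot>\<^bsub>\<AA>\<^esub> (x \<otimes>\<^bsub>\<AA>\<^esub> y) \<and>
        x \<otimes>\<^bsub>\<AA>\<^esub> (c \<odot>\<^bsub>\<AA>\<^esub> y) = c \<odot>\<^bsub>\<AA>\<^esub> (x \<otimes>\<^bsub>\<AA>\<^esub> y))"

definition algebra_iso :: "(complex, 'm) module \<Rightarrow> (complex, 'n) module \<Rightarrow> ('m \<Rightarrow> 'n) set" where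
  "algebra_iso \<AA> \<BB> =
     {h \<in> ring_iso \<AA> \<BB>. \<forall>c. \<forall>x\<in>carrier \<AA>. h (c \<odot>\<^bsub>\<AA>\<^esub> x) = c \<odot>\<^bsub>\<BB>\<^esub> h x}"

definition subalgebra :: "'m set \<Rightarrow> (complex, 'm) module \<Rightarrow> bool" where
  "subalgebra B \<AA> \<longleftrightarrow> subring B \<AA> \<and> (\<forall>c. \<forall>x\<in>B. c \<odot>\<^bsub>\<AA>\<^esub> x \<in> B)"

definition generated_subalgebra :: "(complex, 'm) module \<Rightarrow> 'm \<Rightarrow> 'm set" where
  "generated_subalgebra \<AA> a = \<Inter>{B. subalgebra B \<AA> \<and> a \<in> B}"

definition primitive_idempotents :: "(complex, 'm) module \<Rightarrow> 'm set \<Rightarrow> 'm set" where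
  "primitive_idempotents \<AA> B =
     {e \<in> B. e \<otimes>\<^bsub>\<AA>\<^esub> e = e \<and> e \<noteq> \<zero>\<^bsub>\<AA>\<^esub> \<and>
        (\<forall>f\<in>B. \<forall>g\<in>B. f \<otimes>\<^bsub>\<AA>\<^esub> f = f \<and> g \<otimes>\<^bsub>\<AA>\<^esub> g = g \<and>
            f \<otimes>\<^bsub>\<AA>\<^esub> g = \<zero>\<^bsub>\<AA>\<^esub> \<and> g \<otimes>\<^bsub>\<AA>\<^esub> f = \<zero>\<^bsub>\<AA>\<^esub> \<and> e = f \<oplus>\<^bsub>\<AA>\<^esub> g
            \<longrightarrow> f = \<zero>\<^bsub>\<AA>\<^esub> \<or> g = \<zero>\<^bsub>\<AA>\<^esub>)}"


section \<open>Leonard systems\<close>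

record 'm leonard_tuple =
  ls_alg :: "(complex, 'm) module"
  ls_diam :: nat
  ls_a :: 'm
  ls_a_star :: 'm
  ls_e :: "nat \<Rightarrow> 'm"
  ls_e_star :: "nat \<Rightarrow> 'm"

text \<open>The eigenvalues of an element of an algebra isomorphic to a full matrix algebra are those of
  its image under an isomorphism; by Skolem--Noether the choice of the isomorphism is immaterial.
  The primitive idempotents of an element are those of the subalgebra that it generates.\<close>

definition leonard_system :: "'m leonard_tuple \<Rightarrow> bool" where
  "leonard_system \<Phi> \<longleftrightarrow>
     (let \<AA> = ls_alg \<Phi>; d = ls_diam \<Phi>; a = ls_a \<Phi>; a' = ls_a_star \<Phi>;
          e = ls_e \<Phi>; e' = ls_e_star \<Phi> in
      complex_algebra \<AA> \<and> a \<in> carrier \<AA> \<and> a' \<in> carrier \<AA> \<and>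
      (\<exists>h \<in> algebra_iso \<AA> (module_mat TYPE(complex) (d + 1) (d + 1)).
         card {\<theta>. eigenvalue (h a) \<theta>} = d + 1 \<and> card {\<theta>. eigenvalue (h a') \<theta>} = d + 1) \<and>
      bij_betw e {..d} (primitive_idempotents \<AA> (generated_subalgebra \<AA> a)) \<and>
      bij_betw e' {..d} (primitive_idempotents \<AA> (generated_subalgebra \<AA> a')) \<and>
      (\<forall>i\<le>d. \<forall>j\<le>d.
         (\<bar>int i - int j\<bar> > 1 \<longrightarrow>
            e' i \<otimes>\<^bsub>\<AA>\<^esub> a \<otimes>\<^bsub>\<AA>\<^esub> e' j = \<zero>\<^bsub>\<AA>\<^esub> \<and> e i \<otimes>\<^bsub>\<AA>\<^esub> a' \<otimes>\<^bsub>\<AA>\<^esub> e j = \<zero>\<^bsub>\<AA>\<^esub>) \<and>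
         (\<bar>int i - int j\<bar> = 1 \<longrightarrow>
            e' i \<otimes>\<^bsub>\<AA>\<^esub> a \<otimes>\<^bsub>\<AA>\<^esub> e' j \<noteq> \<zero>\<^bsub>\<AA>\<^esub> \<and> e i \<otimes>\<^bsub>\<AA>\<^esub> a' \<otimes>\<^bsub>\<AA>\<^esub> e j \<noteq> \<zero>\<^bsub>\<AA>\<^esub>)))"

definition leonard_isomorphic :: "'m leonard_tuple \<Rightarrow> 'n leonard_tuple \<Rightarrow> bool" where
  "leonard_isomorphic \<Phi> \<Psi> \<longleftrightarrow>
     leonard_system \<Phi> \<and> leonard_system \<Psi> \<and> ls_diam \<Phi> = ls_diam \<Psi> \<and>
     (\<exists>\<sigma> \<in> algebra_iso (ls_alg \<Phi>) (ls_alg \<Psi>).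
        \<sigma> (ls_a \<Phi>) = ls_a \<Psi> \<and> \<sigma> (ls_a_star \<Phi>) = ls_a_star \<Psi> \<and>
        (\<forall>i\<le>ls_diam \<Phi>. \<sigma> (ls_e \<Phi> i) = ls_e \<Psi> i \<and> \<sigma> (ls_e_star \<Phi> i) = ls_e_star \<Psi> i))"


section \<open>Matrices and vectors indexed by a finite set\<close>

text \<open>Elements of \<open>\<complex>\<^bsup>X\<times>X\<^esup>\<close> and \<open>\<complex>\<^bsup>X\<^esup>\<close> are functions that vanish outside
  \<open>X \<times> X\<close> and \<open>X\<close>, respectively.\<close>

type_synonym 'a cvec = "'a \<Rightarrow> complex"
type_synonym 'a cmat = "'a \<Rightarrow> 'a \<Rightarrow> complex"

definition mat_algebra :: "'a set \<Rightarrow> (complex, 'a cmat) module" where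
  "mat_algebra X =
     \<lparr> carrier = {M. \<forall>x y. M x y \<noteq> 0 \<longrightarrow> x \<in> X \<and> y \<in> X},
       monoid.mult = (\<lambda>M N x y. \<Sum>z\<in>X. M x z * N z y),
       one = (\<lambda>x y. if x \<in> X \<and> x = y then 1 else 0),
       zero = (\<lambda>x y. 0),
       add = (\<lambda>M N x y. M x y + N x y),
       module.smult = (\<lambda>c M x y. c * M x y) \<rparr>"

definition mat_vec :: "'a set \<Rightarrow> 'a cmat \<Rightarrow> 'a cvec \<Rightarrow> 'a cvec" where
  "mat_vec X M v = (\<lambda>x. \<Sum>y\<in>X. M x y * v y)"

definition diag :: "'a cvec \<Rightarrow> 'a cmat" where
  "diag v = (\<lambda>x y. if x = y then v x else 0)"

definition char_vec :: "'a set \<Rightarrow> 'a cvec" where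
  "char_vec Y = (\<lambda>x. if x \<in> Y then 1 else 0)"

definition quad_form :: "'a set \<Rightarrow> 'a cmat \<Rightarrow> 'a cvec \<Rightarrow> complex" where
  "quad_form X M v = (\<Sum>x\<in>X. \<Sum>y\<in>X. v x * M x y * v y)"

definition principal_submatrix :: "'a set \<Rightarrow> 'a cmat \<Rightarrow> 'a cmat" where
  "principal_submatrix Y M = (\<lambda>x y. if x \<in> Y \<and> y \<in> Y then M x y else 0)"

definition mat_span :: "nat \<Rightarrow> (nat \<Rightarrow> 'a cmat) \<Rightarrow> 'a cmat set" where
  "mat_span n B = {(\<lambda>x y. \<Sum>i\<le>n. c i * B i x y) | c :: nat \<Rightarrow> complex. True}"

text \<open>The linear operators on a subspace \<open>W\<close>, as extensional functions.\<close>

definition operator_algebra :: "'a cvec set \<Rightarrow> (complex, 'a cvec \<Rightarrow> 'a cvec) module" where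
  "operator_algebra W =
     \<lparr> carrier = {f \<in> W \<rightarrow>\<^sub>E W.
         (\<forall>u\<in>W. \<forall>v\<in>W. f (\<lambda>x. u x + v x) = (\<lambda>x. f u x + f v x)) \<and>
         (\<forall>c. \<forall>u\<in>W. f (\<lambda>x. c * u x) = (\<lambda>x. c * f u x))},
       monoid.mult = compose W,
       one = (\<lambda>v\<in>W. v),
       zero = (\<lambda>v\<in>W. \<lambda>x. 0),
       add = (\<lambda>f g. \<lambda>v\<in>W. \<lambda>x. f v x + g v x),
       module.smult = (\<lambda>c f. \<lambda>v\<in>W. \<lambda>x. c * f v x) \<rparr>"


section \<open>Distance-regular graphs\<close>

text \<open>An undirected finite simple graph is a symmetric digraph without loops and parallel arcs
  (locale graph). The distance is only meaningful if the vertices are joined by a walk.\<close>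

definition gdist :: "('a, 'e) pre_digraph \<Rightarrow> 'a \<Rightarrow> 'a \<Rightarrow> nat" where
  "gdist G x y = (LEAST n. \<exists>p. pre_digraph.awalk G x p y \<and> length p = n)"

definition gdiam :: "('a, 'e) pre_digraph \<Rightarrow> nat" where
  "gdiam G = Max {gdist G x y | x y. x \<in> verts G \<and> y \<in> verts G}"

definition distance_regular :: "('a, 'e) pre_digraph \<Rightarrow> bool" where
  "distance_regular G \<longleftrightarrow> graph G \<and> connected G \<and>
     (\<exists>b c :: nat \<Rightarrow> nat. \<forall>x\<in>verts G. \<forall>y\<in>verts G.
        card {z \<in> verts G. y \<rightarrow>\<^bsub>G\<^esub> z \<and> gdist G x z = gdist G x y + 1} = b (gdist G x y) \<and>
        card {z \<in> verts G. y \<rightarrow>\<^bsub>G\<^esub> z \<and> gdist G x z + 1 = gdist G x y} = c (gdist G x y))"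

definition dist_mat :: "('a, 'e) pre_digraph \<Rightarrow> nat \<Rightarrow> 'a cmat" where
  "dist_mat G i = (\<lambda>x y. if x \<in> verts G \<and> y \<in> verts G \<and> gdist G x y = i then 1 else 0)"

definition bose_mesner :: "('a, 'e) pre_digraph \<Rightarrow> 'a cmat set" where
  "bose_mesner G = mat_span (gdiam G) (dist_mat G)"

definition Q_polynomial :: "('a, 'e) pre_digraph \<Rightarrow> (nat \<Rightarrow> 'a cmat) \<Rightarrow> bool" where
  "Q_polynomial G E \<longleftrightarrow>
     (let X = verts G; d = gdiam G; q = 1 / of_nat (card X) in
      bij_betw E {..d} (primitive_idempotents (mat_algebra X) (bose_mesner G)) \<and>
      E 0 = (\<lambda>x y. if x \<in> X \<and> y \<in> X then q else 0) \<and>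
      (\<exists>a b c :: nat \<Rightarrow> complex.
         b d = 0 \<and> c 0 = 0 \<and> (\<forall>i\<in>{1..d}. b (i - 1) * c i \<noteq> 0) \<and>
         (\<forall>i\<le>d. \<forall>x\<in>X. \<forall>y\<in>X.
            E 1 x y * E i x y =
              q * ((if i = 0 then 0 else b (i - 1) * E (i - 1) x y) + a i * E i x y
                   + (if i = d then 0 else c (i + 1) * E (i + 1) x y)))))"


section \<open>Descendents\<close>

definition width :: "('a, 'e) pre_digraph \<Rightarrow> 'a set \<Rightarrow> nat" where
  "width G Y = Max {i. i \<le> gdiam G \<and> quad_form (verts G) (dist_mat G i) (char_vec Y) \<noteq> 0}"

definition dual_width :: "('a, 'e) pre_digraph \<Rightarrow> (nat \<Rightarrow> 'a cmat) \<Rightarrow> 'a set \<Rightarrow> nat" where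
  "dual_width G E Y = Max {i. i \<le> gdiam G \<and> quad_form (verts G) (E i) (char_vec Y) \<noteq> 0}"

definition descendent :: "('a, 'e) pre_digraph \<Rightarrow> (nat \<Rightarrow> 'a cmat) \<Rightarrow> 'a set \<Rightarrow> bool" where
  "descendent G E Y \<longleftrightarrow>
     Y \<noteq> {} \<and> Y \<subseteq> verts G \<and> width G Y + dual_width G E Y = gdiam G"

definition nontrivial_descendent :: "('a, 'e) pre_digraph \<Rightarrow> (nat \<Rightarrow> 'a cmat) \<Rightarrow> 'a set \<Rightarrow> bool" where
  "nontrivial_descendent G E Y \<longleftrightarrow>
     descendent G E Y \<and> width G Y \<noteq> 0 \<and> width G Y \<noteq> gdiam G"

text \<open>\<open>E'\<close> is the ordering, induced by the ordering \<open>E\<close>, of the primitive idempotents of the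
  association scheme on \<open>Y\<close> whose relations are the restrictions of the distance relations of
  \<open>G\<close> (not those of the induced subgraph). Only the values of \<open>E'\<close> on \<open>{..width G Y}\<close> matter.\<close>

definition induced_ordering ::
  "('a, 'e) pre_digraph \<Rightarrow> (nat \<Rightarrow> 'a cmat) \<Rightarrow> 'a set \<Rightarrow> (nat \<Rightarrow> 'a cmat) \<Rightarrow> bool" where
  "induced_ordering G E Y E' \<longleftrightarrow>
     (let w = width G Y in
      bij_betw E' {..w} (primitive_idempotents (mat_algebra Y)
        (mat_span w (\<lambda>i. principal_submatrix Y (dist_mat G i)))) \<and>
      (\<forall>i\<le>w. mat_span i E' = mat_span i (\<lambda>j. principal_submatrix Y (E j))))"


section \<open>The Leonard system of a Q-polynomial distance-regular graph\<close>

definition primary_module :: "('a, 'e) pre_digraph \<Rightarrow> 'a \<Rightarrow> 'a cvec set" where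
  "primary_module G x = {mat_vec (verts G) M (char_vec {x}) | M. M \<in> bose_mesner G}"

definition graph_leonard ::
  "('a, 'e) pre_digraph \<Rightarrow> (nat \<Rightarrow> 'a cmat) \<Rightarrow> 'a \<Rightarrow> ('a cvec \<Rightarrow> 'a cvec) leonard_tuple" where
  "graph_leonard G E x =
     (let X = verts G; W = primary_module G x; on_W = (\<lambda>M. restrict (mat_vec X M) W) in
      \<lparr> ls_alg = operator_algebra W,
        ls_diam = gdiam G,
        ls_a = on_W (dist_mat G 1),
        ls_a_star = on_W (\<lambda>y z. of_nat (card X) * diag (mat_vec X (E 1) (char_vec {x})) y z),
        ls_e = (\<lambda>i. on_W (E i)),
        ls_e_star = (\<lambda>i. on_W (diag (mat_vec X (dist_mat G i) (char_vec {x})))) \<rparr>)"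

end

theory Submission
  imports Defs
begin

text \<open>Both Leonard systems are encoded by functions on the distances \<open>0, \<dots>, d\<close>: the intersection
  numbers \<open>b, c\<close> and the entries \<open>Q i r\<close> of \<open>|X| E i\<close> at distance \<open>r\<close>. Let \<open>T\<close> be the tridiagonal
  operator with coefficients \<open>b, c\<close>. Up to affine changes of \<open>T\<close> and \<open>x = Q 1\<close>, row \<open>r\<close> of the
  equations for \<open>T x\<close>, \<open>T (Q d)\<close> and \<open>T (x Q d)\<close>, for the unknowns \<open>b r\<close> and \<open>c r\<close>, only involves \<open>x\<close>
  and \<open>Q d\<close> near \<open>r\<close>; it follows that \<open>x\<close> up to an affine map, \<open>Q d\<close> up to a scalar and \<open>c 1 = 1\<close>
  determine \<open>b\<close> and \<open>c\<close>. As \<open>x\<close> satisfies a three-term recurrence, the values at \<open>0, \<dots>, w\<close> suffice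
  if \<open>w \<ge> 3\<close>.

  For a descendent \<open>Y\<close> of width \<open>w\<close>, the space of functions on \<open>{..w}\<close> is the direct sum of the spans
  of \<open>Q 0, \<dots>, Q (j - 1)\<close> and of \<open>Q (d - w + j), \<dots>, Q d\<close>, and the corresponding matrices on \<open>Y\<close>
  annihilate each other. Hence the restricted distance relations form an association scheme whose
  \<open>Q' 1\<close> is affine in \<open>Q 1\<close> and whose \<open>Q' w\<close> is proportional to \<open>Q d\<close>, so that either of the two
  Leonard systems determines the data that determine the other one.\<close>

section \<open>Leonard data\<close>

text \<open>An isomorphism sees the tridiagonal operator only up to a diagonal change of basis: it
  preserves the diagonal entries and the products \<open>b i * c (i + 1)\<close>, not
  \<open>b\<close> and \<open>c\<close> themselves. The relations \<open>c 0 = 0\<close> and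
  \<open>b 0 = th 0\<close>, valid for graphs, recover \<open>b\<close> and \<open>c\<close> from
  these by induction. The row equations in turn are homogeneous in \<open>b\<close>,
  \<open>c\<close> and their unknown scalars, so that they fix the data only up to a common factor,
  which \<open>c 1 = 1\<close> removes. Passing from width w back to d meets another obstacle: the
  values of \<open>Q d\<close> beyond w are unknown, hence so are most of its rows, in particular
  row d. They are replaced by a relation between the scalars that involves \<open>x\<close> alone,
  extracted from the two end rows, and by the row equations for the square of \<open>x\<close>. The
  bilinear setting over the complex numbers has no positivity. Where it is indispensable, namely for
  the vanishing of matrices on Y and for the direct sum, it comes from the reality of the
  idempotents, which rests on \<open>b\<close> and \<open>c\<close> being natural numbers.\<close>

lemma square_system_solvable:
  fixes a :: "nat \<Rightarrow> nat \<Rightarrow> complex"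
  assumes inj: "\<And>u. (\<forall>r\<le>n. (\<Sum>i\<le>n. u i * a i r) = 0) \<Longrightarrow> \<forall>i\<le>n. u i = 0"
  obtains u where "\<And>r. r \<le> n \<Longrightarrow> f r = (\<Sum>i\<le>n. u i * a i r)"
proof -
  define M where "M = mat (Suc n) (Suc n) (\<lambda>(r, i). a i r)"
  have M: "M \<in> carrier_mat (Suc n) (Suc n)"
    by (simp add: M_def)
  have mv: "(M *\<^sub>v v) $ r = (\<Sum>i\<le>n. v $ i * a i r)" if "v \<in> carrier_vec (Suc n)" "r \<le> n" for v r
  proof -
    have "(M *\<^sub>v v) $ r = (\<Sum>i<Suc n. a i r * v $ i)"
      using that by (simp add: M_def scalar_prod_def atLeast0LessThan)
    then show ?thesis
      by (simp only: lessThan_Suc_atMost mult.commute)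
  qed
  have "det M \<noteq> 0"
  proof
    assume "det M = 0"
    then obtain v where v: "v \<in> carrier_vec (Suc n)" "v \<noteq> 0\<^sub>v (Suc n)" "M *\<^sub>v v = 0\<^sub>v (Suc n)"
      using det_0_iff_vec_prod_zero_field[OF M] by blast
    have "\<forall>r\<le>n. (\<Sum>i\<le>n. v $ i * a i r) = 0"
      using mv[OF v(1)] v(3) by auto
    then have "\<forall>i\<le>n. v $ i = 0"
      by (rule inj)
    then have "v = 0\<^sub>v (Suc n)"
      using v(1) by (intro eq_vecI) auto
    with v(2) show False by simp
  qed
  then obtain B where B: "B \<in> carrier_mat (Suc n) (Suc n)" "M * B = 1\<^sub>m (Suc n)"
    using det_non_zero_imp_unit[OF M, of "()"] unfolding Units_def ring_mat_simps by blast
  define v where "v = B *\<^sub>v vec (Suc n) f"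
  have v: "v \<in> carrier_vec (Suc n)"
    using B by (simp add: v_def)
  have "M *\<^sub>v v = vec (Suc n) f"
    using assoc_mult_mat_vec[OF M B(1), of "vec (Suc n) f"] B by (simp add: v_def)
  then have "f r = (\<Sum>i\<le>n. v $ i * a i r)" if "r \<le> n" for r
    using mv[OF v that] that by simp
  then show ?thesis by (rule that)
qed

text \<open>\<open>b, c\<close> are the intersection numbers, \<open>th\<close> the eigenvalues, \<open>Q\<close> the second eigenmatrix and \<open>x\<close>
  the dual eigenvalues.\<close>

locale leonard_data =
  fixes d :: nat and b c x :: "nat \<Rightarrow> complex" and Q :: "nat \<Rightarrow> nat \<Rightarrow> complex"
    and th :: "nat \<Rightarrow> complex"
  assumes b_nz: "r < d \<Longrightarrow> b r \<noteq> 0" and b_d: "b d = 0"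
    and c_0: "c 0 = 0" and c_nz: "\<lbrakk>1 \<le> r; r \<le> d\<rbrakk> \<Longrightarrow> c r \<noteq> 0"
    and x_inj: "inj_on x {..d}" and th_inj: "inj_on th {..d}"
    and Q_0: "r \<le> d \<Longrightarrow> Q 0 r = 1"
    and Q_poly: "i \<le> d \<Longrightarrow> \<exists>p. degree p = i \<and> (\<forall>r\<le>d. Q i r = poly p (x r))"
    and eig: "\<lbrakk>i \<le> d; r \<le> d\<rbrakk> \<Longrightarrow>
      c r * Q i (r - 1) + (th 0 - b r - c r) * Q i r + b r * Q i (r + 1) = th i * Q i r"
begin

text \<open>The diagonal entry makes every row sum equal to \<open>th 0\<close>. The values
  \<open>f (0 - 1) = f 0\<close> and \<open>f (d + 1)\<close> do no harm, since \<open>c 0\<close>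
  and \<open>b d\<close> vanish.\<close>

definition T :: "(nat \<Rightarrow> complex) \<Rightarrow> nat \<Rightarrow> complex" where
  "T f r = c r * f (r - 1) + (th 0 - b r - c r) * f r + b r * f (r + 1)"

lemma T_cong:
  assumes "\<And>r. r \<le> d \<Longrightarrow> f r = g r" and "r \<le> d"
  shows "T f r = T g r"
proof -
  have "f r = g r" "f (r - 1) = g (r - 1)"
    using assms by auto
  moreover have "b r * f (r + 1) = b r * g (r + 1)"
    using assms b_d by (cases "r = d") auto
  ultimately show ?thesis
    by (simp only: T_def)
qed

lemma T_sum: "T (\<lambda>r. \<Sum>i\<in>I. u i * f i r) r = (\<Sum>i\<in>I. u i * T (f i) r)"
  by (simp add: T_def sum_distrib_left sum.distrib distrib_left mult.left_commute)

lemma T_Q: "\<lbrakk>i \<le> d; r \<le> d\<rbrakk> \<Longrightarrow> T (Q i) r = th i * Q i r"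
  unfolding T_def by (rule eig)

lemma T_expand:
  assumes "\<And>r. r \<le> d \<Longrightarrow> f r = (\<Sum>i\<le>n. u i * Q i r)" and "n \<le> d" and "r \<le> d"
  shows "T f r = (\<Sum>i\<le>n. u i * th i * Q i r)"
  using T_cong[OF assms(1,3)] assms(2,3) by (simp add: T_sum T_Q mult.assoc)

definition P :: "nat \<Rightarrow> complex poly" where
  "P i = (SOME p. degree p = i \<and> (\<forall>r\<le>d. Q i r = poly p (x r)))"

lemma P: assumes "i \<le> d" shows "degree (P i) = i" and "r \<le> d \<Longrightarrow> Q i r = poly (P i) (x r)"
  using someI_ex[OF Q_poly[OF assms]] unfolding P_def[symmetric] by simp_all

lemma poly_zero:
  assumes "degree p \<le> d" and "\<And>r. r \<le> d \<Longrightarrow> poly p (x r) = 0"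
  shows "p = 0"
proof (rule ccontr)
  assume p: "p \<noteq> 0"
  have "card (x ` {..d}) \<le> card {y. poly p y = 0}"
    using assms p by (intro card_mono poly_roots_finite) auto
  also have "\<dots> \<le> degree p"
    using p by (rule poly_roots_degree)
  finally show False
    using assms(1) card_image[OF x_inj] by simp
qed

text \<open>Only degree 0 needs care: there the degree does not exclude the zero polynomial, but
  \<open>Q 0\<close> is 1.\<close>

lemma P_lead: assumes "i \<le> d" shows "coeff (P i) i \<noteq> 0"
proof -
  have "P i \<noteq> 0"
    using P[OF assms] P(2)[of 0 0] Q_0[of 0] assms by (cases "i = 0") auto
  then show ?thesis
    using P(1)[OF assms] by (metis leading_coeff_0_iff)
qed

text \<open>Subtracting a multiple of \<open>P n\<close> lowers the degree. The clause on the
  leading coefficient is what makes the entries above the diagonal nonzero in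
  \<open>three_term\<close>.\<close>

lemma poly_expand:
  assumes "degree p \<le> n" and "n \<le> d"
  shows "\<exists>u. (\<forall>r\<le>d. poly p (x r) = (\<Sum>i\<le>n. u i * Q i r)) \<and> (coeff p n \<noteq> 0 \<longrightarrow> u n \<noteq> 0)"
  using assms
proof (induction n arbitrary: p)
  case 0
  then obtain a where "p = [:a:]"
    by (meson degree_eq_zeroE le_zero_eq)
  then show ?case
    by (intro exI[of _ "\<lambda>_. a"]) (auto simp: Q_0)
next
  case (Suc n)
  define a where "a = coeff p (Suc n) / coeff (P (Suc n)) (Suc n)"
  define p' where "p' = p - Polynomial.smult a (P (Suc n))"
  have "coeff p' (Suc n) = 0"
    using P_lead[OF Suc.prems(2)] by (simp add: p'_def a_def)
  moreover have "degree p' \<le> Suc n"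
    using Suc.prems P(1)[of "Suc n"] unfolding p'_def
    by (intro degree_diff_le) (auto intro: order.trans[OF degree_smult_le])
  ultimately have "degree p' \<le> n"
    by (metis le_Suc_eq leading_coeff_0_iff degree_0 le0)
  with Suc obtain u where u: "\<forall>r\<le>d. poly p' (x r) = (\<Sum>i\<le>n. u i * Q i r)"
    by (meson Suc_leD)
  have "poly p (x r) = (\<Sum>i\<le>Suc n. (u(Suc n := a)) i * Q i r)" if "r \<le> d" for r
  proof -
    have "(\<Sum>i\<le>n. (u(Suc n := a)) i * Q i r) = (\<Sum>i\<le>n. u i * Q i r)"
      by (intro sum.cong) auto
    moreover have "poly p (x r) = poly p' (x r) + a * Q (Suc n) r"
      using P(2)[OF Suc.prems(2) that] by (simp add: p'_def)
    ultimately show ?thesis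
      using u that by simp
  qed
  moreover have "coeff p (Suc n) \<noteq> 0 \<longrightarrow> a \<noteq> 0"
    using P_lead[OF Suc.prems(2)] by (simp add: a_def)
  ultimately show ?case
    by (intro exI[of _ "u(Suc n := a)"]) auto
qed

lemma Q_indep:
  assumes "n \<le> d" and "\<forall>r\<le>d. (\<Sum>i\<le>n. u i * Q i r) = 0"
  shows "\<forall>i\<le>n. u i = 0"
  using assms
proof (induction n)
  case 0
  then show ?case using Q_0[of 0] by auto
next
  case (Suc n)
  define p where "p = (\<Sum>i\<le>Suc n. Polynomial.smult (u i) (P i))"
  have "degree p \<le> d"
    unfolding p_def
  proof (intro degree_sum_le)
    fix i assume "i \<in> {..Suc n}"
    then show "degree (Polynomial.smult (u i) (P i)) \<le> d"
      using Suc.prems(1) P(1)[of i] degree_smult_le[of "u i" "P i"] by simp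
  qed simp
  moreover have "poly p (x r) = 0" if "r \<le> d" for r
  proof -
    have "(\<Sum>i\<le>Suc n. u i * poly (P i) (x r)) = (\<Sum>i\<le>Suc n. u i * Q i r)"
      using P(2)[OF _ that] Suc.prems(1) by (intro sum.cong) auto
    then show ?thesis using Suc.prems(2) that by (simp add: p_def poly_sum)
  qed
  ultimately have "p = 0" by (rule poly_zero)
  then have "0 = coeff p (Suc n)" by simp
  also have "\<dots> = (\<Sum>i\<le>Suc n. u i * coeff (P i) (Suc n))"
    by (simp add: p_def coeff_sum)
  also have "\<dots> = u (Suc n) * coeff (P (Suc n)) (Suc n)"
    using Suc.prems(1) P(1) by (auto intro!: sum.neutral coeff_eq_0)
  finally have "u (Suc n) = 0"
    using P_lead[OF Suc.prems(1)] by simp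
  moreover from this have "\<forall>r\<le>d. (\<Sum>i\<le>n. u i * Q i r) = 0"
    using Suc.prems(2) by simp
  then have "\<forall>i\<le>n. u i = 0"
    using Suc.prems(1) by (intro Suc.IH) simp_all
  ultimately show ?case
    by (auto simp: le_Suc_eq)
qed

lemma Q_unique:
  assumes "\<forall>r\<le>d. (\<Sum>i\<le>d. u i * Q i r) = (\<Sum>i\<le>d. v i * Q i r)" and "i \<le> d"
  shows "u i = v i"
  using Q_indep[of d "\<lambda>i. u i - v i"] assms by (simp add: left_diff_distrib sum_subtractf)

lemma Q_expand: obtains u where "\<And>r. r \<le> d \<Longrightarrow> f r = (\<Sum>i\<le>d. u i * Q i r)"
  using square_system_solvable[of d Q f] Q_indep[of d] by blast

text \<open>The weights that symmetrise \<open>T\<close>; for a graph, the number of vertices at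
  distance r from a given vertex.\<close>

definition k :: "nat \<Rightarrow> complex" where "k r = (\<Prod>s<r. b s / c (Suc s))"

lemma k_Suc: "r < d \<Longrightarrow> k (Suc r) * c (Suc r) = k r * b r"
  using c_nz[of "Suc r"] by (simp add: k_def)

lemma k_nz: "r \<le> d \<Longrightarrow> k r \<noteq> 0"
  using b_nz c_nz by (auto simp: k_def)

text \<open>There is no conjugation, so the form is symmetric for complex data, at the price that a
  function might be orthogonal to itself; hence \<open>Q_norm\<close> needs an argument.\<close>

definition form :: "(nat \<Rightarrow> complex) \<Rightarrow> (nat \<Rightarrow> complex) \<Rightarrow> complex" where
  "form f g = (\<Sum>r\<le>d. k r * f r * g r)"

lemma form_cong:
  "\<lbrakk>\<And>r. r \<le> d \<Longrightarrow> f r = f' r; \<And>r. r \<le> d \<Longrightarrow> g r = g' r\<rbrakk> \<Longrightarrow> form f g = form f' g'"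
  by (auto simp: form_def intro!: sum.cong)

lemma form_sym: "form f g = form g f"
  by (simp add: form_def mult.commute mult.left_commute)

lemma form_sum_left: "form (\<lambda>r. \<Sum>i\<in>I. u i * f i r) g = (\<Sum>i\<in>I. u i * form (f i) g)"
  unfolding form_def sum_distrib_left sum_distrib_right
  by (subst sum.swap) (simp add: mult_ac)

lemma form_scale_left: "form (\<lambda>r. a * f r) g = a * form f g"
  by (simp add: form_def sum_distrib_left mult_ac)

lemma T_self_adjoint: "form (T f) g = form f (T g)"
proof -
  define h where "h r = (th 0 - b r - c r) * k r" for r
  \<comment> \<open>The right side is symmetric in f and g: by \<open>k_Suc\<close> both
    off-diagonal sums carry the weights \<open>k r * b r\<close>.\<close>
  have *: "form (T f) g = (\<Sum>r\<le>d. h r * f r * g r) +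
     ((\<Sum>r<d. k r * b r * f r * g (Suc r)) + (\<Sum>r<d. k r * b r * f (Suc r) * g r))" for f g
  proof -
    have "(\<Sum>r\<le>d. k r * c r * f (r - 1) * g r) = (\<Sum>r<d. k (Suc r) * c (Suc r) * f r * g (Suc r))"
      by (subst sum.atMost_shift) (simp add: c_0)
    also have "\<dots> = (\<Sum>r<d. k r * b r * f r * g (Suc r))"
      by (intro sum.cong) (auto simp: k_Suc)
    finally have 1: "(\<Sum>r\<le>d. k r * c r * f (r - 1) * g r) = (\<Sum>r<d. k r * b r * f r * g (Suc r))" .
    have 2: "(\<Sum>r\<le>d. k r * b r * f (Suc r) * g r) = (\<Sum>r<d. k r * b r * f (Suc r) * g r)"
      by (simp add: lessThan_Suc_atMost[symmetric] b_d)
    have "form (T f) g = (\<Sum>r\<le>d. h r * f r * g r + (k r * c r * f (r - 1) * g r + k r * b r * f (Suc r) * g r))"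
      unfolding form_def T_def h_def by (intro sum.cong) (auto simp: algebra_simps)
    then show ?thesis by (simp only: sum.distrib 1 2)
  qed
  show ?thesis
    unfolding *[of f g] form_sym[of f] *[of g f] by (simp add: mult_ac add_ac)
qed

lemma Q_orth:
  assumes "i \<le> d" "j \<le> d" "i \<noteq> j"
  shows "form (Q i) (Q j) = 0"
proof -
  have "th i * form (Q i) (Q j) = form (T (Q i)) (Q j)"
    unfolding form_scale_left[symmetric] using assms by (intro form_cong) (auto simp: T_Q)
  also have "\<dots> = form (T (Q j)) (Q i)"
    by (simp add: T_self_adjoint form_sym[of "Q i"])
  also have "\<dots> = th j * form (Q j) (Q i)"
    unfolding form_scale_left[symmetric] using assms by (intro form_cong) (auto simp: T_Q)
  finally have "(th i - th j) * form (Q i) (Q j) = 0"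
    by (simp add: form_sym[of "Q i"] algebra_simps)
  then show ?thesis
    using th_inj assms by (auto simp: inj_on_def)
qed

lemma form_Q_expand:
  assumes "\<And>r. r \<le> d \<Longrightarrow> f r = (\<Sum>i\<le>d. u i * Q i r)" and "j \<le> d"
  shows "form f (Q j) = u j * form (Q j) (Q j)"
proof -
  have "form f (Q j) = (\<Sum>i\<le>d. u i * form (Q i) (Q j))"
    using form_cong[of f "\<lambda>r. \<Sum>i\<le>d. u i * Q i r" "Q j" "Q j"] assms by (simp add: form_sum_left)
  also have "\<dots> = (\<Sum>i\<le>d. if i = j then u j * form (Q j) (Q j) else 0)"
    using assms(2) by (intro sum.cong) (auto simp: Q_orth)
  finally show ?thesis using assms(2) by simp
qed

lemma Q_nonzero:
  assumes "i \<le> d" shows "\<exists>r\<le>d. Q i r \<noteq> 0"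
proof (rule ccontr)
  assume "\<not> ?thesis"
  then have "\<forall>r\<le>d. (\<Sum>j\<le>d. (if j = i then 1 else 0) * Q j r) = 0"
    by (auto intro!: sum.neutral)
  from Q_indep[OF order.refl this] assms show False by auto
qed

text \<open>If \<open>Q i\<close> were orthogonal to itself, it would be orthogonal to every
  function, because the \<open>Q j\<close> span; the indicator of a point where \<open>Q i\<close>
  is nonzero contradicts this.\<close>

lemma Q_norm:
  assumes "i \<le> d" shows "form (Q i) (Q i) \<noteq> 0"
proof
  assume 0: "form (Q i) (Q i) = 0"
  obtain r where r: "r \<le> d" "Q i r \<noteq> 0" using Q_nonzero[OF assms] by blast
  obtain u where u: "\<And>s. s \<le> d \<Longrightarrow> (if s = r then 1 else 0) = (\<Sum>i\<le>d. u i * Q i s)"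
    using Q_expand[of "\<lambda>s. if s = r then 1 else 0"] by blast
  have "form (\<lambda>s. if s = r then 1 else 0) (Q i) = 0"
    using form_Q_expand[OF u assms] 0 by simp
  moreover have "form (\<lambda>s. if s = r then 1 else 0) (Q i) = k r * Q i r"
    using r(1) by (simp add: form_def if_distrib[of "\<lambda>y. _ * y"] if_distrib[of "\<lambda>y. y * _"] cong: if_cong)
  ultimately show False using r k_nz by simp
qed

text \<open>Degrees control the entries above the diagonal. Multiplication by \<open>x\<close> is
  self-adjoint for \<open>form\<close>, so \<open>h i j\<close> and \<open>h j i\<close> differ by a
  nonzero factor, which carries the information below the diagonal.\<close>

lemma three_term:
  obtains h where "\<And>i r. \<lbrakk>i \<le> d; r \<le> d\<rbrakk> \<Longrightarrow> x r * Q i r = (\<Sum>j\<le>d. h i j * Q j r)"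
    and "\<And>i j. \<lbrakk>i \<le> d; j \<le> d; j + 1 < i \<or> i + 1 < j\<rbrakk> \<Longrightarrow> h i j = 0"
    and "\<And>i j. \<lbrakk>i \<le> d; j \<le> d; j + 1 = i \<or> i + 1 = j\<rbrakk> \<Longrightarrow> h i j \<noteq> 0"
proof -
  have "\<exists>u. \<forall>r\<le>d. x r * Q i r = (\<Sum>j\<le>d. u j * Q j r)" for i
    using Q_expand[of "\<lambda>r. x r * Q i r"] by metis
  then obtain h where h: "\<And>i r. r \<le> d \<Longrightarrow> x r * Q i r = (\<Sum>j\<le>d. h i j * Q j r)"
    by metis
  have sym: "h i j * form (Q j) (Q j) = h j i * form (Q i) (Q i)" if "i \<le> d" "j \<le> d" for i j
  proof -
    have "form (\<lambda>r. x r * Q i r) (Q j) = form (\<lambda>r. x r * Q j r) (Q i)"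
      by (simp add: form_def mult_ac)
    then show ?thesis
      using form_Q_expand[OF h] that by simp
  qed
  have up: "(i + 1 < j \<longrightarrow> h i j = 0) \<and> (i + 1 = j \<longrightarrow> h i j \<noteq> 0)" if "i \<le> d" "j \<le> d" for i j
  proof (cases "i + 1 \<le> d")
    case True
    have "degree (pCons 0 (P i)) \<le> Suc i" "coeff (pCons 0 (P i)) (Suc i) \<noteq> 0"
      using P(1)[OF that(1)] P_lead[OF that(1)] by auto
    then obtain u where u: "\<forall>r\<le>d. poly (pCons 0 (P i)) (x r) = (\<Sum>j\<le>Suc i. u j * Q j r)" "u (Suc i) \<noteq> 0"
      using poly_expand[of "pCons 0 (P i)" "Suc i"] True by auto
    define v where "v j = (if j \<le> Suc i then u j else 0)" for j
    have "(\<Sum>j\<le>d. v j * Q j r) = (\<Sum>j\<le>Suc i. u j * Q j r)" for r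
      using True by (intro sum.mono_neutral_cong_right) (auto simp: v_def)
    then have "\<forall>r\<le>d. (\<Sum>j\<le>d. h i j * Q j r) = (\<Sum>j\<le>d. v j * Q j r)"
      using u(1) h[of _ i] P(2)[OF that(1)] by simp
    from Q_unique[OF this that(2)] show ?thesis
      using u(2) by (auto simp: v_def)
  qed (use that in auto)
  show ?thesis
  proof (rule that[of h])
    fix i j assume ij: "i \<le> d" "j \<le> d"
    show "h i j = 0" if "j + 1 < i \<or> i + 1 < j"
      using that sym[OF ij] up[OF ij] up[OF ij(2,1)] Q_norm[OF ij(2)] by auto
    show "h i j \<noteq> 0" if "j + 1 = i \<or> i + 1 = j"
      using that sym[OF ij] up[OF ij] up[OF ij(2,1)] Q_norm[OF ij(1)] by auto
  qed (rule h)
qed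

text \<open>The recurrence can be run downwards from d: a zero of \<open>Q d\<close> at r would
  propagate to all \<open>Q j\<close> and finally to \<open>Q 0\<close>.\<close>

lemma Q_d_nz:
  assumes r: "r \<le> d" shows "Q d r \<noteq> 0"
proof
  assume 0: "Q d r = 0"
  obtain h where h: "\<And>i r. \<lbrakk>i \<le> d; r \<le> d\<rbrakk> \<Longrightarrow> x r * Q i r = (\<Sum>j\<le>d. h i j * Q j r)"
    "\<And>i j. \<lbrakk>i \<le> d; j \<le> d; j + 1 < i \<or> i + 1 < j\<rbrakk> \<Longrightarrow> h i j = 0"
    "\<And>i j. \<lbrakk>i \<le> d; j \<le> d; j + 1 = i \<or> i + 1 = j\<rbrakk> \<Longrightarrow> h i j \<noteq> 0"
    by (rule three_term) blast
  have "m \<le> d \<longrightarrow> (\<forall>j. d - m \<le> j \<and> j \<le> d \<longrightarrow> Q j r = 0)" for m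
  proof (induction m)
    case 0
    then show ?case using \<open>Q d r = 0\<close> by auto
  next
    case (Suc m)
    show ?case
    proof (intro impI allI)
      fix j assume m: "Suc m \<le> d" and j: "d - Suc m \<le> j \<and> j \<le> d"
      define i where "i = d - m"
      have IH: "\<And>j. i \<le> j \<Longrightarrow> j \<le> d \<Longrightarrow> Q j r = 0" using Suc m by (auto simp: i_def)
      have i: "1 \<le> i" "i \<le> d" using m by (auto simp: i_def)
      have "0 = (\<Sum>j\<le>d. h i j * Q j r)"
        using h(1)[OF i(2) r] IH[of i] i by simp
      also have "\<dots> = (\<Sum>j\<le>d. if j = i - 1 then h i (i - 1) * Q (i - 1) r else 0)"
      proof (intro sum.cong refl)
        fix j assume "j \<in> {..d}"
        then show "h i j * Q j r = (if j = i - 1 then h i (i - 1) * Q (i - 1) r else 0)"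
          using h(2)[OF i(2), of j] IH[of j] by (cases "i \<le> j"; cases "j + 1 < i") auto
      qed
      also have "\<dots> = h i (i - 1) * Q (i - 1) r" using i by auto
      finally have "Q (i - 1) r = 0" using h(3)[OF i(2), of "i - 1"] i by auto
      moreover have "i \<le> j \<or> j = i - 1"
        using j by (auto simp: i_def)
      ultimately show "Q j r = 0"
        using IH[of j] j by auto
    qed
  qed
  from this[of d] have "Q 0 r = 0" by simp
  with Q_0[OF r] show False by simp
qed

end

section \<open>Row equations, and the recurrence for the dual eigenvalues\<close>

context leonard_data
begin

text \<open>\<open>T\<close> is diagonal on the \<open>Q i\<close>, and \<open>Q 0\<close>, ...,
  \<open>Q n\<close> span the polynomials of degree at most n in \<open>x\<close>.\<close>

lemma poly_T:
  assumes "degree p \<le> n" and "n \<le> d"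
  shows "\<exists>q. degree q \<le> n \<and> (\<forall>r\<le>d. T (\<lambda>s. poly p (x s)) r = poly q (x r))"
proof -
  obtain u where u: "\<forall>r\<le>d. poly p (x r) = (\<Sum>i\<le>n. u i * Q i r)"
    using poly_expand[OF assms] by blast
  define q where "q = (\<Sum>i\<le>n. Polynomial.smult (u i * th i) (P i))"
  have "degree q \<le> n"
    unfolding q_def
  proof (intro degree_sum_le)
    fix i assume "i \<in> {..n}"
    then show "degree (Polynomial.smult (u i * th i) (P i)) \<le> n"
      using assms(2) P(1)[of i] degree_smult_le[of "u i * th i" "P i"] by simp
  qed simp
  moreover have "T (\<lambda>s. poly p (x s)) r = poly q (x r)" if "r \<le> d" for r
  proof -
    have "T (\<lambda>s. poly p (x s)) r = (\<Sum>i\<le>n. u i * th i * Q i r)"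
      using u assms(2) that by (intro T_expand) auto
    also have "\<dots> = poly q (x r)"
      using P(2)[OF _ that] assms(2) unfolding q_def poly_sum by (intro sum.cong) auto
    finally show ?thesis .
  qed
  ultimately show ?thesis by blast
qed

lemma row_diff: "T f r - th 0 * f r = c r * (f (r - 1) - f r) + b r * (f (r + 1) - f r)"
  by (simp add: T_def algebra_simps)

lemma row_Q_d:
  assumes "r \<le> d"
  shows "c r * (Q d (r - 1) - Q d r) + b r * (Q d (r + 1) - Q d r) = (th d - th 0) * Q d r"
  using T_Q[OF order.refl assms] row_diff[of "Q d" r] by (simp add: algebra_simps)

lemma row_x:
  assumes "1 \<le> d"
  shows "\<exists>s \<sigma>. \<forall>r\<le>d. c r * (x (r - 1) - x r) + b r * (x (r + 1) - x r) = s * x r - \<sigma>"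
proof -
  obtain q where q: "degree q \<le> 1" "\<forall>r\<le>d. T (\<lambda>s. poly [:0, 1:] (x s)) r = poly q (x r)"
    using poly_T[of "[:0, 1:]" 1] assms by auto
  obtain u v where "q = [:u, v:]"
    using q(1) by (metis One_nat_def degree_eq_zeroE degree_pCons_eq_if le_Suc_eq le_zero_eq nat.inject pCons_0_0 pCons_cases)
  with q(2) have "T x r = u + v * x r" if "r \<le> d" for r
    using that by (simp add: mult.commute)
  then have "\<forall>r\<le>d. c r * (x (r - 1) - x r) + b r * (x (r + 1) - x r) = (v - th 0) * x r - (- u)"
    unfolding row_diff[of x, symmetric] by (simp add: algebra_simps)
  then show ?thesis by blast
qed

lemma row_x_square:
  assumes "2 \<le> d"
  shows "\<exists>p. degree p \<le> 2 \<and>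
    (\<forall>r\<le>d. c r * (x (r - 1) - x r) * x (r - 1) + b r * (x (r + 1) - x r) * x (r + 1) = poly p (x r))"
proof -
  obtain q where q: "degree q \<le> 2" "\<forall>r\<le>d. T (\<lambda>s. poly [:0, 0, 1:] (x s)) r = poly q (x r)"
    using poly_T[of "[:0, 0, 1:]" 2] assms by auto
  obtain s \<sigma> where s: "\<forall>r\<le>d. c r * (x (r - 1) - x r) + b r * (x (r + 1) - x r) = s * x r - \<sigma>"
    using row_x assms by auto
  \<comment> \<open>The subtracted polynomial is \<open>th 0\<close> times the square of
    \<open>x\<close> plus \<open>x\<close> times the row of \<open>x\<close>; the first summand
    removes the diagonal part of \<open>T\<close>, the second the mixed products.\<close>
  define p where "p = q - [:0, - \<sigma>, th 0 + s:]"
  have "degree p \<le> 2"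
    unfolding p_def by (intro degree_diff_le q) simp
  moreover have "c r * (x (r - 1) - x r) * x (r - 1) + b r * (x (r + 1) - x r) * x (r + 1) = poly p (x r)"
    if r: "r \<le> d" for r
  proof -
    have "T (\<lambda>s. x s * x s) r = poly q (x r)"
      using q(2) r by simp
    then have "c r * (x (r - 1) * x (r - 1) - x r * x r) + b r * (x (r + 1) * x (r + 1) - x r * x r)
      = poly q (x r) - th 0 * (x r * x r)"
      using row_diff[of "\<lambda>s. x s * x s" r] by simp
    moreover have "x r * (c r * (x (r - 1) - x r) + b r * (x (r + 1) - x r)) = x r * (s * x r - \<sigma>)"
      using s r by simp
    ultimately show ?thesis
      by (simp add: p_def algebra_simps)
  qed
  ultimately show ?thesis by blast
qed

text \<open>The left side is the commutator of \<open>T\<close> and \<open>x\<close> applied to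
  \<open>Q d\<close>, in which the diagonal entries of \<open>T\<close> cancel. As
  \<open>x * Q d\<close> only has components d - 1 and d, eliminating \<open>Q (d - 1)\<close>
  leaves \<open>Q d\<close> times an affine function of \<open>x\<close>.\<close>

lemma row_x_Q_d:
  assumes "1 \<le> d"
  shows "\<exists>s \<sigma>. \<forall>r\<le>d. c r * (x (r - 1) - x r) * Q d (r - 1) + b r * (x (r + 1) - x r) * Q d (r + 1)
    = (s * x r - \<sigma>) * Q d r"
proof -
  obtain h where h: "\<And>i r. \<lbrakk>i \<le> d; r \<le> d\<rbrakk> \<Longrightarrow> x r * Q i r = (\<Sum>j\<le>d. h i j * Q j r)"
    "\<And>i j. \<lbrakk>i \<le> d; j \<le> d; j + 1 < i \<or> i + 1 < j\<rbrakk> \<Longrightarrow> h i j = 0"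
    by (rule three_term) blast
  define f where "f = (\<lambda>r. x r * Q d r)"
  have split: "(\<Sum>j\<le>d. h d j * g j) = h d (d - 1) * g (d - 1) + h d d * g d" for g
  proof -
    have "(\<Sum>j\<le>d. h d j * g j) = (\<Sum>j\<in>{d - 1, d}. h d j * g j)"
      using h(2)[of d] by (intro sum.mono_neutral_right) auto
    then show ?thesis using assms by simp
  qed
  have f: "f r = h d (d - 1) * Q (d - 1) r + h d d * Q d r" if "r \<le> d" for r
    using h(1)[of d r] that split[of "\<lambda>j. Q j r"] by (simp add: f_def)
  have Tf: "T f r = h d (d - 1) * (th (d - 1) * Q (d - 1) r) + h d d * (th d * Q d r)" if "r \<le> d" for r
    using T_expand[OF h(1)[of d] order.refl that] that split[of "\<lambda>j. th j * Q j r"]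
    by (simp add: f_def mult.assoc)
  have "c r * (x (r - 1) - x r) * Q d (r - 1) + b r * (x (r + 1) - x r) * Q d (r + 1)
    = ((th (d - 1) - th d) * x r - (th (d - 1) - th d) * h d d) * Q d r" if r: "r \<le> d" for r
  proof -
    have "c r * (x (r - 1) - x r) * Q d (r - 1) + b r * (x (r + 1) - x r) * Q d (r + 1)
      = T f r - x r * T (Q d) r"
      by (simp add: T_def f_def algebra_simps)
    also have "\<dots> = th (d - 1) * f r + h d d * (th d - th (d - 1)) * Q d r - x r * (th d * Q d r)"
      using Tf[OF r] f[OF r] T_Q[OF order.refl r] by (simp add: algebra_simps)
    finally show ?thesis by (simp add: f_def algebra_simps)
  qed
  then show ?thesis by blast
qed

lemma poly_cubic:
  fixes p :: "complex poly"
  assumes "degree p \<le> 3"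
  shows "poly p y = coeff p 0 + coeff p 1 * y + coeff p 2 * y^2 + coeff p 3 * y^3"
proof -
  have "poly p y = (\<Sum>i\<le>3. coeff p i * y ^ i)"
    unfolding poly_altdef using assms by (intro sum.mono_neutral_left) (auto simp: coeff_eq_0)
  also have "{..3::nat} = {0, 1, 2, 3}" by auto
  finally show ?thesis by simp
qed

text \<open>The function \<open>z\<close> below is chosen so that \<open>T z - th 0 z\<close> is \<open>x\<close> times a polynomial of
  degree 2 in \<open>x\<close>; as \<open>T\<close> respects the degree filtration and its eigenvalues are distinct, \<open>z\<close> is
  itself a cubic polynomial in \<open>x\<close>.\<close>

lemma x_recurrence:
  assumes "3 \<le> d"
  shows "\<exists>\<alpha> \<beta>. \<forall>i. 1 \<le> i \<and> i < d \<longrightarrow> x i = \<alpha> * (x (i - 1) + x i + x (i + 1)) + \<beta>"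
proof -
  define z where "z r = (\<Sum>s<r. x s * x (s + 1) * (x (s + 1) - x s))" for r
  have z_Suc: "z (Suc r) - z r = x r * x (r + 1) * (x (r + 1) - x r)" for r
    by (simp add: z_def)
  obtain p where p: "degree p \<le> 2"
    "\<forall>r\<le>d. c r * (x (r - 1) - x r) * x (r - 1) + b r * (x (r + 1) - x r) * x (r + 1) = poly p (x r)"
    using row_x_square assms by auto
  have Tz: "T z r - th 0 * z r = poly (pCons 0 p) (x r)" if r: "r \<le> d" for r
  proof -
    have "c r * (z (r - 1) - z r) = x r * (c r * (x (r - 1) - x r) * x (r - 1))"
    proof (cases r)
      case (Suc m)
      have "z (r - 1) - z r = x r * ((x (r - 1) - x r) * x (r - 1))"
        using z_Suc[of m] Suc by (simp add: algebra_simps)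
      then show ?thesis by (simp only: mult_ac)
    qed (simp add: c_0)
    moreover have "b r * (z (r + 1) - z r) = x r * (b r * (x (r + 1) - x r) * x (r + 1))"
    proof -
      have "z (r + 1) - z r = x r * ((x (r + 1) - x r) * x (r + 1))"
        using z_Suc[of r] by (simp add: algebra_simps)
      then show ?thesis by (simp only: mult_ac)
    qed
    ultimately have "T z r - th 0 * z r
       = x r * (c r * (x (r - 1) - x r) * x (r - 1) + b r * (x (r + 1) - x r) * x (r + 1))"
      unfolding row_diff distrib_left by presburger
    then show ?thesis using p(2) r by simp
  qed
  have "degree (pCons 0 p) \<le> 3"
    using p(1) by (simp add: degree_pCons_eq_if)
  then obtain v where v: "\<forall>r\<le>d. poly (pCons 0 p) (x r) = (\<Sum>i\<le>3. v i * Q i r)"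
    using poly_expand assms by blast
  obtain u where u: "\<And>r. r \<le> d \<Longrightarrow> z r = (\<Sum>i\<le>d. u i * Q i r)"
    using Q_expand by blast
  have "(\<Sum>i\<le>d. (u i * (th i - th 0)) * Q i r) = (\<Sum>i\<le>d. (if i \<le> 3 then v i else 0) * Q i r)"
    if r: "r \<le> d" for r
  proof -
    have "(\<Sum>i\<le>d. (u i * (th i - th 0)) * Q i r) = T z r - th 0 * z r"
    proof -
      have "T z r = (\<Sum>i\<le>d. u i * th i * Q i r)"
        by (rule T_expand[OF u order.refl r])
      then show ?thesis
        by (simp add: u[OF r] sum_distrib_left sum_subtractf[symmetric] algebra_simps)
    qed
    also have "\<dots> = (\<Sum>i\<le>3. v i * Q i r)"
      using Tz[OF r] v r by simp
    also have "\<dots> = (\<Sum>i\<le>d. (if i \<le> 3 then v i else 0) * Q i r)"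
      using assms by (intro sum.mono_neutral_cong_left) auto
    finally show ?thesis .
  qed
  \<comment> \<open>Both sides are coordinates of \<open>T z - th 0 * z\<close>. For i > 3 the
    factor \<open>th i - th 0\<close> is nonzero, so z has no component beyond 3.\<close>
  then have uv: "u i * (th i - th 0) = (if i \<le> 3 then v i else 0)" if "i \<le> d" for i
    by (intro Q_unique that) simp
  have u0: "u i = 0" if "3 < i" "i \<le> d" for i
  proof -
    have "th i \<noteq> th 0" using th_inj that by (auto simp: inj_on_def)
    then show ?thesis using uv[OF that(2)] that(1) by simp
  qed
  define q where "q = (\<Sum>i\<le>3. Polynomial.smult (u i) (P i))"
  have "degree q \<le> 3"
    unfolding q_def
  proof (intro degree_sum_le)
    fix i :: nat assume "i \<in> {..3}"
    then show "degree (Polynomial.smult (u i) (P i)) \<le> 3"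
      using assms P(1)[of i] degree_smult_le[of "u i" "P i"] by simp
  qed simp
  define a where "a = coeff q"
  have z: "z r = a 0 + a 1 * x r + a 2 * (x r)^2 + a 3 * (x r)^3" if r: "r \<le> d" for r
  proof -
    have "z r = (\<Sum>i\<le>3. u i * Q i r)"
      unfolding u[OF r] using assms u0 by (intro sum.mono_neutral_right) auto
    also have "\<dots> = poly q (x r)"
      using P(2)[OF _ r] assms unfolding q_def poly_sum by (intro sum.cong) auto
    finally show ?thesis
      using poly_cubic[OF \<open>degree q \<le> 3\<close>] by (simp add: a_def)
  qed
  \<comment> \<open>Take the difference of the cubic expression for z at r + 1 and r, and cancel
    \<open>x (r + 1) - x r\<close>.\<close>
  have prod: "x r * x (r + 1)
      = a 1 + a 2 * (x r + x (r + 1)) + a 3 * ((x r)^2 + x r * x (r + 1) + (x (r + 1))^2)"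
    if r: "r < d" for r
  proof -
    have "(x (r + 1) - x r) * (x r * x (r + 1))
      = (x (r + 1) - x r) * (a 1 + a 2 * (x r + x (r + 1)) + a 3 * ((x r)^2 + x r * x (r + 1) + (x (r + 1))^2))"
      using z_Suc[of r] z[of r] z[of "r + 1"] r by (simp add: algebra_simps power2_eq_square power3_eq_cube)
    moreover have "x (r + 1) - x r \<noteq> 0"
      using inj_on_eq_iff[OF x_inj, of "r + 1" r] r by simp
    ultimately show ?thesis
      by (simp only: mult_cancel_left) simp
  qed
  \<comment> \<open>Two consecutive instances of \<open>prod\<close> are subtracted, and the common
    factor \<open>x (i + 1) - x (i - 1)\<close> is cancelled.\<close>
  have "x i = a 3 * (x (i - 1) + x i + x (i + 1)) + a 2" if i: "1 \<le> i" "i < d" for i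
  proof -
    have "x (i - 1) * x i = a 1 + a 2 * (x (i - 1) + x i) + a 3 * ((x (i - 1))^2 + x (i - 1) * x i + (x i)^2)"
      using prod[of "i - 1"] i by simp
    then have "(x (i + 1) - x (i - 1)) * x i
      = (x (i + 1) - x (i - 1)) * (a 3 * (x (i - 1) + x i + x (i + 1)) + a 2)"
      using prod[of i] i by (simp add: algebra_simps power2_eq_square)
    moreover have "x (i + 1) - x (i - 1) \<noteq> 0"
      using inj_on_eq_iff[OF x_inj, of "i + 1" "i - 1"] i by simp
    ultimately show ?thesis
      by (simp only: mult_cancel_left) simp
  qed
  then show ?thesis by blast
qed

end

section \<open>Data determined by the dual eigenvalues and the last eigenvector\<close>

text \<open>The rows of \<open>x\<close>, of \<open>x * Q d\<close> and of \<open>Q d\<close>, with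
  \<open>g\<close> in the place of \<open>Q d\<close>. They are linear and homogeneous in
  \<open>b\<close>, \<open>c\<close> and the five scalars jointly, so two solutions can be
  subtracted. The set R admits only part of the rows, as needed when g is known on an initial
  segment.\<close>

definition rows :: "(nat \<Rightarrow> complex) \<Rightarrow> (nat \<Rightarrow> complex) \<Rightarrow> nat set \<Rightarrow> (nat \<Rightarrow> complex) \<Rightarrow>
    (nat \<Rightarrow> complex) \<Rightarrow> complex \<Rightarrow> complex \<Rightarrow> complex \<Rightarrow> complex \<Rightarrow> complex \<Rightarrow> bool" where
  "rows x g R b c s \<sigma> s' \<sigma>' t \<longleftrightarrow> (\<forall>r\<in>R.
     c r * (x (r - 1) - x r) + b r * (x (r + 1) - x r) = s * x r - \<sigma> \<and>
     c r * ((x (r - 1) - x r) * g (r - 1)) + b r * ((x (r + 1) - x r) * g (r + 1))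
       = (s' * x r - \<sigma>') * g r \<and>
     c r * (g (r - 1) - g r) + b r * (g (r + 1) - g r) = t * g r)"

lemma linear_combination:
  fixes b c :: complex
  assumes "c * X + b * Y = R" and "c' * X + b' * Y = R'"
  shows "(c' - \<mu> * c) * X + (b' - \<mu> * b) * Y = R' - \<mu> * R"
  unfolding assms[symmetric] by (simp add: algebra_simps)

lemma rows_diff:
  assumes "rows x g R b c s \<sigma> s' \<sigma>' t" and "rows x g R u v p \<pi> p' \<pi>' q"
  shows "rows x g R (\<lambda>r. u r - \<mu> * b r) (\<lambda>r. v r - \<mu> * c r) (p - \<mu> * s) (\<pi> - \<mu> * \<sigma>)
    (p' - \<mu> * s') (\<pi>' - \<mu> * \<sigma>') (q - \<mu> * t)"
  unfolding rows_def
proof (intro ballI conjI)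
  fix r assume r: "r \<in> R"
  note e = assms[unfolded rows_def, rule_format, OF r]
  show "(v r - \<mu> * c r) * (x (r - 1) - x r) + (u r - \<mu> * b r) * (x (r + 1) - x r)
     = (p - \<mu> * s) * x r - (\<pi> - \<mu> * \<sigma>)"
    using linear_combination[OF conjunct1[OF e(1)] conjunct1[OF e(2)], of \<mu>] by (simp add: algebra_simps)
  show "(v r - \<mu> * c r) * ((x (r - 1) - x r) * g (r - 1)) + (u r - \<mu> * b r) * ((x (r + 1) - x r) * g (r + 1))
     = ((p' - \<mu> * s') * x r - (\<pi>' - \<mu> * \<sigma>')) * g r"
    using linear_combination[OF conjunct1[OF conjunct2[OF e(1)]] conjunct1[OF conjunct2[OF e(2)]], of \<mu>]
    by (simp only: algebra_simps)
  show "(v r - \<mu> * c r) * (g (r - 1) - g r) + (u r - \<mu> * b r) * (g (r + 1) - g r) = (q - \<mu> * t) * g r"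
    using linear_combination[OF conjunct2[OF conjunct2[OF e(1)]] conjunct2[OF conjunct2[OF e(2)]], of \<mu>]
    by (simp only: algebra_simps)
qed

text \<open>Row r reads the values at r + 1, whence the condition that r + 1 is still in the known
  range or \<open>b r\<close> is zero. The scalars \<sigma> and \<sigma>' absorb the translation,
  while the scale \<nu> of g cancels.\<close>

lemma rows_transfer:
  assumes rows: "rows x' g' R b c s \<sigma> s' \<sigma>' t" and "\<zeta> \<noteq> 0" and "\<nu> \<noteq> 0"
    and x': "\<And>r. r \<le> n \<Longrightarrow> x' r = \<xi> + \<zeta> * x r" and g': "\<And>r. r \<le> n \<Longrightarrow> g' r = \<nu> * g r"
    and R: "\<And>r. r \<in> R \<Longrightarrow> r \<le> n \<and> (r < n \<or> b r = 0)"
  shows "rows x g R b c s ((\<sigma> - s * \<xi>) / \<zeta>) s' ((\<sigma>' - s' * \<xi>) / \<zeta>) t"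
  unfolding rows_def
proof (intro ballI)
  fix r assume r: "r \<in> R"
  define l u where "l = r - 1" and "u = r + 1"
  note e = rows[unfolded rows_def, rule_format, OF r, folded l_def u_def]
  have lower: "x' r = \<xi> + \<zeta> * x r" "x' (l) = \<xi> + \<zeta> * x (l)"
      "g' r = \<nu> * g r" "g' (l) = \<nu> * g (l)"
    using R[OF r] by (auto simp: l_def intro!: x' g')
  have upper: "b r * f (x' (u)) (g' (u)) = b r * f (\<xi> + \<zeta> * x (u)) (\<nu> * g (u))" for f
    using R[OF r] x'[of "u"] g'[of "u"] by (auto simp: u_def)
  have "c r * (\<zeta> * (x (l) - x r)) + b r * (\<zeta> * (x (u) - x r)) = s * (\<xi> + \<zeta> * x r) - \<sigma>"
    using e upper[of "\<lambda>p q. p - x' r"] by (simp add: lower algebra_simps)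
  then have "\<zeta> * (c r * (x (l) - x r) + b r * (x (u) - x r)) = s * (\<xi> + \<zeta> * x r) - \<sigma>"
    by (simp add: algebra_simps)
  then have 1: "c r * (x (l) - x r) + b r * (x (u) - x r) = s * x r - (\<sigma> - s * \<xi>) / \<zeta>"
    using \<open>\<zeta> \<noteq> 0\<close> by (simp add: field_simps)
  have "c r * ((\<zeta> * (x (l) - x r)) * (\<nu> * g (l))) + b r * ((\<zeta> * (x (u) - x r)) * (\<nu> * g (u)))
      = (s' * (\<xi> + \<zeta> * x r) - \<sigma>') * (\<nu> * g r)"
    using conjunct1[OF conjunct2[OF e]] unfolding lower upper[of "\<lambda>p q. (p - (\<xi> + \<zeta> * x r)) * q"]
    by (simp add: algebra_simps)
  then have "(\<zeta> * \<nu>) * (c r * ((x (l) - x r) * g (l)) + b r * ((x (u) - x r) * g (u)))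
      = \<nu> * ((s' * (\<xi> + \<zeta> * x r) - \<sigma>') * g r)"
    by (simp add: algebra_simps)
  also have "\<dots> = (\<zeta> * \<nu>) * ((s' * x r - (\<sigma>' - s' * \<xi>) / \<zeta>) * g r)"
    using \<open>\<zeta> \<noteq> 0\<close> by (simp add: field_simps)
  finally have 2: "c r * ((x (l) - x r) * g (l)) + b r * ((x (u) - x r) * g (u))
      = (s' * x r - (\<sigma>' - s' * \<xi>) / \<zeta>) * g r"
    using \<open>\<zeta> \<noteq> 0\<close> \<open>\<nu> \<noteq> 0\<close> by simp
  have "c r * (\<nu> * (g (l) - g r)) + b r * (\<nu> * (g (u) - g r)) = t * (\<nu> * g r)"
    using conjunct2[OF conjunct2[OF e]] unfolding lower upper[of "\<lambda>p q. q - \<nu> * g r"]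
    by (simp add: algebra_simps)
  then have "\<nu> * (c r * (g (l) - g r) + b r * (g (u) - g r)) = \<nu> * (t * g r)"
    by (simp add: algebra_simps)
  then have 3: "c r * (g (l) - g r) + b r * (g (u) - g r) = t * g r"
    using \<open>\<nu> \<noteq> 0\<close> by simp
  show "c r * (x (r - 1) - x r) + b r * (x (r + 1) - x r) = s * x r - (\<sigma> - s * \<xi>) / \<zeta> \<and>
     c r * ((x (r - 1) - x r) * g (r - 1)) + b r * ((x (r + 1) - x r) * g (r + 1))
       = (s' * x r - (\<sigma>' - s' * \<xi>) / \<zeta>) * g r \<and>
     c r * (g (r - 1) - g r) + b r * (g (r + 1) - g r) = t * g r"
    using 1 2 3 unfolding l_def u_def by blast
qed

text \<open>In the rows 0 and d only one neighbour occurs, so there the rows of \<open>x\<close> and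
  \<open>x * Q d\<close> combine with that of \<open>Q d\<close> to an equation from which
  \<open>Q d\<close> cancels. The difference of the two end equations is the last clause; it later
  stands in for row d when \<open>Q d\<close> is not known there.\<close>

lemma (in leonard_data) rows_Q_d:
  assumes "1 \<le> d"
  shows "\<exists>s \<sigma> s' \<sigma>'. rows x (Q d) {..d} b c s \<sigma> s' \<sigma>' (th d - th 0) \<and>
    (s' - s) * (x 0 - x d) = (th d - th 0) * (x 1 - x 0 - (x (d - 1) - x d))"
proof -
  define t where "t = th d - th 0"
  obtain s \<sigma> where 1: "\<forall>r\<le>d. c r * (x (r - 1) - x r) + b r * (x (r + 1) - x r) = s * x r - \<sigma>"
    using row_x[OF assms] by blast
  obtain s' \<sigma>' where 2: "\<forall>r\<le>d. c r * (x (r - 1) - x r) * Q d (r - 1) + b r * (x (r + 1) - x r) * Q d (r + 1)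
    = (s' * x r - \<sigma>') * Q d r"
    using row_x_Q_d[OF assms] by blast
  have 3: "c r * (Q d (r - 1) - Q d r) + b r * (Q d (r + 1) - Q d r) = t * Q d r" if "r \<le> d" for r
    using row_Q_d[OF that] by (simp add: t_def)
  have "rows x (Q d) {..d} b c s \<sigma> s' \<sigma>' t"
    unfolding rows_def using 1 2 3 by (simp add: mult.assoc)
  moreover have "(s' - s) * (x 0 - x d) = t * (x 1 - x 0 - (x (d - 1) - x d))"
  proof -
    have "(s' * x 0 - \<sigma>' - (s * x 0 - \<sigma>)) * Q d 0 = b 0 * (x 1 - x 0) * (Q d 1 - Q d 0)"
    proof -
      have "s * x 0 - \<sigma> = b 0 * (x 1 - x 0)"
        using 1[rule_format, of 0] by (simp add: c_0)
      moreover have "(s' * x 0 - \<sigma>') * Q d 0 = b 0 * (x 1 - x 0) * Q d 1"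
        using 2[rule_format, of 0] by (simp add: c_0)
      ultimately show ?thesis by (simp only: left_diff_distrib right_diff_distrib)
    qed
    also have "\<dots> = t * (x 1 - x 0) * Q d 0"
      using 3[of 0] by (simp add: c_0 mult_ac)
    finally have e0: "s' * x 0 - \<sigma>' - (s * x 0 - \<sigma>) = t * (x 1 - x 0)"
      using Q_d_nz[of 0] by simp
    have "(s' * x d - \<sigma>' - (s * x d - \<sigma>)) * Q d d
        = c d * (x (d - 1) - x d) * (Q d (d - 1) - Q d d)"
    proof -
      have "s * x d - \<sigma> = c d * (x (d - 1) - x d)"
        using 1[rule_format, of d] by (simp add: b_d)
      moreover have "(s' * x d - \<sigma>') * Q d d = c d * (x (d - 1) - x d) * Q d (d - 1)"
        using 2[rule_format, of d] by (simp add: b_d)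
      ultimately show ?thesis by (simp only: left_diff_distrib right_diff_distrib)
    qed
    also have "\<dots> = t * (x (d - 1) - x d) * Q d d"
      using 3[of d] by (simp add: b_d mult_ac)
    finally have "s' * x d - \<sigma>' - (s * x d - \<sigma>) = t * (x (d - 1) - x d)"
      using Q_d_nz[of d] by simp
    note ed = this
    have "(s' - s) * (x 0 - x d) = s' * x 0 - \<sigma>' - (s * x 0 - \<sigma>) - (s' * x d - \<sigma>' - (s * x d - \<sigma>))"
      by (simp add: algebra_simps)
    then show ?thesis unfolding e0 ed by (simp only: right_diff_distrib)
  qed
  ultimately show ?thesis unfolding t_def by blast
qed

lemma (in leonard_data) affine_nonconstant:
  assumes "inj_on x' {..d}" and "1 \<le> n" and "n \<le> d" and "\<And>r. r \<le> n \<Longrightarrow> x' r = \<xi> + \<zeta> * x r"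
  shows "\<zeta> \<noteq> 0"
proof
  assume "\<zeta> = 0"
  then have "x' 0 = x' 1" using assms(2,4) by simp
  then show False using assms(1,2,3) inj_on_eq_iff[OF assms(1), of 0 1] by simp
qed

text \<open>A multiple of one solution of the row equations is subtracted from the other so that row
  0 becomes zero. Then row 0 kills the scalar of the third equation, row d kills the remaining ones,
  and each interior row is left with the zero solution only.\<close>

theorem leonard_data_determined:
  assumes 1: "leonard_data d b c x Q th" and 2: "leonard_data d b' c' x' Q' th'" and d: "1 \<le> d"
    and x': "\<And>r. r \<le> d \<Longrightarrow> x' r = \<xi> + \<zeta> * x r"
    and Q': "\<And>r. r \<le> d \<Longrightarrow> Q' d r = \<nu> * Q d r"
    and c1: "c 1 = 1" "c' 1 = 1" and r: "r \<le> d"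
  shows "b' r = b r" and "c' r = c r"
proof -
  interpret L1: leonard_data d b c x Q th by (rule 1)
  interpret L2: leonard_data d b' c' x' Q' th' by (rule 2)
  define t where "t = th d - th 0"
  have x_eq: "x i = x j \<longleftrightarrow> i = j" if "i \<le> d" "j \<le> d" for i j
    using inj_on_eq_iff[OF L1.x_inj] that by auto
  have t: "t \<noteq> 0"
    using inj_on_eq_iff[OF L1.th_inj, of d 0] d by (simp add: t_def)
  have \<zeta>: "\<zeta> \<noteq> 0"
    by (rule L1.affine_nonconstant[OF L2.x_inj d order.refl x'])
  have \<nu>: "\<nu> \<noteq> 0"
    using L2.Q_d_nz[of 0] Q'[of 0] by auto
  define g where "g = Q d"
  have g: "g i \<noteq> 0" if "i \<le> d" for i
    using L1.Q_d_nz that by (simp add: g_def)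
  obtain s \<sigma> s' \<sigma>' where rows1: "rows x g {..d} b c s \<sigma> s' \<sigma>' t"
    using L1.rows_Q_d[OF d] unfolding g_def t_def by blast
  obtain p \<pi> p' \<pi>' q where rows2: "rows x g {..d} b' c' p \<pi> p' \<pi>' q"
  proof -
    obtain p \<pi> p' \<pi>' q where rows': "rows x' (Q' d) {..d} b' c' p \<pi> p' \<pi>' q"
      using L2.rows_Q_d[OF d] by blast
    show thesis
      by (rule that, rule rows_transfer[OF rows' \<zeta> \<nu> x' Q'[folded g_def]]) (use L2.b_d in \<open>auto simp: le_less\<close>)
  qed
  \<comment> \<open>This makes \<open>B 0 = 0\<close>. That \<mu> is 1 is read off from row 1 at the
    very end, by \<open>c 1 = c' 1\<close>.\<close>
  define \<mu> where "\<mu> = b' 0 / b 0"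
  define B where "B r = b' r - \<mu> * b r" for r
  define C where "C r = c' r - \<mu> * c r" for r
  obtain S \<Sigma> S' \<Sigma>' \<tau> where rows: "rows x g {..d} B C S \<Sigma> S' \<Sigma>' \<tau>"
    using rows_diff[OF rows1 rows2, of \<mu>] unfolding B_def C_def by blast
  have r1: "C r * (x (r - 1) - x r) + B r * (x (r + 1) - x r) = S * x r - \<Sigma>"
    and r2: "C r * ((x (r - 1) - x r) * g (r - 1)) + B r * ((x (r + 1) - x r) * g (r + 1)) = (S' * x r - \<Sigma>') * g r"
    and r3: "C r * (g (r - 1) - g r) + B r * (g (r + 1) - g r) = \<tau> * g r" if "r \<le> d" for r
    using rows that unfolding rows_def by auto
  have real: "c r * (g (r - 1) - g r) + b r * (g (r + 1) - g r) = t * g r" if "r \<le> d" for r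
    using rows1 that unfolding rows_def by auto
  have B0: "B 0 = 0" "C 0 = 0" "B d = 0"
    using L1.b_nz[of 0] d L1.c_0 L2.c_0 L1.b_d L2.b_d by (simp_all add: B_def C_def \<mu>_def)
  have \<tau>: "\<tau> = 0" and S0: "S * x 0 = \<Sigma>" "S' * x 0 = \<Sigma>'"
    using r1[of 0] r2[of 0] r3[of 0] g[of 0] by (auto simp: B0)
  \<comment> \<open>Otherwise row d of the first data would read \<open>0 = t * g d\<close>.\<close>
  have "g (d - 1) \<noteq> g d"
    using real[of d] t g[of d] by (auto simp: L1.b_d)
  then have Cd: "C d = 0"
    using r3[of d] by (simp add: B0 \<tau>)
  have "S * (x d - x 0) = 0" "S' * (x d - x 0) * g d = 0"
    using r1[of d] r2[of d] by (auto simp: B0 Cd S0[symmetric] algebra_simps)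
  then have S: "S = 0" "S' = 0"
    using x_eq[of d 0] d g[of d] by auto
  have BC: "B r = 0 \<and> C r = 0" if r: "r \<le> d" for r
  proof (cases "r = 0 \<or> r = d")
    case True
    then show ?thesis using B0 Cd by auto
  next
    case False
    then have r': "0 < r" "r < d" using r by auto
    have neq: "x (r - 1) \<noteq> x (r + 1)" "x (r - 1) \<noteq> x r" "x (r + 1) \<noteq> x r"
      using r' by (auto simp: x_eq)
    have e1: "C r * (x (r - 1) - x r) = - (B r * (x (r + 1) - x r))"
      using r1[OF r] by (simp add: S S0[symmetric] add_eq_0_iff2)
    have "(C r * (x (r - 1) - x r)) * g (r - 1) + (B r * (x (r + 1) - x r)) * g (r + 1) = 0"
      using r2[OF r] by (simp add: S S0[symmetric] mult.assoc)
    then have "B r * (x (r + 1) - x r) * (g (r + 1) - g (r - 1)) = 0"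
      unfolding e1 by (simp add: algebra_simps)
    then consider "B r = 0" | "g (r + 1) = g (r - 1)"
      using neq by auto
    then show ?thesis
    proof cases
      case 1
      then show ?thesis using e1 neq by auto
    next
      \<comment> \<open>The first two equations coincide here. The third one for the original data
        shows \<open>g (r - 1) \<noteq> g r\<close>, so for the difference, where its right side is
        0, it gives \<open>C r = - B r\<close>.\<close>
      case 2
      have "(c r + b r) * (g (r - 1) - g r) \<noteq> 0"
        using real[OF r] 2 t g[OF r] by (simp add: distrib_right)
      moreover have "(C r + B r) * (g (r - 1) - g r) = 0"
        using r3[OF r] 2 \<tau> by (simp add: distrib_right)
      ultimately have "C r = - B r"
        by (simp add: add_eq_0_iff2)
      then have "B r * (x (r + 1) - x (r - 1)) = 0"
        using e1 by (simp add: algebra_simps)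
      then show ?thesis using neq \<open>C r = - B r\<close> by auto
    qed
  qed
  have "\<mu> = 1"
    using BC[of 1] d c1 by (simp add: C_def)
  then show "b' r = b r" "c' r = c r"
    using BC[OF r] by (simp_all add: B_def C_def)
qed

lemma quadratic_zero:
  fixes p :: "complex poly"
  assumes "degree p \<le> 2" and "poly p u = 0" "poly p v = 0" "poly p w = 0"
    and "u \<noteq> v" "u \<noteq> w" "v \<noteq> w"
  shows "p = 0"
proof (rule ccontr)
  assume p: "p \<noteq> 0"
  have "card {u, v, w} \<le> card {y. poly p y = 0}"
    using assms p by (intro card_mono poly_roots_finite) auto
  also have "\<dots> \<le> degree p"
    using p by (rule poly_roots_degree)
  finally show False
    using assms by simp
qed

text \<open>Four consecutive values determine both constants of the recurrence: \<alpha> is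
  invariant under affine maps and \<beta> transforms accordingly. As \<open>x 1\<close> and
  \<open>x 2\<close> differ, \<alpha> is nonzero, and the recurrence can be solved for the next
  value.\<close>

lemma affine_extends:
  assumes 1: "leonard_data d b c x Q th" and 2: "leonard_data d b' c' x' Q' th'"
    and d: "3 \<le> d" and x': "\<And>r. r \<le> 3 \<Longrightarrow> x' r = \<xi> + \<zeta> * x r" and r: "r \<le> d"
  shows "x' r = \<xi> + \<zeta> * x r"
proof -
  interpret L1: leonard_data d b c x Q th by (rule 1)
  interpret L2: leonard_data d b' c' x' Q' th' by (rule 2)
  have x_eq: "x i = x j \<longleftrightarrow> i = j" if "i \<le> d" "j \<le> d" for i j
    using inj_on_eq_iff[OF L1.x_inj] that by auto
  have x'_eq: "x' i = x' j \<longleftrightarrow> i = j" if "i \<le> d" "j \<le> d" for i j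
    using inj_on_eq_iff[OF L2.x_inj] that by auto
  have \<zeta>: "\<zeta> \<noteq> 0"
    using L1.affine_nonconstant[OF L2.x_inj _ d x'] by simp
  obtain \<alpha> \<beta> where rec: "\<And>i. \<lbrakk>1 \<le> i; i < d\<rbrakk> \<Longrightarrow> x i = \<alpha> * (x (i - 1) + x i + x (i + 1)) + \<beta>"
    using L1.x_recurrence[OF d] by blast
  obtain \<alpha>' \<beta>' where rec': "\<And>i. \<lbrakk>1 \<le> i; i < d\<rbrakk> \<Longrightarrow> x' i = \<alpha>' * (x' (i - 1) + x' i + x' (i + 1)) + \<beta>'"
    using L2.x_recurrence[OF d] by blast
  have e1: "x 1 = \<alpha> * (x 0 + x 1 + x 2) + \<beta>" and e2: "x 2 = \<alpha> * (x 1 + x 2 + x 3) + \<beta>"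
    using rec[of 1] rec[of 2] d by (simp_all add: numeral_2_eq_2 numeral_3_eq_3)
  have e1': "x' 1 = \<alpha>' * (x' 0 + x' 1 + x' 2) + \<beta>'" and e2': "x' 2 = \<alpha>' * (x' 1 + x' 2 + x' 3) + \<beta>'"
    using rec'[of 1] rec'[of 2] d by (simp_all add: numeral_2_eq_2 numeral_3_eq_3)
  have d1: "x 2 - x 1 = \<alpha> * (x 3 - x 0)"
  proof -
    have "x 2 - x 1 = (\<alpha> * (x 1 + x 2 + x 3) + \<beta>) - (\<alpha> * (x 0 + x 1 + x 2) + \<beta>)"
      using e1 e2 by presburger
    then show ?thesis by (simp add: algebra_simps)
  qed
  have d2: "x' 2 - x' 1 = \<alpha>' * (x' 3 - x' 0)"
  proof -
    have "x' 2 - x' 1 = (\<alpha>' * (x' 1 + x' 2 + x' 3) + \<beta>') - (\<alpha>' * (x' 0 + x' 1 + x' 2) + \<beta>')"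
      using e1' e2' by presburger
    then show ?thesis by (simp add: algebra_simps)
  qed
  have "\<zeta> * (x 2 - x 1) = \<zeta> * (\<alpha>' * (x 3 - x 0))"
    using d2 by (simp add: x' algebra_simps)
  then have "\<alpha>' * (x 3 - x 0) = \<alpha> * (x 3 - x 0)"
    using \<zeta> d1 by simp
  then have \<alpha>': "\<alpha>' = \<alpha>"
    using x_eq[of 3 0] d by simp
  have \<alpha>: "\<alpha> \<noteq> 0"
    using d1 x_eq[of 2 1] d by auto
  have "\<xi> + \<zeta> * x 1 = \<alpha> * (3 * \<xi> + \<zeta> * (x 0 + x 1 + x 2)) + \<beta>'"
    using e1' by (simp add: x' \<alpha>' algebra_simps)
  moreover have "\<zeta> * x 1 = \<alpha> * (\<zeta> * (x 0 + x 1 + x 2)) + \<zeta> * \<beta>"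
  proof -
    have "\<zeta> * x 1 = \<zeta> * (\<alpha> * (x 0 + x 1 + x 2) + \<beta>)"
      using e1 by presburger
    then show ?thesis by (simp add: algebra_simps)
  qed
  ultimately have \<beta>': "\<beta>' = \<xi> - \<alpha> * (3 * \<xi>) + \<zeta> * \<beta>"
    by Groebner_Basis.algebra
  show ?thesis
    using r
  proof (induction r rule: less_induct)
    case (less r)
    show ?case
    proof (cases "r \<le> 3")
      case False
      define i where "i = r - 1"
      have i: "1 \<le> i" "i < d" "r = i + 1" using False less.prems by (auto simp: i_def)
      have IH: "x' i = \<xi> + \<zeta> * x i" "x' (i - 1) = \<xi> + \<zeta> * x (i - 1)"
        using less.IH[of i] less.IH[of "i - 1"] i by auto
      have "\<alpha> * x' (i + 1) = x' i - \<alpha> * (x' (i - 1) + x' i) - \<beta>'"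
      proof -
        have "x' i = \<alpha> * (x' (i - 1) + x' i + x' (i + 1)) + \<beta>'"
          using rec'[OF i(1,2)] \<alpha>' by simp
        then show ?thesis by (simp add: algebra_simps)
      qed
      also have "\<dots> = \<zeta> * x i + \<alpha> * \<xi> - \<alpha> * (\<zeta> * (x (i - 1) + x i)) - \<zeta> * \<beta>"
        unfolding IH \<beta>' by (simp add: algebra_simps)
      also have "\<dots> = \<alpha> * (\<xi> + \<zeta> * x (i + 1))"
      proof -
        have "\<zeta> * x i = \<zeta> * (\<alpha> * (x (i - 1) + x i + x (i + 1)) + \<beta>)"
          using rec[OF i(1,2)] by presburger
        then show ?thesis by (simp add: algebra_simps)
      qed
      finally show ?thesis using \<alpha> i(3) by simp
    qed (simp add: x')
  qed
qed

text \<open>By \<open>affine_extends\<close> everything that involves \<open>x\<close> alone is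
  available in all rows, whereas rows containing \<open>Q d\<close> are only available below w; of
  these, rows 0, 1 and 2 suffice.\<close>

theorem leonard_data_determined_by_part:
  assumes 1: "leonard_data d b c x Q th" and 2: "leonard_data d b' c' x' Q' th'"
    and w: "3 \<le> w" "w \<le> d"
    and x'_w: "\<And>r. r \<le> w \<Longrightarrow> x' r = \<xi> + \<zeta> * x r"
    and Q': "\<And>r. r \<le> w \<Longrightarrow> Q' d r = \<nu> * Q d r"
    and c1: "c 1 = 1" "c' 1 = 1" and r: "r \<le> d"
  shows "b' r = b r" and "c' r = c r"
proof -
  interpret L1: leonard_data d b c x Q th by (rule 1)
  interpret L2: leonard_data d b' c' x' Q' th' by (rule 2)
  have d: "3 \<le> d" using w by simp
  have x': "x' r = \<xi> + \<zeta> * x r" if "r \<le> d" for r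
    using affine_extends[OF 1 2 d _ that] x'_w w by simp
  define t where "t = th d - th 0"
  have x_eq: "x i = x j \<longleftrightarrow> i = j" if "i \<le> d" "j \<le> d" for i j
    using inj_on_eq_iff[OF L1.x_inj] that by auto
  have t: "t \<noteq> 0"
    using inj_on_eq_iff[OF L1.th_inj, of d 0] d by (simp add: t_def)
  have \<zeta>: "\<zeta> \<noteq> 0"
    using L1.affine_nonconstant[OF L2.x_inj _ order.refl x'] d by simp
  have \<nu>: "\<nu> \<noteq> 0"
    using L2.Q_d_nz[of 0] Q'[of 0] by auto
  define g where "g = Q d"
  have g: "g i \<noteq> 0" if "i \<le> d" for i
    using L1.Q_d_nz that by (simp add: g_def)
  define D where "D = x 1 - x 0 - (x (d - 1) - x d)"
  obtain s \<sigma> s' \<sigma>' where rows1: "rows x g {..d} b c s \<sigma> s' \<sigma>' t" and ss: "(s' - s) * (x 0 - x d) = t * D"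
    using L1.rows_Q_d d unfolding g_def t_def D_def by (metis One_nat_def Suc_leD numeral_3_eq_3)
  define t' where "t' = th' d - th' 0"
  obtain p \<pi> p' \<pi>' where rows': "rows x' (Q' d) {..d} b' c' p \<pi> p' \<pi>' t'"
      and pp': "(p' - p) * (x' 0 - x' d) = t' * (x' 1 - x' 0 - (x' (d - 1) - x' d))"
    using L2.rows_Q_d d unfolding t'_def by (metis One_nat_def Suc_leD numeral_3_eq_3)
  have "\<zeta> * ((p' - p) * (x 0 - x d)) = \<zeta> * (t' * D)"
    using pp' d by (simp add: x' D_def algebra_simps)
  then have pp: "(p' - p) * (x 0 - x d) = t' * D"
    using \<zeta> by simp
  define q where "q = (\<pi> - p * \<xi>) / \<zeta>"
  define q' where "q' = (\<pi>' - p' * \<xi>) / \<zeta>"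
  have "rows x' (Q' d) {..<w} b' c' p \<pi> p' \<pi>' t'"
    using rows' w unfolding rows_def by auto
  then have rows2: "rows x g {..<w} b' c' p q p' q' t'"
    unfolding q_def q'_def
    by (rule rows_transfer[OF _ \<zeta> \<nu> x'_w Q'[folded g_def]]) auto
  define \<mu> where "\<mu> = b' 0 / b 0"
  define B where "B r = b' r - \<mu> * b r" for r
  define C where "C r = c' r - \<mu> * c r" for r
  define S where "S = p - \<mu> * s"
  define \<Sigma> where "\<Sigma> = q - \<mu> * \<sigma>"
  define S' where "S' = p' - \<mu> * s'"
  define \<Sigma>' where "\<Sigma>' = q' - \<mu> * \<sigma>'"
  define \<tau> where "\<tau> = t' - \<mu> * t"
  have rows1': "rows x g {..<w} b c s \<sigma> s' \<sigma>' t"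
    using rows1 w unfolding rows_def by auto
  have rows: "rows x g {..<w} B C S \<Sigma> S' \<Sigma>' \<tau>"
    unfolding B_def C_def S_def S'_def \<Sigma>_def \<Sigma>'_def \<tau>_def by (rule rows_diff[OF rows1' rows2])
  \<comment> \<open>The row of \<open>x\<close> does not mention \<open>Q d\<close>, so it can be
    transported for all r up to d.\<close>
  have rx': "c' r * (x (r - 1) - x r) + b' r * (x (r + 1) - x r) = p * x r - q" if r: "r \<le> d" for r
  proof -
    have up: "b' r * x' (r + 1) = b' r * (\<xi> + \<zeta> * x (r + 1))"
      using L2.b_d x'[of "r + 1"] r by (cases "r = d") auto
    have "c' r * (x' (r - 1) - x' r) + b' r * (x' (r + 1) - x' r) = p * x' r - \<pi>"
      using rows' r unfolding rows_def by auto
    then have "\<zeta> * (c' r * (x (r - 1) - x r) + b' r * (x (r + 1) - x r)) = p * (\<xi> + \<zeta> * x r) - \<pi>"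
      using r x'[of "r - 1"] x'[of r] unfolding right_diff_distrib up by (simp add: algebra_simps)
    also have "\<dots> = \<zeta> * (p * x r - q)"
      using \<zeta> by (simp add: q_def field_simps)
    finally show ?thesis using \<zeta> by simp
  qed
  have r1: "C r * (x (r - 1) - x r) + B r * (x (r + 1) - x r) = S * x r - \<Sigma>" if "r \<le> d" for r
  proof -
    have "c r * (x (r - 1) - x r) + b r * (x (r + 1) - x r) = s * x r - \<sigma>"
      using rows1 that unfolding rows_def by auto
    from linear_combination[OF this rx'[OF that], of \<mu>] show ?thesis
      by (simp add: B_def C_def S_def \<Sigma>_def algebra_simps)
  qed
  have r2: "C r * ((x (r - 1) - x r) * g (r - 1)) + B r * ((x (r + 1) - x r) * g (r + 1)) = (S' * x r - \<Sigma>') * g r"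
    and r3: "C r * (g (r - 1) - g r) + B r * (g (r + 1) - g r) = \<tau> * g r" if "r < w" for r
    using rows that unfolding rows_def by auto
  have real: "c r * (g (r - 1) - g r) + b r * (g (r + 1) - g r) = t * g r" if "r \<le> d" for r
    using rows1 that unfolding rows_def by auto
  have B0: "B 0 = 0" "C 0 = 0" "B d = 0"
    using L1.b_nz[of 0] d L1.c_0 L2.c_0 L1.b_d L2.b_d by (simp_all add: B_def C_def \<mu>_def)
  have \<tau>: "\<tau> = 0" and S0: "S * x 0 = \<Sigma>" "S' * x 0 = \<Sigma>'"
    using r1[of 0] r2[of 0] r3[of 0] g[of 0] w by (auto simp: B0)
  \<comment> \<open>Substitute for row d: \<open>ss\<close> and \<open>pp\<close> are homogeneous in
    the scalars, so their difference is a multiple of \<tau>, which row 0 has made zero.\<close>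
  have "(S' - S) * (x 0 - x d) = ((p' - p) * (x 0 - x d)) - \<mu> * ((s' - s) * (x 0 - x d))"
    by (simp add: S_def S'_def algebra_simps)
  also have "\<dots> = \<tau> * D"
    unfolding pp ss by (simp add: \<tau>_def algebra_simps)
  finally have "S' = S"
    using x_eq[of 0 d] d by (simp add: \<tau>)
  have \<Sigma>': "\<Sigma>' = \<Sigma>"
    using S0 \<open>S' = S\<close> by simp
  have row1: "C 1 * (x 0 - x 1) + B 1 * (x 2 - x 1) = S * (x 1 - x 0)"
    using r1[of 1] d S0(1) by (simp add: numeral_2_eq_2 algebra_simps)
  have row2: "C 2 * (x 1 - x 2) + B 2 * (x 3 - x 2) = S * (x 2 - x 0)"
    using r1[of 2] d S0(1) by (simp add: numeral_2_eq_2 numeral_3_eq_3 algebra_simps)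
  have g_row1: "C 1 * (g 0 - g 1) + B 1 * (g 2 - g 1) = 0"
    using r3[of 1] w by (simp add: numeral_2_eq_2 \<tau>)
  have "g 1 \<noteq> g 0"
    using real[of 0] t g[of 0] by (auto simp: L1.c_0)
  \<comment> \<open>Since \<open>S' = S\<close>, the row of \<open>x * Q d\<close> and
    \<open>g 1\<close> times the row of \<open>x\<close> have equal right sides. Their difference,
    combined with \<open>g_row1\<close>, leaves only \<open>C 1\<close>.\<close>
  have C1: "C 1 = 0"
  proof -
    have "C 1 * ((x 0 - x 1) * g 0) + B 1 * ((x 2 - x 1) * g 2) = (S * (x 1 - x 0)) * g 1"
      using r2[of 1] w S0 \<Sigma>' \<open>S' = S\<close> by (simp add: numeral_2_eq_2 algebra_simps)
    then have "C 1 * ((x 0 - x 1) * g 0) + B 1 * ((x 2 - x 1) * g 2) = (C 1 * (x 0 - x 1) + B 1 * (x 2 - x 1)) * g 1"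
      unfolding row1 .
    then have "(x 0 - x 1) * (C 1 * (g 0 - g 1)) + (x 2 - x 1) * (B 1 * (g 2 - g 1)) = 0"
      by (simp add: algebra_simps)
    moreover have "B 1 * (g 2 - g 1) = - (C 1 * (g 0 - g 1))"
      using g_row1 by (simp add: add_eq_0_iff2)
    ultimately have "(x 0 - x 2) * (C 1 * (g 0 - g 1)) = 0"
      by Groebner_Basis.algebra
    then show ?thesis
      using \<open>g 1 \<noteq> g 0\<close> x_eq[of 0 2] d by auto
  qed
  \<comment> \<open>\<open>row_x_square\<close> again involves \<open>x\<close> alone, so its
    difference is available in all rows. Together with the row of \<open>x\<close> it determines
    \<open>B r\<close> and \<open>C r\<close> for interior r once the right sides are known.\<close>
  obtain P where P: "degree P \<le> 2" "\<And>r. r \<le> d \<Longrightarrow>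
     C r * (x (r - 1) - x r) * x (r - 1) + B r * (x (r + 1) - x r) * x (r + 1) = poly P (x r)"
  proof -
    obtain f where f: "degree f \<le> 2"
      "\<And>r. r \<le> d \<Longrightarrow> c r * (x (r - 1) - x r) * x (r - 1) + b r * (x (r + 1) - x r) * x (r + 1) = poly f (x r)"
      using L1.row_x_square d by (metis Suc_leD eval_nat_numeral(3))
    obtain f' where f': "degree f' \<le> 2"
      "\<And>r. r \<le> d \<Longrightarrow> c' r * (x' (r - 1) - x' r) * x' (r - 1) + b' r * (x' (r + 1) - x' r) * x' (r + 1) = poly f' (x' r)"
      using L2.row_x_square d by (metis Suc_leD eval_nat_numeral(3))
    \<comment> \<open>This undoes the affine change: the expression for x' is \<zeta>^2 times that
      for \<open>x\<close> plus \<xi> * \<zeta> times the row of \<open>x\<close>.\<close>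
    define h where "h = Polynomial.smult (1 / \<zeta>^2) (f' \<circ>\<^sub>p [:\<xi>, \<zeta>:]) - Polynomial.smult (\<xi> / \<zeta>) [:- q, p:]"
    have h: "c' r * (x (r - 1) - x r) * x (r - 1) + b' r * (x (r + 1) - x r) * x (r + 1) = poly h (x r)"
      if r: "r \<le> d" for r
    proof -
      define l u where "l = r - 1" and "u = r + 1"
      have up: "b' r * ((x' u - (\<xi> + \<zeta> * x r)) * x' u) = b' r * ((\<xi> + \<zeta> * x u - (\<xi> + \<zeta> * x r)) * (\<xi> + \<zeta> * x u))"
        using L2.b_d x'[of u] r by (cases "r = d") (auto simp: u_def)
      have "x' r = \<xi> + \<zeta> * x r" "x' l = \<xi> + \<zeta> * x l"
        using r by (auto simp: l_def intro!: x')
      then have "poly f' (\<xi> + \<zeta> * x r) = c' r * ((\<xi> + \<zeta> * x l - (\<xi> + \<zeta> * x r)) * (\<xi> + \<zeta> * x l))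
          + b' r * ((\<xi> + \<zeta> * x u - (\<xi> + \<zeta> * x r)) * (\<xi> + \<zeta> * x u))"
        using f'(2)[OF r, folded l_def u_def] up by (simp add: mult.assoc)
      also have "\<dots> = \<zeta>^2 * (c' r * (x l - x r) * x l + b' r * (x u - x r) * x u)
          + \<xi> * \<zeta> * (c' r * (x l - x r) + b' r * (x u - x r))"
        by (simp add: algebra_simps power2_eq_square)
      also have "c' r * (x l - x r) + b' r * (x u - x r) = p * x r - q"
        using rx'[OF r] by (simp add: l_def u_def)
      finally have "c' r * (x l - x r) * x l + b' r * (x u - x r) * x u
          = (poly f' (\<xi> + \<zeta> * x r) - \<xi> * \<zeta> * (p * x r - q)) / \<zeta>^2"
        using \<zeta> by (simp add: field_simps)
      also have "\<dots> = poly h (x r)"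
        using \<zeta> by (simp add: h_def poly_pcompose field_simps power2_eq_square)
      finally show ?thesis by (simp add: l_def u_def)
    qed
    have "degree h \<le> 2"
      unfolding h_def using f'(1)
      by (intro degree_diff_le order.trans[OF degree_smult_le]) (auto simp: degree_pcompose)
    show thesis
    proof (rule that[of "h - Polynomial.smult \<mu> f"])
      show "degree (h - Polynomial.smult \<mu> f) \<le> 2"
        by (intro degree_diff_le order.trans[OF degree_smult_le] f \<open>degree h \<le> 2\<close>)
      show "C r * (x (r - 1) - x r) * x (r - 1) + B r * (x (r + 1) - x r) * x (r + 1)
          = poly (h - Polynomial.smult \<mu> f) (x r)" if r: "r \<le> d" for r
        using h[OF r] f(2)[OF r]
          linear_combination[of "c r" "(x (r - 1) - x r) * x (r - 1)" "b r" "(x (r + 1) - x r) * x (r + 1)"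
            _ "c' r" "b' r" _ \<mu>]
        by (simp add: B_def C_def mult.assoc)
    qed
  qed
  have P0: "poly P (x 0) = 0"
    using P(2)[of 0] by (simp add: B0)
  have Pd: "poly P (x d) = S * (x d - x 0) * x (d - 1)"
  proof -
    have "C d * (x (d - 1) - x d) = S * (x d - x 0)"
      using r1[of d] S0(1) by (simp add: B0 algebra_simps)
    then show ?thesis using P(2)[of d] by (simp add: B0)
  qed
  have P1: "poly P (x 1) = B 1 * (x 2 - x 1) * x 2"
    using P(2)[of 1] d by (simp add: C1[simplified] numeral_2_eq_2)
  \<comment> \<open>If g separates 1 and 2, row 1 suffices. Otherwise row 2 gives
    \<open>B 2 = 0\<close>, which fixes P at three points; its value at \<open>x d\<close> is then
    incompatible with row d of \<open>x\<close> unless S is 0.\<close>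
  have S: "S = 0"
  proof (cases "g 2 = g 1")
    case False
    then have "B 1 = 0" using g_row1 C1 by simp
    then show ?thesis using row1 C1 x_eq[of 1 0] d by simp
  next
    case True
    have "c 2 * (g 1 - g 2) + b 2 * (g 3 - g 2) \<noteq> 0"
      using real[of 2] t g[of 2] d by (simp add: numeral_2_eq_2 numeral_3_eq_3)
    then have "g 3 \<noteq> g 2" using True by auto
    moreover have "C 2 * (g 1 - g 2) + B 2 * (g 3 - g 2) = 0"
      using r3[of 2] w by (simp add: numeral_2_eq_2 numeral_3_eq_3 \<tau>)
    ultimately have B2: "B 2 = 0" using True by simp
    have P1': "poly P (x 1) = S * (x 1 - x 0) * x 2"
      unfolding P1 using row1 C1 by simp
    have "poly P (x 2) = C 2 * (x 1 - x 2) * x 1"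
      using P(2)[of 2] d by (simp add: B2[simplified] numeral_2_eq_2 B2[unfolded numeral_2_eq_2])
    then have P2: "poly P (x 2) = S * (x 2 - x 0) * x 1"
      using row2 B2 by simp
    \<comment> \<open>The subtracted quadratic interpolates the values of P at \<open>x 0\<close>,
      \<open>x 1\<close> and \<open>x 2\<close> just found, so F has three roots.\<close>
    define F where "F = P - Polynomial.smult S ([:- x 0, 1:] * [:x 1 + x 2, -1:])"
    have "degree F \<le> 2"
      unfolding F_def using P(1) by (intro degree_diff_le order.trans[OF degree_smult_le]) auto
    then have "F = 0"
      using P0 P1' P2 x_eq[of 0 1] x_eq[of 0 2] x_eq[of 1 2] d
      by (intro quadratic_zero[of F "x 0" "x 1" "x 2"]) (auto simp: F_def algebra_simps)
    then have "poly P (x d) = S * ((x d - x 0) * (x 1 + x 2 - x d))"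
      using arg_cong[of F 0 "\<lambda>f. poly f (x d)"] by (simp add: F_def algebra_simps)
    then have "S * (x d - x 0) * (x 1 + x 2 - x d - x (d - 1)) = 0"
      unfolding Pd by (simp add: algebra_simps)
    \<comment> \<open>With \<open>g 2 = g 1\<close> the rows 0 and 1 of the original data yield
      \<open>s' - s = - 2 * t\<close>; inserted into \<open>ss\<close>, this links the two ends of
      the sequence x.\<close>
    moreover have "x 0 + x 1 = x d + x (d - 1)"
    proof -
      have e0: "t * (x 1 - x 0) = (s' * x 0 - \<sigma>') - (s * x 0 - \<sigma>)"
      proof -
        have "((s' * x 0 - \<sigma>') - (s * x 0 - \<sigma>)) * g 0 = b 0 * (x 1 - x 0) * (g 1 - g 0)"
        proof -
          have "b 0 * (x 1 - x 0) = s * x 0 - \<sigma>" "b 0 * ((x 1 - x 0) * g 1) = (s' * x 0 - \<sigma>') * g 0"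
            using rows1[unfolded rows_def, rule_format, of 0] by (simp_all add: L1.c_0)
          then show ?thesis by Groebner_Basis.algebra
        qed
        also have "\<dots> = t * (x 1 - x 0) * g 0"
          using real[of 0] by (simp add: L1.c_0 mult_ac)
        finally show ?thesis using g[of 0] by simp
      qed
      have e1: "t * (x 0 - x 1) = (s' * x 1 - \<sigma>') - (s * x 1 - \<sigma>)"
      proof -
        have i: "c 1 * (x 0 - x 1) + b 1 * (x 2 - x 1) = s * x 1 - \<sigma>"
          and ii: "c 1 * ((x 0 - x 1) * g 0) + b 1 * ((x 2 - x 1) * g 1) = (s' * x 1 - \<sigma>') * g 1"
          and iii: "c 1 * (g 0 - g 1) = t * g 1"
          using rows1[unfolded rows_def, rule_format, of 1] d True by (simp_all add: numeral_2_eq_2)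
        have "((s' * x 1 - \<sigma>') - (s * x 1 - \<sigma>)) * g 1 = (x 0 - x 1) * (c 1 * (g 0 - g 1))"
          using i ii by Groebner_Basis.algebra
        also have "\<dots> = t * (x 0 - x 1) * g 1"
          unfolding iii by simp
        finally show ?thesis using g[of 1] d by simp
      qed
      have "(s' - s) * (x 1 - x 0) = (- 2 * t) * (x 1 - x 0)"
        using e0 e1 by Groebner_Basis.algebra
      moreover have "x 1 - x 0 \<noteq> 0"
        using x_eq[of 1 0] d by simp
      ultimately have "s' - s = - 2 * t"
        by (metis mult_right_cancel)
      then have "t * (x 0 + x 1 - (x d + x (d - 1))) = 0"
        using ss unfolding D_def by Groebner_Basis.algebra
      then show ?thesis using t by simp
    qed
    ultimately have "S * (x d - x 0) * (x 2 - x 0) = 0"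
      by Groebner_Basis.algebra
    then show ?thesis
      using x_eq[of d 0] x_eq[of 2 0] d by auto
  qed
  have B1: "B 1 = 0"
    using row1 C1 S x_eq[of 2 1] d by simp
  \<comment> \<open>As S and \<open>B 1\<close> vanish, \<open>x 0\<close>, \<open>x 1\<close> and
    \<open>x d\<close> are roots of P.\<close>
  have "P = 0"
    using P0 P1 B1 Pd S x_eq[of 0 1] x_eq[of 0 d] x_eq[of 1 d] d
    by (intro quadratic_zero[OF P(1), of "x 0" "x 1" "x d"]) auto
  have BC: "B r = 0 \<and> C r = 0" if r: "r \<le> d" for r
  proof (cases "r = 0 \<or> r = d")
    case True
    have "C d * (x (d - 1) - x d) = 0"
      using r1[of d] S S0(1) by (simp add: B0)
    then show ?thesis using True B0 x_eq[of "d - 1" d] d by auto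
  next
    case False
    then have r': "0 < r" "r < d" using r by auto
    have neq: "x (r - 1) \<noteq> x (r + 1)" "x (r - 1) \<noteq> x r" "x (r + 1) \<noteq> x r"
      using r' by (auto simp: x_eq)
    have e1: "C r * (x (r - 1) - x r) = - (B r * (x (r + 1) - x r))"
      using r1[OF r] S S0(1) by (simp add: add_eq_0_iff2)
    have "C r * (x (r - 1) - x r) * x (r - 1) + B r * (x (r + 1) - x r) * x (r + 1) = 0"
      using P(2)[OF r] \<open>P = 0\<close> by simp
    then have "B r * (x (r + 1) - x r) * (x (r + 1) - x (r - 1)) = 0"
      unfolding e1 by (simp add: algebra_simps)
    then have "B r = 0" using neq by auto
    then show ?thesis using e1 neq by auto
  qed
  have "\<mu> = 1"
    using BC[of 1] d c1 by (simp add: C_def)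
  then show "b' r = b r" "c' r = c r"
    using BC[OF r] by (simp_all add: B_def C_def)
qed

text \<open>\<open>Q' i\<close> is a polynomial of degree i in \<open>x\<close>, hence a combination
  of \<open>Q 0\<close>, ..., \<open>Q i\<close> with nonzero last coefficient, and it is an
  eigenvector of \<open>T\<close>. Distinct eigenvalues leave only the component i.\<close>

theorem leonard_data_proportional:
  assumes 1: "leonard_data d b c x Q th" and 2: "leonard_data d b' c' x' Q' th'" and d: "1 \<le> d"
    and bc: "\<And>r. r \<le> d \<Longrightarrow> b' r = b r" "\<And>r. r \<le> d \<Longrightarrow> c' r = c r"
    and x': "\<And>r. r \<le> d \<Longrightarrow> x' r = \<xi> + \<zeta> * x r" and i: "i \<le> d"
  shows "\<exists>\<nu>. \<forall>r\<le>d. Q' i r = \<nu> * Q i r" and "th' i - th' 0 = th i - th 0"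
proof -
  interpret L1: leonard_data d b c x Q th by (rule 1)
  interpret L2: leonard_data d b' c' x' Q' th' by (rule 2)
  have \<zeta>: "\<zeta> \<noteq> 0"
    by (rule L1.affine_nonconstant[OF L2.x_inj d order.refl x'])
  define p where "p = L2.P i \<circ>\<^sub>p [:\<xi>, \<zeta>:]"
  have p: "poly p (x r) = Q' i r" if "r \<le> d" for r
    using L2.P(2)[OF i that] x'[OF that] by (simp add: p_def poly_pcompose mult.commute)
  have deg: "degree p = i"
    using \<zeta> L2.P(1)[OF i] by (simp add: p_def degree_pcompose)
  have "p \<noteq> 0"
    using p L2.Q_nonzero[OF i] by force
  then have "coeff p i \<noteq> 0"
    using deg by (metis leading_coeff_0_iff)
  then obtain u where u: "\<And>r. r \<le> d \<Longrightarrow> Q' i r = (\<Sum>j\<le>i. u j * Q j r)" "u i \<noteq> 0"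
    using L1.poly_expand[of p i] deg i p by auto
  \<comment> \<open>By \<open>row_diff\<close> the operator minus its eigenvalue at index 0 depends
    on \<open>b\<close> and \<open>c\<close> only; \<eta> is the eigenvalue after this
    shift.\<close>
  define \<eta> where "\<eta> = th' i - th' 0 + th 0"
  have T: "L1.T (Q' i) r = \<eta> * Q' i r" if r: "r \<le> d" for r
  proof -
    have "L1.T (Q' i) r - th 0 * Q' i r = L2.T (Q' i) r - th' 0 * Q' i r"
      unfolding L1.row_diff L2.row_diff by (simp add: bc r)
    then show ?thesis
      unfolding L2.T_Q[OF i r] by (simp add: \<eta>_def algebra_simps)
  qed
  have "\<forall>r\<le>d. (\<Sum>j\<le>i. u j * (th j - \<eta>) * Q j r) = 0"
  proof (intro allI impI)
    fix r assume r: "r \<le> d"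
    have "(\<Sum>j\<le>i. u j * th j * Q j r) = \<eta> * (\<Sum>j\<le>i. u j * Q j r)"
      using T[OF r] L1.T_expand[OF u(1) i r] u(1)[OF r] by simp
    then show "(\<Sum>j\<le>i. u j * (th j - \<eta>) * Q j r) = 0"
      by (simp add: sum_distrib_left algebra_simps sum_subtractf)
  qed
  from L1.Q_indep[OF i this] have ut: "u j * (th j - \<eta>) = 0" if "j \<le> i" for j
    using that by simp
  then have th: "th i = \<eta>"
    using u(2) by fastforce
  then show "th' i - th' 0 = th i - th 0"
    by (simp add: \<eta>_def)
  have "u j = 0" if "j < i" for j
  proof -
    have "th j \<noteq> \<eta>"
      using inj_on_eq_iff[OF L1.th_inj, of j i] that i th by auto
    then show ?thesis using ut[of j] that by simp
  qed
  then have "(\<Sum>j\<le>i. u j * Q j r) = u i * Q i r" for r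
    by (simp add: sum.remove[of "{..i}" i])
  then show "\<exists>\<nu>. \<forall>r\<le>d. Q' i r = \<nu> * Q i r"
    using u(1) by auto
qed

text \<open>For the data of a graph, \<open>n\<close> is the number of vertices: the identity matrix is the sum of the
  primitive idempotents.\<close>

theorem leonard_data_equal:
  assumes 1: "leonard_data d b c x Q th" and 2: "leonard_data d b' c' x' Q' th'" and d: "1 \<le> d"
    and bc: "\<And>r. r \<le> d \<Longrightarrow> b' r = b r" "\<And>r. r \<le> d \<Longrightarrow> c' r = c r"
    and x': "\<And>r. r \<le> d \<Longrightarrow> x' r = \<xi> + \<zeta> * x r"
    and n: "\<And>r. r \<le> d \<Longrightarrow> (\<Sum>l\<le>d. Q l r) = (if r = 0 then n else 0)" "n \<noteq> 0"
    and n': "\<And>r. r \<le> d \<Longrightarrow> (\<Sum>l\<le>d. Q' l r) = (if r = 0 then n' else 0)"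
    and i: "i \<le> d" and r: "r \<le> d"
  shows "Q' i r = Q i r"
proof -
  interpret L1: leonard_data d b c x Q th by (rule 1)
  interpret L2: leonard_data d b' c' x' Q' th' by (rule 2)
  obtain \<nu> where \<nu>: "\<And>i r. \<lbrakk>i \<le> d; r \<le> d\<rbrakk> \<Longrightarrow> Q' i r = \<nu> i * Q i r"
    using leonard_data_proportional(1)[OF 1 2 d bc x'] by metis
  \<comment> \<open>Both sums over all l are multiples of the indicator of 0, hence proportional to
    each other. Independence forces a common factor \<nu>, and index 0 shows that it is 1.\<close>
  have "\<forall>r\<le>d. (\<Sum>l\<le>d. (n * \<nu> l - n') * Q l r) = 0"
  proof (intro allI impI)
    fix r assume r: "r \<le> d"
    have "n * (\<Sum>l\<le>d. Q' l r) = n' * (\<Sum>l\<le>d. Q l r)"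
      using n(1)[OF r] n'[OF r] by simp
    then have "n * (\<Sum>l\<le>d. \<nu> l * Q l r) = n' * (\<Sum>l\<le>d. Q l r)"
      using \<nu> r by simp
    then show "(\<Sum>l\<le>d. (n * \<nu> l - n') * Q l r) = 0"
      by (simp add: sum_distrib_left left_diff_distrib sum_subtractf mult.assoc)
  qed
  from L1.Q_indep[OF order.refl this] have e: "n * \<nu> l = n'" if "l \<le> d" for l
    using that by simp
  have "\<nu> 0 = 1"
    using \<nu>[of 0 0] L1.Q_0[of 0] L2.Q_0[of 0] by simp
  then have "n' = n"
    using e[of 0] by simp
  then have "\<nu> i = 1"
    using e[OF i] n(2) by simp
  then show ?thesis
    using \<nu>[OF i r] by simp
qed

section \<open>Primitive idempotents and operator algebras\<close>

lemma interpolation: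
  fixes t :: "nat \<Rightarrow> complex"
  assumes "inj_on t {..n}"
  shows "\<exists>p. \<forall>i\<le>n. poly p (t i) = f i"
  using assms
proof (induction n)
  case 0
  show ?case by (intro exI[of _ "[:f 0:]"]) auto
next
  case (Suc n)
  then obtain p where p: "\<forall>i\<le>n. poly p (t i) = f i"
    by (metis atMost_subset_iff inj_on_subset le_SucI order.refl)
  define q where "q = (\<Prod>j\<le>n. [:- t j, 1:])"
  have q0: "poly q (t i) = 0" if "i \<le> n" for i
    using that by (auto simp: q_def poly_prod)
  have "t (Suc n) \<noteq> t j" if "j \<le> n" for j
    using inj_on_eq_iff[OF Suc.prems, of "Suc n" j] that by auto
  then have q1: "poly q (t (Suc n)) \<noteq> 0"
    by (auto simp: q_def poly_prod)
  define a where "a = (f (Suc n) - poly p (t (Suc n))) / poly q (t (Suc n))"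
  show ?case
    using p q0 q1 by (intro exI[of _ "p + Polynomial.smult a q"]) (auto simp: le_Suc_eq a_def)
qed

lemma class_ring_complex: "cring (class_ring :: complex ring)" "carrier (class_ring :: complex ring) = UNIV"
  by (rule fieldE(1)[OF class_field], rule class_ring_simps)

lemma complex_algebra_ring: "complex_algebra \<AA> \<Longrightarrow> ring \<AA>"
  by (simp add: complex_algebra_def)

text \<open>An element \<open>S t\<close> with distinct \<open>t 0, \<dots>, t d\<close>, where \<open>S\<close> embeds the split algebra
  \<open>\<complex>\<^bsup>d+1\<^esup>\<close>, generates the image of \<open>S\<close> by interpolation.\<close>

lemma primitive_idempotents_spectral:
  fixes S :: "(nat \<Rightarrow> complex) \<Rightarrow> 'm"
  assumes A: "complex_algebra \<AA>" and closed: "\<And>u. S u \<in> carrier \<AA>"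
    and mult: "\<And>u v. S u \<otimes>\<^bsub>\<AA>\<^esub> S v = S (\<lambda>i. u i * v i)"
    and add: "\<And>u v. S u \<oplus>\<^bsub>\<AA>\<^esub> S v = S (\<lambda>i. u i + v i)"
    and smult: "\<And>a u. a \<odot>\<^bsub>\<AA>\<^esub> S u = S (\<lambda>i. a * u i)"
    and one: "S (\<lambda>i. 1) = \<one>\<^bsub>\<AA>\<^esub>" and zero: "S (\<lambda>i. 0) = \<zero>\<^bsub>\<AA>\<^esub>"
    and eq: "\<And>u v. S u = S v \<longleftrightarrow> (\<forall>i\<le>d. u i = v i)"
    and t: "inj_on t {..d}"
  shows "bij_betw (\<lambda>i. S (\<lambda>j. if j = i then 1 else 0)) {..d}
    (primitive_idempotents \<AA> (generated_subalgebra \<AA> (S t)))"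
proof -
  interpret ring \<AA> by (rule complex_algebra_ring[OF A])
  have neg: "\<ominus>\<^bsub>\<AA>\<^esub> S u = S (\<lambda>i. - u i)" for u
    by (intro minus_equality) (simp_all add: closed add zero)
  have "subring (range S) \<AA>"
    using closed one neg mult add by (intro subringI) (auto simp: image_iff one[symmetric])
  then have sub: "subalgebra (range S) \<AA>"
    by (auto simp: subalgebra_def smult)
  have gen: "generated_subalgebra \<AA> (S t) = range S"
  proof
    show "generated_subalgebra \<AA> (S t) \<subseteq> range S"
      using sub by (auto simp: generated_subalgebra_def)
    show "range S \<subseteq> generated_subalgebra \<AA> (S t)"
      unfolding generated_subalgebra_def
    proof (intro subsetI InterI, clarify)
      fix u B assume B: "subalgebra B \<AA>" and tB: "S t \<in> B"
      have ring: "subring B \<AA>" and scale: "\<And>a x. x \<in> B \<Longrightarrow> a \<odot>\<^bsub>\<AA>\<^esub> x \<in> B"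
        using B by (auto simp: subalgebra_def)
      have const: "S (\<lambda>i. a) \<in> B" for a
        using scale[OF subringE(3)[OF ring], of a] by (simp add: one[symmetric] smult)
      have "S (\<lambda>i. poly p (t i)) \<in> B" for p
      proof (induction p)
        case 0
        then show ?case using const[of 0] by simp
      next
        case (pCons a p)
        have "S (\<lambda>i. a) \<oplus>\<^bsub>\<AA>\<^esub> S t \<otimes>\<^bsub>\<AA>\<^esub> S (\<lambda>i. poly p (t i)) \<in> B"
          using subringE(6,7)[OF ring] const tB pCons.IH by blast
        then show ?case by (simp add: add mult)
      qed
      moreover obtain p where "\<forall>i\<le>d. poly p (t i) = u i"
        using interpolation[OF t] by blast
      ultimately show "S u \<in> B"
        using eq[of "\<lambda>i. poly p (t i)" u] by metis
    qed
  qed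
  define e where "e i = S (\<lambda>j. if j = i then 1 else 0)" for i :: nat
  have prim: "primitive_idempotents \<AA> (range S) = e ` {..d}"
  proof (intro equalityI subsetI)
    fix f assume f: "f \<in> primitive_idempotents \<AA> (range S)"
    then obtain u where u: "f = S u" by (auto simp: primitive_idempotents_def)
    have idem: "u i * u i = u i" if "i \<le> d" for i
      using f that by (auto simp: primitive_idempotents_def u mult eq)
    have "\<not> (\<forall>i\<le>d. u i = 0)"
      using f by (auto simp: primitive_idempotents_def u zero[symmetric] eq)
    then obtain i where i: "i \<le> d" "u i \<noteq> 0" by blast
    then have ui: "u i = 1" using idem by auto
    \<comment> \<open>Split off one index i of the support of u. Primitivity then forces the
      complementary part v' to vanish.\<close>
    define v where "v j = (if j = i then 1 else 0 :: complex)" for j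
    define v' where "v' j = u j - v j" for j
    have "S v = \<zero>\<^bsub>\<AA>\<^esub> \<or> S v' = \<zero>\<^bsub>\<AA>\<^esub>"
    proof -
      have "S v \<otimes>\<^bsub>\<AA>\<^esub> S v = S v" "S v' \<otimes>\<^bsub>\<AA>\<^esub> S v' = S v'" "S v \<otimes>\<^bsub>\<AA>\<^esub> S v' = \<zero>\<^bsub>\<AA>\<^esub>"
        "S v' \<otimes>\<^bsub>\<AA>\<^esub> S v = \<zero>\<^bsub>\<AA>\<^esub>" "f = S v \<oplus>\<^bsub>\<AA>\<^esub> S v'"
        using idem ui by (auto simp: mult add zero[symmetric] eq v_def v'_def u)
      moreover have "\<forall>f'\<in>range S. \<forall>g\<in>range S. f' \<otimes>\<^bsub>\<AA>\<^esub> f' = f' \<and> g \<otimes>\<^bsub>\<AA>\<^esub> g = g \<and>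
            f' \<otimes>\<^bsub>\<AA>\<^esub> g = \<zero>\<^bsub>\<AA>\<^esub> \<and> g \<otimes>\<^bsub>\<AA>\<^esub> f' = \<zero>\<^bsub>\<AA>\<^esub> \<and> f = f' \<oplus>\<^bsub>\<AA>\<^esub> g
            \<longrightarrow> f' = \<zero>\<^bsub>\<AA>\<^esub> \<or> g = \<zero>\<^bsub>\<AA>\<^esub>"
        using f unfolding primitive_idempotents_def by blast
      ultimately show ?thesis by blast
    qed
    moreover have "S v \<noteq> \<zero>\<^bsub>\<AA>\<^esub>"
      using i(1) by (auto simp: zero[symmetric] eq v_def)
    ultimately have "\<forall>j\<le>d. u j = v j"
      by (auto simp: zero[symmetric] eq v'_def)
    then have "f = e i" by (simp add: u e_def eq v_def)
    then show "f \<in> e ` {..d}" using i by blast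
  next
    fix f assume "f \<in> e ` {..d}"
    then obtain i where i: "i \<le> d" "f = e i" by blast
    show "f \<in> primitive_idempotents \<AA> (range S)"
      unfolding primitive_idempotents_def
    proof (intro CollectI conjI ballI impI)
      show "f \<in> range S" "f \<otimes>\<^bsub>\<AA>\<^esub> f = f"
        by (auto simp: i e_def mult eq)
      show "f \<noteq> \<zero>\<^bsub>\<AA>\<^esub>"
        using i(1) by (auto simp: i e_def zero[symmetric] eq)
      fix g h assume "g \<in> range S" "h \<in> range S" and
        *: "g \<otimes>\<^bsub>\<AA>\<^esub> g = g \<and> h \<otimes>\<^bsub>\<AA>\<^esub> h = h \<and> g \<otimes>\<^bsub>\<AA>\<^esub> h = \<zero>\<^bsub>\<AA>\<^esub> \<and> h \<otimes>\<^bsub>\<AA>\<^esub> g = \<zero>\<^bsub>\<AA>\<^esub> \<and> f = g \<oplus>\<^bsub>\<AA>\<^esub> h"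
      then obtain u v where uv: "g = S u" "h = S v" by blast
      have prod: "u j = 0 \<or> v j = 0" if "j \<le> d" for j
        using * that by (auto simp: uv mult zero[symmetric] eq)
      have sum: "u j + v j = (if j = i then 1 else 0)" if "j \<le> d" for j
        using * that by (auto simp: uv i e_def add eq)
      have "u j = 0 \<and> v j = 0" if "j \<le> d" "j \<noteq> i" for j
        using prod[OF that(1)] sum[OF that(1)] that(2) by auto
      then show "g = \<zero>\<^bsub>\<AA>\<^esub> \<or> h = \<zero>\<^bsub>\<AA>\<^esub>"
        using prod[OF i(1)] by (auto simp: uv zero[symmetric] eq)
    qed
  qed
  have "inj_on e {..d}"
    by (auto simp: inj_on_def e_def eq split: if_splits)
  then have "bij_betw e {..d} (primitive_idempotents \<AA> (generated_subalgebra \<AA> (S t)))"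
    unfolding gen prim by (rule inj_on_imp_bij_betw)
  then show ?thesis
    by (simp add: e_def[abs_def])
qed

lemma complex_algebra_operator_algebra:
  assumes W0: "(\<lambda>x. 0) \<in> W" and Wadd: "\<And>u v. \<lbrakk>u \<in> W; v \<in> W\<rbrakk> \<Longrightarrow> (\<lambda>x. u x + v x) \<in> W"
    and Wscale: "\<And>c u. u \<in> W \<Longrightarrow> (\<lambda>x. c * u x) \<in> W"
  shows "complex_algebra (operator_algebra W)"
proof -
  let ?A = "operator_algebra W"
  have lin: "f u \<in> W" "f (\<lambda>x. u x + v x) = (\<lambda>x. f u x + f v x)" "f (\<lambda>x. c * u x) = (\<lambda>x. c * f u x)"
    if "f \<in> carrier ?A" "u \<in> W" "v \<in> W" for f u v c
    using that by (auto simp: operator_algebra_def)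
  have ext: "f = g" if "f \<in> carrier ?A" "g \<in> carrier ?A" "\<And>u. u \<in> W \<Longrightarrow> f u = g u" for f g
    using that by (intro extensionalityI[of f W g]) (auto simp: operator_algebra_def PiE_def)
  have plus: "f \<oplus>\<^bsub>?A\<^esub> g \<in> carrier ?A" if "f \<in> carrier ?A" "g \<in> carrier ?A" for f g
    using that by (auto simp: operator_algebra_def algebra_simps intro!: Wadd Wscale)
  have zero: "\<zero>\<^bsub>?A\<^esub> \<in> carrier ?A"
    by (auto simp: operator_algebra_def W0 Wadd Wscale)
  have scale: "c \<odot>\<^bsub>?A\<^esub> f \<in> carrier ?A" if "f \<in> carrier ?A" for c f
    using that by (auto simp: operator_algebra_def algebra_simps intro!: Wadd Wscale)
  have times: "f \<otimes>\<^bsub>?A\<^esub> g \<in> carrier ?A" if "f \<in> carrier ?A" "g \<in> carrier ?A" for f g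
    using that by (auto simp: operator_algebra_def compose_def Wadd Wscale PiE_iff extensional_def)
  have one: "\<one>\<^bsub>?A\<^esub> \<in> carrier ?A"
    by (auto simp: operator_algebra_def Wadd Wscale)
  have app: "(f \<oplus>\<^bsub>?A\<^esub> g) u = (\<lambda>x. f u x + g u x)" "(f \<otimes>\<^bsub>?A\<^esub> g) u = f (g u)"
    "(c \<odot>\<^bsub>?A\<^esub> f) u = (\<lambda>x. c * f u x)" "\<zero>\<^bsub>?A\<^esub> u = (\<lambda>x. 0)" "\<one>\<^bsub>?A\<^esub> u = u"
    if "u \<in> W" for f g u c
    using that by (auto simp: operator_algebra_def compose_def)
  have grp: "abelian_group ?A"
  proof (rule abelian_groupI)
    fix f assume f: "f \<in> carrier ?A"
    show "\<exists>g\<in>carrier ?A. g \<oplus>\<^bsub>?A\<^esub> f = \<zero>\<^bsub>?A\<^esub>"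
      by (intro bexI[OF ext scale[OF f, of "-1"]] plus scale f zero) (simp add: app)
  qed (auto intro!: plus zero ext simp: app algebra_simps)
  have mon: "monoid ?A"
    by (rule monoidI) (auto intro!: times one ext simp: app lin)
  have "ring ?A"
    by (rule ringI[OF grp mon]; intro ext plus times; simp add: app lin)
  moreover have "module (class_ring :: complex ring) ?A"
    by (rule moduleI[OF class_ring_complex(1) grp])
      (auto simp: class_ring_simps app algebra_simps intro!: scale ext plus)
  moreover have "(c \<odot>\<^bsub>?A\<^esub> f) \<otimes>\<^bsub>?A\<^esub> g = c \<odot>\<^bsub>?A\<^esub> (f \<otimes>\<^bsub>?A\<^esub> g) \<and>
      f \<otimes>\<^bsub>?A\<^esub> (c \<odot>\<^bsub>?A\<^esub> g) = c \<odot>\<^bsub>?A\<^esub> (f \<otimes>\<^bsub>?A\<^esub> g)"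
    if "f \<in> carrier ?A" "g \<in> carrier ?A" for c f g
    using that by (intro conjI ext times scale) (auto simp: app lin)
  ultimately show ?thesis
    by (simp add: complex_algebra_def)
qed

lemma algebra_iso_inverse:
  assumes A: "complex_algebra \<AA>" and h: "h \<in> algebra_iso \<AA> \<BB>"
  shows "inv_into (carrier \<AA>) h \<in> algebra_iso \<BB> \<AA>"
proof -
  have iso: "h \<in> ring_iso \<AA> \<BB>" and smult: "\<And>c x. x \<in> carrier \<AA> \<Longrightarrow> h (c \<odot>\<^bsub>\<AA>\<^esub> x) = c \<odot>\<^bsub>\<BB>\<^esub> h x"
    using h by (auto simp: algebra_iso_def)
  have bij: "bij_betw h (carrier \<AA>) (carrier \<BB>)"
    using iso by (simp add: ring_iso_def)
  have mod: "module (class_ring :: complex ring) \<AA>"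
    using A unfolding complex_algebra_def by blast
  have inv: "inv_into (carrier \<AA>) h (h x) = x" if "x \<in> carrier \<AA>" for x
    using bij that by (simp add: bij_betw_def)
  have "inv_into (carrier \<AA>) h (c \<odot>\<^bsub>\<BB>\<^esub> y) = c \<odot>\<^bsub>\<AA>\<^esub> inv_into (carrier \<AA>) h y" if y: "y \<in> carrier \<BB>" for c y
  proof -
    obtain x where x: "x \<in> carrier \<AA>" "y = h x"
      using y unfolding bij_betw_imp_surj_on[OF bij, symmetric] by blast
    have "c \<odot>\<^bsub>\<AA>\<^esub> x \<in> carrier \<AA>"
      using module.smult_closed[OF mod _ x(1), of c] by (simp only: class_ring_complex(2) UNIV_I)
    from inv[OF this] show ?thesis
      unfolding x(2) smult[OF x(1)] inv[OF x(1)] .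
  qed
  then show ?thesis
    using ring_iso_set_sym[OF complex_algebra_ring[OF A] iso] unfolding algebra_iso_def by blast
qed

lemma algebra_iso_trans:
  assumes "f \<in> algebra_iso \<AA> \<BB>" and "g \<in> algebra_iso \<BB> \<CC>"
  shows "g \<circ> f \<in> algebra_iso \<AA> \<CC>"
proof -
  have "f x \<in> carrier \<BB>" if "x \<in> carrier \<AA>" for x
    using assms(1) that by (auto simp: algebra_iso_def intro: ring_iso_memE(1))
  then show ?thesis
    using assms ring_iso_set_trans by (auto simp: algebra_iso_def)
qed

section \<open>Operators on the functions of the distance to a base vertex\<close>

definition unit_fun :: "nat \<Rightarrow> nat \<Rightarrow> complex" where
  "unit_fun j r = (if r = j then 1 else 0)"

text \<open>A function on all natural numbers stands for its restriction to \<open>{..d}\<close>;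
  the first clause says that M is well defined on such restrictions.\<close>

definition linear_upto :: "nat \<Rightarrow> ((nat \<Rightarrow> complex) \<Rightarrow> nat \<Rightarrow> complex) \<Rightarrow> bool" where
  "linear_upto d M \<longleftrightarrow>
     (\<forall>f g. (\<forall>s\<le>d. f s = g s) \<longrightarrow> (\<forall>r\<le>d. M f r = M g r)) \<and>
     (\<forall>f g. \<forall>r\<le>d. M (\<lambda>s. f s + g s) r = M f r + M g r) \<and>
     (\<forall>a f. \<forall>r\<le>d. M (\<lambda>s. a * f s) r = a * M f r)"

lemma linear_uptoD:
  assumes "linear_upto d M"
  shows "(\<And>s. s \<le> d \<Longrightarrow> f s = g s) \<Longrightarrow> r \<le> d \<Longrightarrow> M f r = M g r"
    and "r \<le> d \<Longrightarrow> M (\<lambda>s. f s + g s) r = M f r + M g r"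
    and "r \<le> d \<Longrightarrow> M (\<lambda>s. a * f s) r = a * M f r"
  using assms by (auto simp: linear_upto_def)

lemma linear_upto_sum:
  assumes M: "linear_upto d M" and r: "r \<le> d" and "finite J"
  shows "M (\<lambda>s. \<Sum>j\<in>J. u j * g j s) r = (\<Sum>j\<in>J. u j * M (g j) r)"
  using \<open>finite J\<close>
proof (induction J rule: finite_induct)
  case empty
  have "M (\<lambda>s. 0) r = M (\<lambda>s. 0 * (0::complex)) r" by simp
  also have "\<dots> = 0" using linear_uptoD(3)[OF M r, of 0 "\<lambda>s. 0"] by simp
  finally show ?case by simp
next
  case (insert j J)
  then show ?case by (simp add: linear_uptoD(2,3)[OF M r])
qed

lemma linear_upto_expand:
  assumes M: "linear_upto d M" and r: "r \<le> d"
  shows "M f r = (\<Sum>j\<le>d. f j * M (unit_fun j) r)"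
proof -
  have "M f r = M (\<lambda>s. \<Sum>j\<le>d. f j * unit_fun j s) r"
    by (rule linear_uptoD(1)[OF M _ r]) (simp add: unit_fun_def if_distrib[of "\<lambda>z. _ * z"] cong: if_cong)
  then show ?thesis by (simp add: linear_upto_sum[OF M r])
qed

text \<open>Intended for the distance D to a base vertex. As D maps X onto \<open>{..d}\<close>,
  \<open>rad\<close> identifies the functions on \<open>{..d}\<close> with a subspace W, which turns
  out to be the primary module (\<open>primary_module\<close>).\<close>

locale radial =
  fixes X :: "'a set" and D :: "'a \<Rightarrow> nat" and d :: nat
  assumes D_le: "y \<in> X \<Longrightarrow> D y \<le> d" and D_ex: "i \<le> d \<Longrightarrow> \<exists>y\<in>X. D y = i"
begin

definition rad :: "(nat \<Rightarrow> complex) \<Rightarrow> 'a \<Rightarrow> complex" where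
  "rad f = (\<lambda>y. if y \<in> X then f (D y) else 0)"

definition co :: "('a \<Rightarrow> complex) \<Rightarrow> nat \<Rightarrow> complex" where
  "co v i = v (SOME y. y \<in> X \<and> D y = i)"

abbreviation "W \<equiv> range rad"

lemma co_rad: assumes "i \<le> d" shows "co (rad f) i = f i"
proof -
  have "\<exists>y. y \<in> X \<and> D y = i" using D_ex[OF assms] by blast
  from someI_ex[OF this] show ?thesis by (simp add: co_def rad_def)
qed

lemma rad_cong: "(\<And>i. i \<le> d \<Longrightarrow> f i = g i) \<Longrightarrow> rad f = rad g"
  by (auto simp: rad_def D_le)

lemma rad_eq: "rad f = rad g \<longleftrightarrow> (\<forall>i\<le>d. f i = g i)"
  using co_rad rad_cong by metis

lemma rad_co: "v \<in> W \<Longrightarrow> rad (co v) = v"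
  by (auto simp: rad_eq co_rad)

lemma rad_add: "(\<lambda>y. rad f y + rad g y) = rad (\<lambda>r. f r + g r)"
  and rad_scale: "(\<lambda>y. a * rad f y) = rad (\<lambda>r. a * f r)"
  and rad_zero: "(\<lambda>y. 0) = rad (\<lambda>r. 0)"
  by (auto simp: rad_def)

abbreviation "\<AA> \<equiv> operator_algebra W"

lemma complex_algebra: "complex_algebra \<AA>"
proof (rule complex_algebra_operator_algebra)
  show "(\<lambda>x. 0) \<in> W" unfolding rad_zero by blast
  show "(\<lambda>x. u x + v x) \<in> W" if "u \<in> W" "v \<in> W" for u v
    using that by (auto simp: rad_add)
  show "(\<lambda>x. c * u x) \<in> W" if "u \<in> W" for c u
    using that by (auto simp: rad_scale)
qed

definition opr :: "((nat \<Rightarrow> complex) \<Rightarrow> nat \<Rightarrow> complex) \<Rightarrow> ('a \<Rightarrow> complex) \<Rightarrow> 'a \<Rightarrow> complex" where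
  "opr M = (\<lambda>v\<in>W. rad (M (co v)))"

lemma opr_rad: "linear_upto d M \<Longrightarrow> opr M (rad f) = rad (M f)"
  by (auto simp: opr_def rad_eq intro: linear_uptoD(1) co_rad)

lemma opr_extensional: "opr M \<in> extensional W"
  by (simp add: opr_def)

lemma carrier_iff:
  "F \<in> carrier \<AA> \<longleftrightarrow> F \<in> extensional W \<and> (\<forall>f. F (rad f) \<in> W) \<and>
     (\<forall>f g. F (rad (\<lambda>r. f r + g r)) = (\<lambda>y. F (rad f) y + F (rad g) y)) \<and>
     (\<forall>a f. F (rad (\<lambda>r. a * f r)) = (\<lambda>y. a * F (rad f) y))"
  by (auto simp: operator_algebra_def PiE_def Pi_def rad_add rad_scale)

lemma opr_closed: assumes "linear_upto d M" shows "opr M \<in> carrier \<AA>"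
  unfolding carrier_iff opr_rad[OF assms] rad_add rad_scale
  using linear_uptoD(2,3)[OF assms] by (auto simp: opr_extensional rad_eq)

lemma carrier_ext:
  assumes "F \<in> carrier \<AA>" "G \<in> carrier \<AA>" "\<And>f. F (rad f) = G (rad f)"
  shows "F = G"
  using assms by (intro extensionalityI[of F W G]) (auto simp: carrier_iff)

lemma opr_eq: assumes "linear_upto d M" "linear_upto d N"
  shows "opr M = opr N \<longleftrightarrow> (\<forall>f. \<forall>r\<le>d. M f r = N f r)"
proof
  assume "opr M = opr N"
  then have "rad (M f) = rad (N f)" for f
    using assms by (simp add: opr_rad[symmetric])
  then show "\<forall>f. \<forall>r\<le>d. M f r = N f r" by (simp add: rad_eq)
next
  assume "\<forall>f. \<forall>r\<le>d. M f r = N f r"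
  then show "opr M = opr N"
    using assms by (intro carrier_ext opr_closed) (auto simp: opr_rad rad_eq)
qed

lemma operator_simps:
  assumes "v \<in> W"
  shows "(F \<otimes>\<^bsub>\<AA>\<^esub> G) v = F (G v)" "(F \<oplus>\<^bsub>\<AA>\<^esub> G) v = (\<lambda>y. F v y + G v y)"
    "(a \<odot>\<^bsub>\<AA>\<^esub> F) v = (\<lambda>y. a * F v y)" "\<one>\<^bsub>\<AA>\<^esub> v = v" "\<zero>\<^bsub>\<AA>\<^esub> v = (\<lambda>y. 0)"
  using assms by (simp_all add: operator_algebra_def compose_def)

lemma mult_closed: "\<lbrakk>F \<in> carrier \<AA>; G \<in> carrier \<AA>\<rbrakk> \<Longrightarrow> F \<otimes>\<^bsub>\<AA>\<^esub> G \<in> carrier \<AA>"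
  and add_closed: "\<lbrakk>F \<in> carrier \<AA>; G \<in> carrier \<AA>\<rbrakk> \<Longrightarrow> F \<oplus>\<^bsub>\<AA>\<^esub> G \<in> carrier \<AA>"
  and one_closed: "\<one>\<^bsub>\<AA>\<^esub> \<in> carrier \<AA>" and zero_closed: "\<zero>\<^bsub>\<AA>\<^esub> \<in> carrier \<AA>"
  using complex_algebra_ring[OF complex_algebra] ring.ring_simprules(1,2,5,6) by metis+

lemma smult_closed: assumes "F \<in> carrier \<AA>" shows "a \<odot>\<^bsub>\<AA>\<^esub> F \<in> carrier \<AA>"
proof -
  have "module (class_ring :: complex ring) \<AA>"
    using complex_algebra unfolding complex_algebra_def by blast
  from module.smult_closed[OF this _ assms, of a] show ?thesis
    by (simp only: class_ring_complex(2) UNIV_I)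
qed

lemma linear_upto_comp: "\<lbrakk>linear_upto d M; linear_upto d N\<rbrakk> \<Longrightarrow> linear_upto d (\<lambda>f. M (N f))"
  unfolding linear_upto_def
proof (elim conjE, intro conjI allI impI)
  assume M: "\<forall>f g. (\<forall>s\<le>d. f s = g s) \<longrightarrow> (\<forall>r\<le>d. M f r = M g r)"
    "\<forall>f g. \<forall>r\<le>d. M (\<lambda>s. f s + g s) r = M f r + M g r"
    "\<forall>a f. \<forall>r\<le>d. M (\<lambda>s. a * f s) r = a * M f r"
  assume N: "\<forall>f g. (\<forall>s\<le>d. f s = g s) \<longrightarrow> (\<forall>r\<le>d. N f r = N g r)"
    "\<forall>f g. \<forall>r\<le>d. N (\<lambda>s. f s + g s) r = N f r + N g r"
    "\<forall>a f. \<forall>r\<le>d. N (\<lambda>s. a * f s) r = a * N f r"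
  show "M (N f) r = M (N g) r" if "\<forall>s\<le>d. f s = g s" "r \<le> d" for f g r
    using M(1) N(1) that by blast
  show "M (N (\<lambda>s. f s + g s)) r = M (N f) r + M (N g) r" if "r \<le> d" for f g r
  proof -
    have "M (N (\<lambda>s. f s + g s)) r = M (\<lambda>s. N f s + N g s) r"
      using M(1) N(2) that by auto
    then show ?thesis using M(2) that by simp
  qed
  show "M (N (\<lambda>s. a * f s)) r = a * M (N f) r" if "r \<le> d" for a f r
  proof -
    have "M (N (\<lambda>s. a * f s)) r = M (\<lambda>s. a * N f s) r"
      using M(1) N(3) that by auto
    then show ?thesis using M(3) that by simp
  qed
qed

lemma opr_mult: assumes "linear_upto d M" "linear_upto d N"
  shows "opr M \<otimes>\<^bsub>\<AA>\<^esub> opr N = opr (\<lambda>f. M (N f))"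
  using assms linear_upto_comp[OF assms]
  by (intro carrier_ext mult_closed opr_closed) (auto simp: operator_simps opr_rad)

lemma opr_add: assumes "linear_upto d M" "linear_upto d N" "linear_upto d (\<lambda>f r. M f r + N f r)"
  shows "opr M \<oplus>\<^bsub>\<AA>\<^esub> opr N = opr (\<lambda>f r. M f r + N f r)"
  using assms by (intro carrier_ext add_closed opr_closed) (auto simp: operator_simps opr_rad rad_add)

lemma opr_smult: assumes "linear_upto d M" "linear_upto d (\<lambda>f r. a * M f r)"
  shows "a \<odot>\<^bsub>\<AA>\<^esub> opr M = opr (\<lambda>f r. a * M f r)"
  using assms by (intro carrier_ext smult_closed opr_closed) (auto simp: operator_simps opr_rad rad_scale)

lemma linear_upto_id: "linear_upto d (\<lambda>f. f)" and linear_upto_zero: "linear_upto d (\<lambda>f r. 0)"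
  by (auto simp: linear_upto_def)

lemma opr_one: "opr (\<lambda>f. f) = \<one>\<^bsub>\<AA>\<^esub>"
  by (intro carrier_ext one_closed opr_closed linear_upto_id)
    (auto simp: operator_simps opr_rad linear_upto_id)

lemma opr_zero: "opr (\<lambda>f r. 0) = \<zero>\<^bsub>\<AA>\<^esub>"
  by (intro carrier_ext zero_closed opr_closed linear_upto_zero)
    (auto simp: operator_simps opr_rad linear_upto_zero rad_zero)

lemma carrier_opr:
  assumes F: "F \<in> carrier \<AA>"
  shows "linear_upto d (\<lambda>f. co (F (rad f)))" and "F = opr (\<lambda>f. co (F (rad f)))"
proof -
  have W: "F (rad f) \<in> W" for f
    using F by (simp add: carrier_iff)
  have "co (F (rad f)) r = co (F (rad g)) r" if "\<forall>s\<le>d. f s = g s" for f g r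
    using that rad_eq[of f g] by simp
  then show lin: "linear_upto d (\<lambda>f. co (F (rad f)))"
    using F by (auto simp: linear_upto_def carrier_iff co_def)
  show "F = opr (\<lambda>f. co (F (rad f)))"
    using F lin W by (intro carrier_ext opr_closed) (auto simp: opr_rad rad_co)
qed

definition to_mat :: "(('a \<Rightarrow> complex) \<Rightarrow> 'a \<Rightarrow> complex) \<Rightarrow> complex mat" where
  "to_mat F = mat (d + 1) (d + 1) (\<lambda>(i, j). co (F (rad (unit_fun j))) i)"

lemma to_mat_opr:
  assumes "linear_upto d M"
  shows "to_mat (opr M) = mat (d + 1) (d + 1) (\<lambda>(i, j). M (unit_fun j) i)"
  unfolding to_mat_def by (intro eq_matI) (auto simp: opr_rad[OF assms] co_rad)

lemma to_mat_iso: "to_mat \<in> algebra_iso \<AA> (module_mat TYPE(complex) (d + 1) (d + 1))"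
proof -
  let ?B = "module_mat TYPE(complex) (d + 1) (d + 1)"
  have inj: "inj_on to_mat (carrier \<AA>)"
  proof (rule inj_onI)
    fix F G assume FG: "F \<in> carrier \<AA>" "G \<in> carrier \<AA>" and eq: "to_mat F = to_mat G"
    note F = carrier_opr[OF FG(1)] and G = carrier_opr[OF FG(2)]
    have "co (F (rad (unit_fun j))) i = co (G (rad (unit_fun j))) i" if "i \<le> d" "j \<le> d" for i j
      using arg_cong[OF eq, of "\<lambda>A. A $$ (i, j)"] that by (simp add: to_mat_def)
    then have "(\<Sum>j\<le>d. f j * co (F (rad (unit_fun j))) r) = (\<Sum>j\<le>d. f j * co (G (rad (unit_fun j))) r)"
      if "r \<le> d" for f r
      using that by (intro sum.cong) auto
    then have "co (F (rad f)) r = co (G (rad f)) r" if "r \<le> d" for f r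
      using linear_upto_expand[OF F(1) that, of f] linear_upto_expand[OF G(1) that, of f] that
      by presburger
    then have "\<forall>f. \<forall>r\<le>d. co (F (rad f)) r = co (G (rad f)) r"
      by blast
    then have "opr (\<lambda>f. co (F (rad f))) = opr (\<lambda>f. co (G (rad f)))"
      using opr_eq[OF F(1) G(1)] by blast
    then show "F = G"
      unfolding F(2)[symmetric] G(2)[symmetric] .
  qed
  have surj: "\<exists>F\<in>carrier \<AA>. to_mat F = A" if A: "A \<in> carrier_mat (d + 1) (d + 1)" for A
  proof -
    define M where "M f i = (\<Sum>j\<le>d. A $$ (i, j) * f j)" for f i
    have M: "linear_upto d M"
      unfolding linear_upto_def M_def
      by (simp add: distrib_left sum.distrib sum_distrib_left mult.left_commute)
    have "M (unit_fun j) i = A $$ (i, j)" if "j \<le> d" for i j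
      using that by (simp add: M_def unit_fun_def if_distrib[of "\<lambda>z. _ * z"] cong: if_cong)
    then have "to_mat (opr M) = A"
      unfolding to_mat_opr[OF M] using A by (intro eq_matI) auto
    then show ?thesis using opr_closed[OF M] by blast
  qed
  have "to_mat ` carrier \<AA> = carrier_mat (d + 1) (d + 1)"
  proof (intro equalityI subsetI)
    show "A \<in> carrier_mat (d + 1) (d + 1)" if "A \<in> to_mat ` carrier \<AA>" for A
      using that by (auto simp: to_mat_def)
    show "A \<in> to_mat ` carrier \<AA>" if "A \<in> carrier_mat (d + 1) (d + 1)" for A
      using surj[OF that] by blast
  qed
  then have bij: "bij_betw to_mat (carrier \<AA>) (carrier ?B)"
    using inj by (simp add: bij_betw_def module_mat_simps)
  have "to_mat \<in> ring_iso \<AA> ?B"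
  proof (rule ring_iso_memI)
    fix F G assume FG: "F \<in> carrier \<AA>" "G \<in> carrier \<AA>"
    define M where "M = (\<lambda>f. co (F (rad f)))"
    define N where "N = (\<lambda>f. co (G (rad f)))"
    have M: "linear_upto d M" "F = opr M" and N: "linear_upto d N" "G = opr N"
      unfolding M_def N_def by (rule carrier_opr[OF FG(1)] carrier_opr[OF FG(2)])+
    have "to_mat F * to_mat G = to_mat (opr (\<lambda>f. M (N f)))"
    proof (intro eq_matI)
      fix i j assume "i < dim_row (to_mat (opr (\<lambda>f. M (N f))))" "j < dim_col (to_mat (opr (\<lambda>f. M (N f))))"
      then have ij: "i \<le> d" "j \<le> d" by (auto simp: to_mat_def)
      have "(to_mat F * to_mat G) $$ (i, j) = (\<Sum>k\<le>d. M (unit_fun k) i * N (unit_fun j) k)"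
        using ij by (simp add: M(2) N(2) to_mat_opr[OF M(1)] to_mat_opr[OF N(1)] scalar_prod_def
          atLeast0LessThan lessThan_Suc_atMost del: sum.lessThan_Suc)
      also have "\<dots> = M (N (unit_fun j)) i"
        by (subst linear_upto_expand[OF M(1) ij(1), of "N (unit_fun j)"]) (simp add: mult.commute)
      finally show "(to_mat F * to_mat G) $$ (i, j) = to_mat (opr (\<lambda>f. M (N f))) $$ (i, j)"
        using ij by (simp add: to_mat_opr[OF linear_upto_comp[OF M(1) N(1)]])
    qed (auto simp: to_mat_def)
    then show "to_mat (F \<otimes>\<^bsub>\<AA>\<^esub> G) = to_mat F \<otimes>\<^bsub>?B\<^esub> to_mat G"
      using opr_mult[OF M(1) N(1)] M(2) N(2) by (simp add: module_mat_simps)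
    show "to_mat (F \<oplus>\<^bsub>\<AA>\<^esub> G) = to_mat F \<oplus>\<^bsub>?B\<^esub> to_mat G"
      unfolding module_mat_simps to_mat_def by (intro eq_matI) (auto simp: operator_simps co_def)
  next
    show "to_mat \<one>\<^bsub>\<AA>\<^esub> = \<one>\<^bsub>?B\<^esub>"
      unfolding module_mat_simps to_mat_def
      by (intro eq_matI) (auto simp: operator_simps co_rad unit_fun_def)
    show "to_mat F \<in> carrier ?B" for F
      by (simp add: module_mat_simps to_mat_def)
  qed (rule bij)
  moreover have "to_mat (a \<odot>\<^bsub>\<AA>\<^esub> F) = a \<odot>\<^bsub>?B\<^esub> to_mat F" for a F
    unfolding module_mat_simps to_mat_def by (intro eq_matI) (auto simp: operator_simps co_def)
  ultimately show ?thesis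
    by (simp add: algebra_iso_def)
qed

text \<open>The eigenfunctions supply d + 1 eigenvalues, and the degree of the characteristic
  polynomial permits no more.\<close>

lemma card_eigenvalues:
  assumes M: "linear_upto d M" and t: "inj_on t {..d}"
    and ev: "\<And>i. i \<le> d \<Longrightarrow> \<exists>f. (\<exists>r\<le>d. f r \<noteq> 0) \<and> (\<forall>r\<le>d. M f r = t i * f r)"
  shows "card {\<theta>. eigenvalue (to_mat (opr M)) \<theta>} = d + 1"
proof -
  let ?A = "to_mat (opr M)"
  have A: "?A \<in> carrier_mat (d + 1) (d + 1)" by (simp add: to_mat_def)
  have deg: "degree (char_poly ?A) = d + 1" and "char_poly ?A \<noteq> 0"
    using degree_monic_char_poly[OF A] by auto
  have fin: "finite {\<theta>. eigenvalue ?A \<theta>}"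
    unfolding eigenvalue_root_char_poly[OF A] using \<open>char_poly ?A \<noteq> 0\<close> by (rule poly_roots_finite)
  have le: "card {\<theta>. eigenvalue ?A \<theta>} \<le> d + 1"
    unfolding eigenvalue_root_char_poly[OF A] using poly_roots_degree[OF \<open>char_poly ?A \<noteq> 0\<close>] deg by simp
  have "eigenvalue ?A (t i)" if i: "i \<le> d" for i
  proof -
    obtain f r where f: "r \<le> d" "f r \<noteq> 0" "\<forall>r\<le>d. M f r = t i * f r" using ev[OF i] by blast
    have "?A *\<^sub>v vec (d + 1) f = t i \<cdot>\<^sub>v vec (d + 1) f"
    proof (rule eq_vecI)
      fix s assume "s < dim_vec (t i \<cdot>\<^sub>v vec (d + 1) f)"
      then have s: "s \<le> d" by simp
      have "(?A *\<^sub>v vec (d + 1) f) $ s = (\<Sum>k\<le>d. M (unit_fun k) s * f k)"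
        using s by (simp add: to_mat_opr[OF M] scalar_prod_def
          atLeast0LessThan lessThan_Suc_atMost del: sum.lessThan_Suc)
      also have "\<dots> = M f s"
        by (subst linear_upto_expand[OF M s, of f]) (simp add: mult.commute)
      finally show "(?A *\<^sub>v vec (d + 1) f) $ s = (t i \<cdot>\<^sub>v vec (d + 1) f) $ s"
        using f(3) s by simp
    qed (simp add: to_mat_def)
    moreover have "vec (d + 1) f \<noteq> 0\<^sub>v (d + 1)"
    proof
      assume "vec (d + 1) f = 0\<^sub>v (d + 1)"
      then have "vec (d + 1) f $ r = 0\<^sub>v (d + 1) $ r" by simp
      then show False using f(1,2) by simp
    qed
    ultimately have "eigenvector ?A (vec (d + 1) f) (t i)"
      by (simp add: eigenvector_def to_mat_def)
    then show ?thesis unfolding eigenvalue_def by blast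
  qed
  then have "card (t ` {..d}) \<le> card {\<theta>. eigenvalue ?A \<theta>}"
    using fin by (intro card_mono) auto
  then show ?thesis
    using le card_image[OF t] by simp
qed

end

section \<open>Coordinates with respect to the eigenfunctions\<close>

context leonard_data
begin

definition coef :: "nat \<Rightarrow> (nat \<Rightarrow> complex) \<Rightarrow> complex" where
  "coef i f = form f (Q i) / form (Q i) (Q i)"

lemma coef_unique:
  assumes "\<And>r. r \<le> d \<Longrightarrow> f r = (\<Sum>i\<le>d. u i * Q i r)" and "i \<le> d"
  shows "coef i f = u i"
  using form_Q_expand[OF assms] Q_norm[OF assms(2)] by (simp add: coef_def)

lemma coef_expand:
  assumes "r \<le> d" shows "f r = (\<Sum>i\<le>d. coef i f * Q i r)"
proof -
  obtain u where u: "\<And>r. r \<le> d \<Longrightarrow> f r = (\<Sum>i\<le>d. u i * Q i r)" using Q_expand by blast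
  show ?thesis
    unfolding u[OF assms] by (intro sum.cong refl) (simp add: coef_unique[OF u])
qed

lemma coef_cong: "(\<And>r. r \<le> d \<Longrightarrow> f r = g r) \<Longrightarrow> coef i f = coef i g"
  unfolding coef_def using form_cong[of f g "Q i" "Q i"] by simp

lemma coef_linear: "coef i (\<lambda>r. f r + g r) = coef i f + coef i g" "coef i (\<lambda>r. a * f r) = a * coef i f"
  by (simp_all add: coef_def form_def algebra_simps sum.distrib sum_distrib_left add_divide_distrib)

lemma coef_Q: "\<lbrakk>i \<le> d; j \<le> d\<rbrakk> \<Longrightarrow> coef i (Q j) = (if i = j then 1 else 0)"
  by (rule coef_unique) (auto simp: if_distrib[of "\<lambda>z. z * _"] cong: if_cong)

text \<open>The functional calculus of \<open>T\<close>: the operator with eigenvalue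
  \<open>u i\<close> on \<open>Q i\<close>. In particular \<open>spec th\<close> is
  \<open>T\<close>, and \<open>spec (unit_fun i)\<close> is the projection to the component
  i.\<close>

definition spec :: "(nat \<Rightarrow> complex) \<Rightarrow> (nat \<Rightarrow> complex) \<Rightarrow> nat \<Rightarrow> complex" where
  "spec u f r = (\<Sum>i\<le>d. u i * coef i f * Q i r)"

lemma coef_spec: "i \<le> d \<Longrightarrow> coef i (spec u f) = u i * coef i f"
  by (rule coef_unique) (simp add: spec_def)

lemma linear_spec: "linear_upto d (spec u)"
  unfolding linear_upto_def
proof (intro conjI allI impI)
  fix f g :: "nat \<Rightarrow> complex" and r assume "\<forall>s\<le>d. f s = g s"
  then have "coef i f = coef i g" for i
    by (intro coef_cong) simp
  then show "spec u f r = spec u g r"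
    by (simp add: spec_def)
qed (simp_all add: spec_def coef_linear distrib_left distrib_right sum.distrib sum_distrib_left mult_ac)

lemma linear_mul: "linear_upto d (\<lambda>f r. u r * f r)"
  by (auto simp: linear_upto_def algebra_simps)

lemma linear_T: "linear_upto d T"
  unfolding linear_upto_def using T_cong by (auto simp: T_def algebra_simps)

lemma T_spec: "r \<le> d \<Longrightarrow> T f r = spec th f r"
  using T_expand[OF coef_expand order.refl, of r f] by (simp add: spec_def mult_ac)

lemma T_unit_fun: "T (unit_fun j) i = c i * unit_fun j (i - 1) + (th 0 - b i - c i) * unit_fun j i
    + b i * unit_fun j (i + 1)"
  by (simp add: T_def)

end

section \<open>The Leonard system of a graph\<close>

text \<open>The facts needed to identify the operators of a graph on the primary module with
  operators on \<open>{..d}\<close>. The last three assumptions are the normalisations: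
  \<open>Q_sum\<close> fixes the scale of the \<open>Q i\<close>, \<open>b_0\<close> identifies the
  eigenvalue at index 0 with the valency, and \<open>c_1\<close> fixes the scale of \<open>b\<close>
  and \<open>c\<close>.\<close>

locale drg_data = leonard_data d b c "Q 1" Q th
  for d :: nat and b c :: "nat \<Rightarrow> complex" and Q :: "nat \<Rightarrow> nat \<Rightarrow> complex" and th :: "nat \<Rightarrow> complex" +
  fixes G :: "('a, 'e) pre_digraph" and E :: "nat \<Rightarrow> 'a cmat"
  assumes finite_verts: "finite (verts G)" and gdiam: "gdiam G = d" and d_pos: "1 \<le> d"
    and gdist_le: "\<lbrakk>y \<in> verts G; z \<in> verts G\<rbrakk> \<Longrightarrow> gdist G y z \<le> d"
    and gdist_ex: "\<lbrakk>z \<in> verts G; i \<le> d\<rbrakk> \<Longrightarrow> \<exists>y\<in>verts G. gdist G y z = i"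
    and gdist_0: "\<lbrakk>y \<in> verts G; z \<in> verts G\<rbrakk> \<Longrightarrow> gdist G y z = 0 \<longleftrightarrow> y = z"
    and nbrs: "\<lbrakk>y \<in> verts G; z \<in> verts G\<rbrakk> \<Longrightarrow>
      (\<Sum>u\<in>verts G. dist_mat G 1 y u * f (gdist G u z)) = T f (gdist G y z)"
    and E_eq: "\<lbrakk>i \<le> d; y \<in> verts G; z \<in> verts G\<rbrakk> \<Longrightarrow> E i y z = Q i (gdist G y z) / of_nat (card (verts G))"
    and E_outside: "\<lbrakk>i \<le> d; y \<notin> verts G \<or> z \<notin> verts G\<rbrakk> \<Longrightarrow> E i y z = 0"
    and E_mult: "\<lbrakk>i \<le> d; j \<le> d; y \<in> verts G; z \<in> verts G\<rbrakk> \<Longrightarrow>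
      (\<Sum>u\<in>verts G. E i y u * E j u z) = (if i = j then E i y z else 0)"
    and Q_sum: "r \<le> d \<Longrightarrow> (\<Sum>l\<le>d. Q l r) = (if r = 0 then of_nat (card (verts G)) else 0)"
    and b_0: "b 0 = th 0" and c_1: "c 1 = 1"

locale drg_point = drg_data d b c Q th G E
  for d :: nat and b c :: "nat \<Rightarrow> complex" and Q :: "nat \<Rightarrow> nat \<Rightarrow> complex" and th :: "nat \<Rightarrow> complex"
    and G :: "('a, 'e) pre_digraph" and E :: "nat \<Rightarrow> 'a cmat" +
  fixes p :: 'a
  assumes p: "p \<in> verts G"
begin

abbreviation "X \<equiv> verts G"

sublocale radial X "\<lambda>y. gdist G y p" d
  using gdist_le gdist_ex p by unfold_locales auto

lemma card_X: "of_nat (card X) \<noteq> (0::complex)"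
  using finite_verts p by auto

lemma mat_vec_base: "mat_vec X M (char_vec {p}) = (\<lambda>y. M y p)"
  using p finite_verts by (auto simp: mat_vec_def char_vec_def if_distrib[of "\<lambda>z. _ * z"] cong: if_cong)

lemma primary_module: "primary_module G p = W"
proof -
  have *: "(\<lambda>y. \<Sum>i\<le>d. a i * dist_mat G i y p) = rad a" for a
  proof
    fix y
    show "(\<Sum>i\<le>d. a i * dist_mat G i y p) = rad a y"
      using p gdist_le[of y p]
      by (cases "y \<in> X") (auto simp: dist_mat_def rad_def if_distrib[of "\<lambda>z. _ * z"] cong: if_cong)
  qed
  show ?thesis
    unfolding primary_module_def mat_vec_base bose_mesner_def mat_span_def gdiam
    by (auto simp: * intro!: exI[of _ "\<lambda>x y. \<Sum>i\<le>d. _ i * dist_mat G i x y"])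
qed

lemma on_W:
  assumes M: "linear_upto d M" and "\<And>f. mat_vec X A (rad f) = rad (M f)"
  shows "restrict (mat_vec X A) W = opr M"
proof
  fix v show "restrict (mat_vec X A) W v = opr M v"
    using assms opr_extensional[of M] by (cases "v \<in> W") (auto simp: opr_rad extensional_def)
qed

lemma on_W_a: "restrict (mat_vec X (dist_mat G 1)) W = opr T"
proof (rule on_W[OF linear_T])
  fix f show "mat_vec X (dist_mat G 1) (rad f) = rad (T f)"
  proof
    fix y
    have "(\<Sum>u\<in>X. dist_mat G 1 y u * rad f u) = (\<Sum>u\<in>X. dist_mat G 1 y u * f (gdist G u p))"
      by (intro sum.cong) (auto simp: rad_def)
    then show "mat_vec X (dist_mat G 1) (rad f) y = rad (T f) y"
      using nbrs[of y p f] p by (cases "y \<in> X") (auto simp: mat_vec_def rad_def dist_mat_def)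
  qed
qed

lemma on_W_diag:
  assumes "\<And>y. y \<in> X \<Longrightarrow> v y = u (gdist G y p)"
  shows "restrict (mat_vec X (diag v)) W = opr (\<lambda>f r. u r * f r)"
proof (rule on_W[OF linear_mul])
  fix f show "mat_vec X (diag v) (rad f) = rad (\<lambda>r. u r * f r)"
    using assms finite_verts
    by (auto simp: mat_vec_def diag_def rad_def if_distrib[of "\<lambda>z. z * _"] cong: if_cong)
qed

lemma on_W_a_star: "restrict (mat_vec X (\<lambda>y z. of_nat (card X) * diag (mat_vec X (E 1) (char_vec {p})) y z)) W
    = opr (\<lambda>f r. Q 1 r * f r)"
proof -
  have "(\<lambda>y z. of_nat (card X) * diag (mat_vec X (E 1) (char_vec {p})) y z)
      = diag (\<lambda>y. of_nat (card X) * E 1 y p)"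
    by (auto simp: diag_def mat_vec_base fun_eq_iff)
  then show ?thesis
    using on_W_diag[of "\<lambda>y. of_nat (card X) * E 1 y p" "Q 1"] E_eq[of 1] d_pos p card_X by simp
qed

lemma on_W_e_star:
  "restrict (mat_vec X (diag (mat_vec X (dist_mat G i) (char_vec {p})))) W = opr (\<lambda>f r. unit_fun i r * f r)"
  unfolding mat_vec_base using p by (intro on_W_diag) (auto simp: dist_mat_def unit_fun_def)

text \<open>Up to the factor \<open>card X\<close>, the radial function of \<open>Q j\<close> is the
  column of \<open>E j\<close> at p, so expanding f in the \<open>Q j\<close> reduces the claim to
  the orthogonality of the idempotents.\<close>

lemma on_W_e:
  assumes i: "i \<le> d"
  shows "restrict (mat_vec X (E i)) W = opr (spec (unit_fun i))"
proof (rule on_W[OF linear_spec])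
  fix f show "mat_vec X (E i) (rad f) = rad (spec (unit_fun i) f)"
  proof
    fix y
    show "mat_vec X (E i) (rad f) y = rad (spec (unit_fun i) f) y"
    proof (cases "y \<in> X")
      case y: True
      have "(\<Sum>u\<in>X. E i y u * rad f u)
          = (\<Sum>u\<in>X. E i y u * (\<Sum>j\<le>d. coef j f * (of_nat (card X) * E j u p)))"
      proof (intro sum.cong refl)
        fix u assume u: "u \<in> X"
        have "rad f u = (\<Sum>j\<le>d. coef j f * Q j (gdist G u p))"
          using coef_expand[OF D_le[OF u], of f] u by (simp add: rad_def)
        also have "\<dots> = (\<Sum>j\<le>d. coef j f * (of_nat (card X) * E j u p))"
          using u p card_X by (intro sum.cong refl) (simp add: E_eq)
        finally show "E i y u * rad f u = E i y u * (\<Sum>j\<le>d. coef j f * (of_nat (card X) * E j u p))"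
          by simp
      qed
      also have "\<dots> = (\<Sum>j\<le>d. coef j f * of_nat (card X) * (\<Sum>u\<in>X. E i y u * E j u p))"
        unfolding sum_distrib_left by (subst sum.swap) (simp add: mult_ac)
      also have "\<dots> = (\<Sum>j\<le>d. if i = j then coef i f * of_nat (card X) * E i y p else 0)"
        using i y p by (intro sum.cong refl) (auto simp: E_mult)
      also have "\<dots> = coef i f * Q i (gdist G y p)"
        using i y p card_X by (simp add: E_eq)
      also have "\<dots> = spec (unit_fun i) f (gdist G y p)"
        using i by (simp add: spec_def unit_fun_def if_distrib[of "\<lambda>z. z * _"] cong: if_cong)
      finally show ?thesis using y by (simp add: mat_vec_def rad_def)
    qed (simp add: mat_vec_def rad_def E_outside i)
  qed
qed

lemma graph_leonard_eq:
  "ls_alg (graph_leonard G E p) = \<AA>" "ls_diam (graph_leonard G E p) = d"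
  "ls_a (graph_leonard G E p) = opr T" "ls_a_star (graph_leonard G E p) = opr (\<lambda>f r. Q 1 r * f r)"
  "i \<le> d \<Longrightarrow> ls_e (graph_leonard G E p) i = opr (spec (unit_fun i))"
  "ls_e_star (graph_leonard G E p) i = opr (\<lambda>f r. unit_fun i r * f r)"
  by (simp_all add: graph_leonard_def Let_def primary_module gdiam on_W_a[simplified] on_W_a_star[simplified]
      on_W_e on_W_e_star)

lemma opr_cong: "\<lbrakk>linear_upto d M; linear_upto d N; \<And>f r. r \<le> d \<Longrightarrow> M f r = N f r\<rbrakk> \<Longrightarrow> opr M = opr N"
  by (simp add: opr_eq)

lemma linear_add:
  assumes M: "linear_upto d M" and N: "linear_upto d N"
  shows "linear_upto d (\<lambda>f r. M f r + N f r)"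
  unfolding linear_upto_def
proof (intro conjI allI impI)
  fix f g :: "nat \<Rightarrow> complex" and r assume "\<forall>s\<le>d. f s = g s" "r \<le> d"
  then show "M f r + N f r = M g r + N g r"
    using linear_uptoD(1)[OF M, of f g r] linear_uptoD(1)[OF N, of f g r] by simp
qed (simp_all add: linear_uptoD(2,3)[OF M] linear_uptoD(2,3)[OF N] distrib_left)

lemma linear_scale:
  assumes M: "linear_upto d M" shows "linear_upto d (\<lambda>f r. a * M f r)"
  unfolding linear_upto_def
proof (intro conjI allI impI)
  fix f g :: "nat \<Rightarrow> complex" and r assume "\<forall>s\<le>d. f s = g s" "r \<le> d"
  then show "a * M f r = a * M g r"
    using linear_uptoD(1)[OF M, of f g r] by simp
qed (simp_all add: linear_uptoD(2,3)[OF M] distrib_left)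

lemma idempotents_a_star:
  "bij_betw (\<lambda>i. opr (\<lambda>f r. unit_fun i r * f r)) {..d}
    (primitive_idempotents \<AA> (generated_subalgebra \<AA> (opr (\<lambda>f r. Q 1 r * f r))))"
  unfolding unit_fun_def
proof (rule primitive_idempotents_spectral[OF complex_algebra, where S = "\<lambda>u. opr (\<lambda>f r. u r * f r)"])
  fix u v :: "nat \<Rightarrow> complex" and a :: complex
  show "opr (\<lambda>f r. u r * f r) \<in> carrier \<AA>" by (rule opr_closed[OF linear_mul])
  show "opr (\<lambda>f r. u r * f r) \<otimes>\<^bsub>\<AA>\<^esub> opr (\<lambda>f r. v r * f r) = opr (\<lambda>f r. u r * v r * f r)"
    by (simp add: opr_mult linear_mul mult.assoc)
  show "opr (\<lambda>f r. u r * f r) \<oplus>\<^bsub>\<AA>\<^esub> opr (\<lambda>f r. v r * f r) = opr (\<lambda>f r. (u r + v r) * f r)"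
    by (subst opr_add) (simp_all add: linear_mul linear_add[OF linear_mul linear_mul] distrib_right)
  show "a \<odot>\<^bsub>\<AA>\<^esub> opr (\<lambda>f r. u r * f r) = opr (\<lambda>f r. a * u r * f r)"
    by (subst opr_smult) (auto intro!: linear_mul linear_scale simp: mult.assoc)
  show "opr (\<lambda>f r. u r * f r) = opr (\<lambda>f r. v r * f r) \<longleftrightarrow> (\<forall>i\<le>d. u i = v i)"
    unfolding opr_eq[OF linear_mul linear_mul] by (auto dest: spec[of _ "\<lambda>_. 1"])
next
  show "inj_on (Q 1) {..d}" by (rule x_inj)
qed (simp_all add: opr_one opr_zero)

lemma idempotents_a:
  "bij_betw (\<lambda>i. opr (spec (unit_fun i))) {..d} (primitive_idempotents \<AA> (generated_subalgebra \<AA> (opr T)))"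
proof -
  have T: "opr T = opr (spec th)"
    by (intro opr_cong linear_T linear_spec T_spec)
  have coef_eq: "(\<forall>f. \<forall>r\<le>d. spec u f r = spec v f r) \<longleftrightarrow> (\<forall>i\<le>d. u i = v i)" for u v
  proof
    assume *: "\<forall>f. \<forall>r\<le>d. spec u f r = spec v f r"
    show "\<forall>i\<le>d. u i = v i"
    proof (intro allI impI)
      fix i assume i: "i \<le> d"
      have "coef i (spec u (Q i)) = coef i (spec v (Q i))"
        using * by (intro coef_cong) auto
      then show "u i = v i" using i by (simp add: coef_spec coef_Q)
    qed
  qed (simp add: spec_def)
  show ?thesis
    unfolding T unit_fun_def[abs_def]
  proof (rule primitive_idempotents_spectral[OF complex_algebra, where S = "\<lambda>u. opr (spec u)"])
    fix u v :: "nat \<Rightarrow> complex" and a :: complex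
    show "opr (spec u) \<in> carrier \<AA>" by (rule opr_closed[OF linear_spec])
    show "opr (spec u) \<otimes>\<^bsub>\<AA>\<^esub> opr (spec v) = opr (spec (\<lambda>i. u i * v i))"
      unfolding opr_mult[OF linear_spec linear_spec]
      by (rule opr_cong[OF linear_upto_comp[OF linear_spec linear_spec] linear_spec])
        (simp add: spec_def[of u] spec_def[of "\<lambda>i. u i * v i"] coef_spec mult.assoc)
    show "opr (spec u) \<oplus>\<^bsub>\<AA>\<^esub> opr (spec v) = opr (spec (\<lambda>i. u i + v i))"
      unfolding opr_add[OF linear_spec linear_spec linear_add[OF linear_spec linear_spec]]
      by (intro opr_cong linear_add linear_spec) (simp add: spec_def distrib_right sum.distrib)
    show "a \<odot>\<^bsub>\<AA>\<^esub> opr (spec u) = opr (spec (\<lambda>i. a * u i))"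
      unfolding opr_smult[OF linear_spec linear_scale[OF linear_spec]]
      by (intro opr_cong linear_scale linear_spec) (simp add: spec_def sum_distrib_left mult.assoc)
    show "opr (spec u) = opr (spec v) \<longleftrightarrow> (\<forall>i\<le>d. u i = v i)"
      unfolding opr_eq[OF linear_spec linear_spec] by (rule coef_eq)
  next
    show "opr (spec (\<lambda>i. 1)) = \<one>\<^bsub>\<AA>\<^esub>"
      unfolding opr_one[symmetric]
      by (intro opr_cong linear_spec linear_upto_id) (simp add: spec_def coef_expand[symmetric])
    show "opr (spec (\<lambda>i. 0)) = \<zero>\<^bsub>\<AA>\<^esub>"
      unfolding opr_zero[symmetric]
      by (intro opr_cong linear_spec linear_upto_zero) (simp add: spec_def)
  qed (rule th_inj)
qed

text \<open>With respect to the distance classes \<open>a\<close> is tridiagonal with off-diagonal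
  entries from \<open>b\<close> and \<open>c\<close>; with respect to the \<open>Q i\<close>,
  \<open>a_star\<close> is tridiagonal by \<open>three_term\<close>. The conditions on products
  reduce to single entries of these matrices.\<close>

lemma leonard_system: "leonard_system (graph_leonard G E p)"
proof -
  let ?e = "\<lambda>i. opr (spec (unit_fun i))" and ?es = "\<lambda>i. opr (\<lambda>f r. unit_fun i r * f r)"
  let ?a = "opr T" and ?as = "opr (\<lambda>f r. Q 1 r * f r)"
  have bij: "bij_betw (ls_e (graph_leonard G E p)) {..d} (primitive_idempotents \<AA> (generated_subalgebra \<AA> ?a))"
  proof -
    have "bij_betw (ls_e (graph_leonard G E p)) {..d} R \<longleftrightarrow> bij_betw ?e {..d} R" for R
      by (rule bij_betw_cong) (simp add: graph_leonard_eq(5))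
    then show ?thesis using idempotents_a by blast
  qed
  have bij': "bij_betw (ls_e_star (graph_leonard G E p)) {..d} (primitive_idempotents \<AA> (generated_subalgebra \<AA> ?as))"
  proof -
    have "bij_betw (ls_e_star (graph_leonard G E p)) {..d} R \<longleftrightarrow> bij_betw ?es {..d} R" for R
      by (rule bij_betw_cong) (simp add: graph_leonard_eq(6))
    then show ?thesis using idempotents_a_star by blast
  qed
  have ev: "card {\<theta>. eigenvalue (to_mat ?a) \<theta>} = d + 1"
  proof (intro card_eigenvalues[OF linear_T th_inj])
    fix i assume i: "i \<le> d"
    show "\<exists>f. (\<exists>r\<le>d. f r \<noteq> 0) \<and> (\<forall>r\<le>d. T f r = th i * f r)"
      using Q_nonzero[OF i] T_Q[OF i] by (intro exI[of _ "Q i"]) simp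
  qed
  have ev': "card {\<theta>. eigenvalue (to_mat ?as) \<theta>} = d + 1"
  proof (intro card_eigenvalues[OF linear_mul[of "Q 1"] x_inj])
    fix i assume "i \<le> d"
    then show "\<exists>f. (\<exists>r\<le>d. f r \<noteq> 0) \<and> (\<forall>r\<le>d. Q 1 r * f r = Q 1 i * f r)"
      by (intro exI[of _ "unit_fun i"]) (auto simp: unit_fun_def)
  qed
  have star: "(?es i \<otimes>\<^bsub>\<AA>\<^esub> ?a \<otimes>\<^bsub>\<AA>\<^esub> ?es j = \<zero>\<^bsub>\<AA>\<^esub>) \<longleftrightarrow> T (unit_fun j) i = 0" if ij: "i \<le> d" "j \<le> d" for i j
  proof -
    have "?es i \<otimes>\<^bsub>\<AA>\<^esub> ?a \<otimes>\<^bsub>\<AA>\<^esub> ?es j = opr (\<lambda>f r. unit_fun i r * T (\<lambda>s. unit_fun j s * f s) r)"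
      by (simp add: opr_mult linear_mul linear_T linear_upto_comp[OF linear_mul linear_T])
    moreover have "linear_upto d (\<lambda>f r. unit_fun i r * T (\<lambda>s. unit_fun j s * f s) r)"
      using linear_upto_comp[OF linear_mul[of "unit_fun i"] linear_upto_comp[OF linear_T linear_mul[of "unit_fun j"]]] by simp
    ultimately have "?es i \<otimes>\<^bsub>\<AA>\<^esub> ?a \<otimes>\<^bsub>\<AA>\<^esub> ?es j = \<zero>\<^bsub>\<AA>\<^esub> \<longleftrightarrow>
        (\<forall>f. \<forall>r\<le>d. unit_fun i r * T (\<lambda>s. unit_fun j s * f s) r = 0)"
      by (simp add: opr_zero[symmetric] opr_eq linear_upto_zero)
    also have "\<dots> \<longleftrightarrow> T (unit_fun j) i = 0"
    proof
      assume "\<forall>f. \<forall>r\<le>d. unit_fun i r * T (\<lambda>s. unit_fun j s * f s) r = 0"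
      from this[rule_format, of i "\<lambda>_. 1"] show "T (unit_fun j) i = 0"
        using ij unit_fun_def[of i i] by simp
    next
      assume *: "T (unit_fun j) i = 0"
      have "T (\<lambda>s. unit_fun j s * f s) i = 0" for f
      proof -
        have "(\<lambda>s. unit_fun j s * f s) = (\<lambda>s. f j * unit_fun j s)" by (auto simp: unit_fun_def)
        then show ?thesis using * linear_uptoD(3)[OF linear_T ij(1)] by simp
      qed
      then show "\<forall>f. \<forall>r\<le>d. unit_fun i r * T (\<lambda>s. unit_fun j s * f s) r = 0"
        by (auto simp: unit_fun_def)
    qed
    finally show ?thesis .
  qed
  obtain h where h: "\<And>i r. \<lbrakk>i \<le> d; r \<le> d\<rbrakk> \<Longrightarrow> Q 1 r * Q i r = (\<Sum>j\<le>d. h i j * Q j r)"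
    "\<And>i j. \<lbrakk>i \<le> d; j \<le> d; j + 1 < i \<or> i + 1 < j\<rbrakk> \<Longrightarrow> h i j = 0"
    "\<And>i j. \<lbrakk>i \<le> d; j \<le> d; j + 1 = i \<or> i + 1 = j\<rbrakk> \<Longrightarrow> h i j \<noteq> 0"
    by (rule three_term) blast
  \<comment> \<open>The outer factors are projections, so the product is governed by one number: the
    coefficient of \<open>Q i\<close> in \<open>Q 1 * Q j\<close>.\<close>
  have e: "(?e i \<otimes>\<^bsub>\<AA>\<^esub> ?as \<otimes>\<^bsub>\<AA>\<^esub> ?e j = \<zero>\<^bsub>\<AA>\<^esub>) \<longleftrightarrow> h j i = 0" if ij: "i \<le> d" "j \<le> d" for i j
  proof -
    define M where "M f = spec (unit_fun i) (\<lambda>r. Q 1 r * spec (unit_fun j) f r)" for f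
    have M: "linear_upto d M"
      using linear_upto_comp[OF linear_spec[of "unit_fun i"] linear_upto_comp[OF linear_mul[of "Q 1"] linear_spec[of "unit_fun j"]]]
      unfolding M_def[abs_def] by simp
    have "spec (unit_fun l) f r = coef l f * Q l r" if "l \<le> d" for l f r
      using that by (simp add: spec_def unit_fun_def if_distrib[of "\<lambda>z. z * _"] cong: if_cong)
    then have "M f r = coef i (\<lambda>s. coef j f * (Q 1 s * Q j s)) * Q i r" for f r
      using ij by (simp add: M_def mult.left_commute)
    moreover have "coef i (\<lambda>s. Q 1 s * Q j s) = h j i"
      using coef_unique[of "\<lambda>s. Q 1 s * Q j s" "h j" i] h(1)[OF ij(2)] ij(1) by simp
    ultimately have Mf: "M f r = coef j f * h j i * Q i r" for f r
      by (simp add: coef_linear)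
    have "?e i \<otimes>\<^bsub>\<AA>\<^esub> ?as \<otimes>\<^bsub>\<AA>\<^esub> ?e j = opr M"
      by (simp add: M_def[abs_def] opr_mult linear_mul linear_spec linear_upto_comp[OF linear_spec linear_mul])
    then have "?e i \<otimes>\<^bsub>\<AA>\<^esub> ?as \<otimes>\<^bsub>\<AA>\<^esub> ?e j = \<zero>\<^bsub>\<AA>\<^esub> \<longleftrightarrow> (\<forall>f. \<forall>r\<le>d. coef j f * h j i * Q i r = 0)"
      by (simp add: opr_zero[symmetric] opr_eq linear_upto_zero M Mf)
    also have "\<dots> \<longleftrightarrow> h j i = 0"
    proof
      assume *: "\<forall>f. \<forall>r\<le>d. coef j f * h j i * Q i r = 0"
      obtain r where "r \<le> d" "Q i r \<noteq> 0" using Q_nonzero[OF ij(1)] by blast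
      then show "h j i = 0" using *[rule_format, of r "Q j"] ij by (simp add: coef_Q)
    qed simp
    finally show ?thesis .
  qed
  have T0: "T (unit_fun j) i = 0" if "i \<le> d" "j \<le> d" "\<bar>int i - int j\<bar> > 1" for i j
    using that c_0 by (cases "i = 0") (auto simp: T_def unit_fun_def)
  have T1: "T (unit_fun j) i \<noteq> 0" if "i \<le> d" "j \<le> d" "\<bar>int i - int j\<bar> = 1" for i j
  proof -
    from that(3) consider "i = j + 1" | "j = i + 1" by linarith
    then show ?thesis
      using that b_nz[of i] c_nz[of i] c_0 by cases (auto simp: T_def unit_fun_def)
  qed
  have h0: "h j i = 0" if "i \<le> d" "j \<le> d" "\<bar>int i - int j\<bar> > 1" for i j
    using that by (intro h(2)) auto
  have h1: "h j i \<noteq> 0" if "i \<le> d" "j \<le> d" "\<bar>int i - int j\<bar> = 1" for i j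
    using that by (intro h(3)) auto
  show ?thesis
    unfolding leonard_system_def Let_def graph_leonard_eq(1-4)
  proof (intro conjI allI impI)
    show "complex_algebra \<AA>" by (rule complex_algebra)
    show "?a \<in> carrier \<AA>" "?as \<in> carrier \<AA>"
      by (rule opr_closed, rule linear_T linear_mul)+
    show "\<exists>h\<in>algebra_iso \<AA> (module_mat TYPE(complex) (d + 1) (d + 1)).
        card {\<theta>. eigenvalue (h ?a) \<theta>} = d + 1 \<and> card {\<theta>. eigenvalue (h ?as) \<theta>} = d + 1"
      using to_mat_iso ev ev' by blast
    show "bij_betw (ls_e (graph_leonard G E p)) {..d} (primitive_idempotents \<AA> (generated_subalgebra \<AA> ?a))"
      by (rule bij)
    show "bij_betw (ls_e_star (graph_leonard G E p)) {..d} (primitive_idempotents \<AA> (generated_subalgebra \<AA> ?as))"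
      by (rule bij')
  next
    fix i j assume ij: "i \<le> d" "j \<le> d" and "1 < \<bar>int i - int j\<bar>"
    then show "ls_e_star (graph_leonard G E p) i \<otimes>\<^bsub>\<AA>\<^esub> ?a \<otimes>\<^bsub>\<AA>\<^esub> ls_e_star (graph_leonard G E p) j = \<zero>\<^bsub>\<AA>\<^esub>"
      "ls_e (graph_leonard G E p) i \<otimes>\<^bsub>\<AA>\<^esub> ?as \<otimes>\<^bsub>\<AA>\<^esub> ls_e (graph_leonard G E p) j = \<zero>\<^bsub>\<AA>\<^esub>"
      unfolding graph_leonard_eq(5)[OF ij(1)] graph_leonard_eq(5)[OF ij(2)] graph_leonard_eq(6) star[OF ij] e[OF ij]
      using T0[OF ij] h0[OF ij] by simp_all
  next
    fix i j assume ij: "i \<le> d" "j \<le> d" and "\<bar>int i - int j\<bar> = 1"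
    then show "ls_e_star (graph_leonard G E p) i \<otimes>\<^bsub>\<AA>\<^esub> ?a \<otimes>\<^bsub>\<AA>\<^esub> ls_e_star (graph_leonard G E p) j \<noteq> \<zero>\<^bsub>\<AA>\<^esub>"
      "ls_e (graph_leonard G E p) i \<otimes>\<^bsub>\<AA>\<^esub> ?as \<otimes>\<^bsub>\<AA>\<^esub> ls_e (graph_leonard G E p) j \<noteq> \<zero>\<^bsub>\<AA>\<^esub>"
      unfolding graph_leonard_eq(5)[OF ij(1)] graph_leonard_eq(5)[OF ij(2)] graph_leonard_eq(6) star[OF ij] e[OF ij]
      using T1[OF ij] h1[OF ij] by simp_all
  qed
qed

end

section \<open>Scalars that can be recovered from the operators\<close>

context drg_point
begin

abbreviation (input) "e_star i \<equiv> opr (\<lambda>f r. unit_fun i r * f r)"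
abbreviation (input) "a_star \<equiv> opr (\<lambda>f r. Q 1 r * f r)"

lemma smult_e_star: "\<eta> \<odot>\<^bsub>\<AA>\<^esub> e_star i = opr (\<lambda>f r. \<eta> * (unit_fun i r * f r))"
  by (rule opr_smult[OF linear_mul linear_scale[OF linear_mul]])

lemma smult_e_star_inject:
  assumes i: "i \<le> d" and eq: "\<eta> \<odot>\<^bsub>\<AA>\<^esub> e_star i = \<theta> \<odot>\<^bsub>\<AA>\<^esub> e_star i"
  shows "\<eta> = \<theta>"
proof -
  have "opr (\<lambda>f r. \<eta> * (unit_fun i r * f r)) = opr (\<lambda>f r. \<theta> * (unit_fun i r * f r))"
    using eq unfolding smult_e_star .
  then have "\<forall>f. \<forall>r\<le>d. \<eta> * (unit_fun i r * f r) = \<theta> * (unit_fun i r * f r)"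
    unfolding opr_eq[OF linear_scale[OF linear_mul] linear_scale[OF linear_mul]] .
  from this[rule_format, OF i, of "\<lambda>_. 1"] show ?thesis
    by (simp add: unit_fun_def)
qed

lemma smult_e_inject:
  assumes eq: "\<eta> \<odot>\<^bsub>\<AA>\<^esub> opr (spec (unit_fun 0)) = \<theta> \<odot>\<^bsub>\<AA>\<^esub> opr (spec (unit_fun 0))"
  shows "\<eta> = \<theta>"
proof -
  have "\<forall>f. \<forall>r\<le>d. \<eta> * spec (unit_fun 0) f r = \<theta> * spec (unit_fun 0) f r"
    using eq unfolding opr_smult[OF linear_spec linear_scale[OF linear_spec]]
      opr_eq[OF linear_scale[OF linear_spec] linear_scale[OF linear_spec]] .
  from this[rule_format, of 0 "Q 0"] have "\<eta> * spec (unit_fun 0) (Q 0) 0 = \<theta> * spec (unit_fun 0) (Q 0) 0"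
    by simp
  moreover have "spec (unit_fun 0) (Q 0) 0 = 1"
    using Q_0[of 0] by (simp add: spec_def unit_fun_def coef_Q if_distrib[of "\<lambda>z. z * _"] cong: if_cong)
  ultimately show ?thesis by simp
qed

lemma a_e: "opr T \<otimes>\<^bsub>\<AA>\<^esub> opr (spec (unit_fun 0)) = th 0 \<odot>\<^bsub>\<AA>\<^esub> opr (spec (unit_fun 0))"
  unfolding opr_mult[OF linear_T linear_spec] opr_smult[OF linear_spec linear_scale[OF linear_spec]]
proof (rule opr_cong[OF linear_upto_comp[OF linear_T linear_spec] linear_scale[OF linear_spec]])
  fix f r assume r: "r \<le> d"
  show "T (spec (unit_fun 0) f) r = th 0 * spec (unit_fun 0) f r"
    unfolding T_spec[OF r] spec_def[of th]
    by (simp add: spec_def[of "unit_fun 0" f r] coef_spec unit_fun_def sum_distrib_left mult_ac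
        if_distrib[of "\<lambda>z. z * _"] if_distrib[of "\<lambda>z. _ * z"] cong: if_cong)
qed

lemma a_star_e_star:
  assumes "i \<le> d"
  shows "a_star \<otimes>\<^bsub>\<AA>\<^esub> e_star i = Q 1 i \<odot>\<^bsub>\<AA>\<^esub> e_star i"
  unfolding opr_mult[OF linear_mul linear_mul] smult_e_star
  by (rule opr_cong[OF linear_upto_comp[OF linear_mul linear_mul] linear_scale[OF linear_mul]])
    (simp add: unit_fun_def)

lemma T_unit_mul: "T (\<lambda>s. unit_fun i s * f s) r = f i * T (unit_fun i) r"
proof -
  have "(\<lambda>s. unit_fun i s * f s) = (\<lambda>s. f i * unit_fun i s)"
    by (auto simp: unit_fun_def)
  then show ?thesis by (simp add: T_def algebra_simps)
qed

lemma e_star_a_e_star: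
  "e_star i \<otimes>\<^bsub>\<AA>\<^esub> opr T \<otimes>\<^bsub>\<AA>\<^esub> e_star j = opr (\<lambda>f r. unit_fun i r * (f j * T (unit_fun j) i))"
  and linear_e_star_a_e_star: "linear_upto d (\<lambda>f r. unit_fun i r * (f j * T (unit_fun j) i))"
proof -
  note l1 = linear_upto_comp[OF linear_mul[of "unit_fun i"] linear_T]
  note l2 = linear_upto_comp[OF l1 linear_mul[of "unit_fun j"]]
  have *: "(\<lambda>f r. unit_fun i r * T (\<lambda>s. unit_fun j s * f s) r)
      = (\<lambda>f r. unit_fun i r * (f j * T (unit_fun j) i))"
    by (intro ext) (auto simp: T_unit_mul unit_fun_def[of i])
  show "e_star i \<otimes>\<^bsub>\<AA>\<^esub> opr T \<otimes>\<^bsub>\<AA>\<^esub> e_star j = opr (\<lambda>f r. unit_fun i r * (f j * T (unit_fun j) i))"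
    unfolding opr_mult[OF linear_mul linear_T] opr_mult[OF l1 linear_mul] * ..
  show "linear_upto d (\<lambda>f r. unit_fun i r * (f j * T (unit_fun j) i))"
    using l2 unfolding * .
qed

lemma e_star_a_e_star_same:
  assumes "i \<le> d"
  shows "e_star i \<otimes>\<^bsub>\<AA>\<^esub> opr T \<otimes>\<^bsub>\<AA>\<^esub> e_star i = (th 0 - b i - c i) \<odot>\<^bsub>\<AA>\<^esub> e_star i"
proof -
  have "T (unit_fun i) i = th 0 - b i - c i"
    using c_0 by (cases "i = 0") (auto simp: T_def unit_fun_def)
  then show ?thesis
    unfolding e_star_a_e_star smult_e_star
    by (intro opr_cong[OF linear_e_star_a_e_star[of i i] linear_scale[OF linear_mul]])
      (auto simp: unit_fun_def)
qed

text \<open>Separately, \<open>b i\<close> and \<open>c (i + 1)\<close> depend on how the basis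
  vectors are scaled; passing from class i to i + 1 and back exhibits their product, which does
  not.\<close>

lemma e_star_a_e_star_a_e_star:
  assumes i: "i < d"
  shows "(e_star i \<otimes>\<^bsub>\<AA>\<^esub> opr T \<otimes>\<^bsub>\<AA>\<^esub> e_star (i + 1)) \<otimes>\<^bsub>\<AA>\<^esub> (e_star (i + 1) \<otimes>\<^bsub>\<AA>\<^esub> opr T \<otimes>\<^bsub>\<AA>\<^esub> e_star i)
    = (b i * c (i + 1)) \<odot>\<^bsub>\<AA>\<^esub> e_star i"
proof -
  have T: "T (unit_fun (i + 1)) i = b i" "T (unit_fun i) (i + 1) = c (i + 1)"
    using c_0 by (cases "i = 0"; auto simp: T_def unit_fun_def)+
  note l = linear_e_star_a_e_star[of i "i + 1", unfolded T] linear_e_star_a_e_star[of "i + 1" i, unfolded T]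
  show ?thesis
    unfolding e_star_a_e_star smult_e_star T opr_mult[OF l]
    by (rule opr_cong[OF linear_upto_comp[OF l] linear_scale[OF linear_mul]])
      (auto simp: unit_fun_def)
qed

end

text \<open>The two modules consist of functions on different vertex sets; the isomorphism matches
  operators that have the same matrix in the bases of distance classes. Equal parameters make these
  matrices equal.\<close>

lemma leonard_isomorphicI:
  fixes G :: "('a, 'e) pre_digraph" and H :: "('b, 'f) pre_digraph"
  assumes 1: "drg_point d b c Q th G E p" and 2: "drg_point d b' c' Q' th' H F q"
    and b: "\<And>r. r \<le> d \<Longrightarrow> b' r = b r" and c: "\<And>r. r \<le> d \<Longrightarrow> c' r = c r"
    and Q: "\<And>l r. \<lbrakk>l \<le> d; r \<le> d\<rbrakk> \<Longrightarrow> Q' l r = Q l r"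
  shows "leonard_isomorphic (graph_leonard G E p) (graph_leonard H F q)"
proof -
  interpret G: drg_point d b c Q th G E p by (rule 1)
  interpret H: drg_point d b' c' Q' th' H F q by (rule 2)
  define \<sigma> where "\<sigma> = inv_into (carrier H.\<AA>) H.to_mat \<circ> G.to_mat"
  have \<sigma>: "\<sigma> \<in> algebra_iso G.\<AA> H.\<AA>"
    unfolding \<sigma>_def
    by (rule algebra_iso_trans[OF G.to_mat_iso algebra_iso_inverse[OF H.complex_algebra H.to_mat_iso]])
  have inj: "inj_on H.to_mat (carrier H.\<AA>)"
    using H.to_mat_iso by (auto simp: algebra_iso_def ring_iso_def bij_betw_def)
  have map: "\<sigma> (G.opr M) = H.opr N" if "linear_upto d M" "linear_upto d N"
      "\<And>i j. \<lbrakk>i \<le> d; j \<le> d\<rbrakk> \<Longrightarrow> N (unit_fun j) i = M (unit_fun j) i" for M N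
  proof -
    have "G.to_mat (G.opr M) = H.to_mat (H.opr N)"
      unfolding G.to_mat_opr[OF that(1)] H.to_mat_opr[OF that(2)]
      by (intro eq_matI) (auto simp: that(3))
    then show ?thesis
      using inv_into_f_f[OF inj H.opr_closed[OF that(2)]] by (simp add: \<sigma>_def)
  qed
  have th0: "th' 0 = th 0"
    using G.b_0 H.b_0 b[of 0] by simp
  have spec: "H.spec u f r = G.spec u f r" if r: "r \<le> d" for u f r
  proof -
    have "H.coef i f = G.coef i f" if "i \<le> d" for i
      using that G.coef_expand[of _ f] Q by (intro H.coef_unique) auto
    then show ?thesis
      unfolding H.spec_def G.spec_def using r Q by (intro sum.cong) auto
  qed
  have a: "\<sigma> (G.opr G.T) = H.opr H.T"
    by (rule map[OF G.linear_T H.linear_T]) (simp add: G.T_unit_fun H.T_unit_fun b c th0)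
  have as: "\<sigma> (G.opr (\<lambda>f r. Q 1 r * f r)) = H.opr (\<lambda>f r. Q' 1 r * f r)"
    using G.d_pos by (intro map[OF G.linear_mul H.linear_mul]) (simp add: Q)
  have e: "\<sigma> (G.opr (G.spec u)) = H.opr (H.spec u)" for u
    by (rule map[OF G.linear_spec H.linear_spec]) (simp add: spec)
  have es: "\<sigma> (G.opr (\<lambda>f r. u r * f r)) = H.opr (\<lambda>f r. u r * f r)" for u
    by (rule map[OF G.linear_mul H.linear_mul]) simp
  show ?thesis
    unfolding leonard_isomorphic_def G.graph_leonard_eq(1-4) H.graph_leonard_eq(1-4)
    using G.leonard_system H.leonard_system \<sigma> a as e es
    by (auto simp: G.graph_leonard_eq(5,6) H.graph_leonard_eq(5,6) intro!: bexI[of _ \<sigma>])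
qed

text \<open>An isomorphism preserves the relations that express \<open>th 0\<close>, the values of
  \<open>Q 1\<close>, the diagonal entries and the products \<open>b i * c (i + 1)\<close> as
  scalars acting on the idempotents.\<close>

lemma leonard_isomorphicD:
  fixes G :: "('a, 'e) pre_digraph" and H :: "('b, 'f) pre_digraph"
  assumes 1: "drg_point d b c Q th G E p" and 2: "drg_point d b' c' Q' th' H F q"
    and iso: "leonard_isomorphic (graph_leonard G E p) (graph_leonard H F q)"
    and r: "r \<le> d"
  shows "b' r = b r" and "c' r = c r" and "Q' 1 r = Q 1 r"
proof -
  interpret G: drg_point d b c Q th G E p by (rule 1)
  interpret H: drg_point d b' c' Q' th' H F q by (rule 2)
  let ?eG = "\<lambda>i. G.opr (\<lambda>f r. unit_fun i r * f r)" and ?eH = "\<lambda>i. H.opr (\<lambda>f r. unit_fun i r * f r)"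
  let ?aG = "G.opr G.T" and ?aH = "H.opr H.T"
  obtain \<sigma> where \<sigma>: "\<sigma> \<in> algebra_iso G.\<AA> H.\<AA>" "\<sigma> ?aG = ?aH"
    "\<sigma> (G.opr (\<lambda>f r. Q 1 r * f r)) = H.opr (\<lambda>f r. Q' 1 r * f r)"
    "\<And>i. i \<le> d \<Longrightarrow> \<sigma> (ls_e (graph_leonard G E p) i) = ls_e (graph_leonard H F q) i"
    "\<And>i. i \<le> d \<Longrightarrow> \<sigma> (?eG i) = ?eH i"
    using iso unfolding leonard_isomorphic_def G.graph_leonard_eq(1-4,6) H.graph_leonard_eq(1-4,6) by blast
  have e0: "\<sigma> (G.opr (G.spec (unit_fun 0))) = H.opr (H.spec (unit_fun 0))"
    using \<sigma>(4)[of 0] unfolding G.graph_leonard_eq(5)[OF le0] H.graph_leonard_eq(5)[OF le0] by simp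
  have mult: "\<sigma> (x \<otimes>\<^bsub>G.\<AA>\<^esub> y) = \<sigma> x \<otimes>\<^bsub>H.\<AA>\<^esub> \<sigma> y" if "x \<in> carrier G.\<AA>" "y \<in> carrier G.\<AA>" for x y
  proof -
    have "\<sigma> \<in> ring_iso G.\<AA> H.\<AA>"
      using \<sigma>(1) unfolding algebra_iso_def by blast
    from ring_iso_memE(2)[OF this that] show ?thesis .
  qed
  have smult: "\<sigma> (t \<odot>\<^bsub>G.\<AA>\<^esub> x) = t \<odot>\<^bsub>H.\<AA>\<^esub> \<sigma> x" if "x \<in> carrier G.\<AA>" for x t
    using \<sigma>(1) that unfolding algebra_iso_def by blast
  note cl = G.opr_closed[OF G.linear_mul] G.opr_closed[OF G.linear_T] G.opr_closed[OF G.linear_spec]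
  have th0: "th' 0 = th 0"
  proof -
    have "?aH \<otimes>\<^bsub>H.\<AA>\<^esub> H.opr (H.spec (unit_fun 0)) = th 0 \<odot>\<^bsub>H.\<AA>\<^esub> H.opr (H.spec (unit_fun 0))"
      using arg_cong[OF G.a_e, of \<sigma>] by (simp add: mult smult cl \<sigma>(2) e0)
    then show ?thesis
      unfolding H.a_e by (rule H.smult_e_inject)
  qed
  have Q1: "Q' 1 i = Q 1 i" if i: "i \<le> d" for i
  proof -
    have "H.opr (\<lambda>f r. Q' 1 r * f r) \<otimes>\<^bsub>H.\<AA>\<^esub> ?eH i = Q 1 i \<odot>\<^bsub>H.\<AA>\<^esub> ?eH i"
      using arg_cong[OF G.a_star_e_star[OF i], of \<sigma>]
      unfolding mult[OF cl(1) cl(1)] smult[OF cl(1)] \<sigma>(3) \<sigma>(5)[OF i] .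
    then show ?thesis
      unfolding H.a_star_e_star[OF i] by (rule H.smult_e_star_inject[OF i])
  qed
  have cl2: "?eG i \<otimes>\<^bsub>G.\<AA>\<^esub> ?aG \<in> carrier G.\<AA>" "?eG i \<otimes>\<^bsub>G.\<AA>\<^esub> ?aG \<otimes>\<^bsub>G.\<AA>\<^esub> ?eG j \<in> carrier G.\<AA>" for i j
    by (intro G.mult_closed cl)+
  have word: "\<sigma> (?eG i \<otimes>\<^bsub>G.\<AA>\<^esub> ?aG \<otimes>\<^bsub>G.\<AA>\<^esub> ?eG j) = ?eH i \<otimes>\<^bsub>H.\<AA>\<^esub> ?aH \<otimes>\<^bsub>H.\<AA>\<^esub> ?eH j"
    if "i \<le> d" "j \<le> d" for i j
    unfolding mult[OF cl2(1) cl(1)] mult[OF cl(1) cl(2)] \<sigma>(2) \<sigma>(5)[OF that(1)] \<sigma>(5)[OF that(2)] ..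
  have diagonal: "th' 0 - b' i - c' i = th 0 - b i - c i" if i: "i \<le> d" for i
  proof -
    have "?eH i \<otimes>\<^bsub>H.\<AA>\<^esub> ?aH \<otimes>\<^bsub>H.\<AA>\<^esub> ?eH i = (th 0 - b i - c i) \<odot>\<^bsub>H.\<AA>\<^esub> ?eH i"
      using arg_cong[OF G.e_star_a_e_star_same[OF i], of \<sigma>]
      unfolding word[OF i i] smult[OF cl(1)] \<sigma>(5)[OF i] .
    then show ?thesis
      unfolding H.e_star_a_e_star_same[OF i] by (rule H.smult_e_star_inject[OF i])
  qed
  have offdiagonal: "b' i * c' (i + 1) = b i * c (i + 1)" if i: "i < d" for i
  proof -
    have i': "i \<le> d" "i + 1 \<le> d" using i by auto
    have "(?eH i \<otimes>\<^bsub>H.\<AA>\<^esub> ?aH \<otimes>\<^bsub>H.\<AA>\<^esub> ?eH (i + 1)) \<otimes>\<^bsub>H.\<AA>\<^esub> (?eH (i + 1) \<otimes>\<^bsub>H.\<AA>\<^esub> ?aH \<otimes>\<^bsub>H.\<AA>\<^esub> ?eH i)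
        = (b i * c (i + 1)) \<odot>\<^bsub>H.\<AA>\<^esub> ?eH i"
      using arg_cong[OF G.e_star_a_e_star_a_e_star[OF i], of \<sigma>]
      unfolding mult[OF cl2(2) cl2(2)] word[OF i'] word[OF i'(2,1)] smult[OF cl(1)] \<sigma>(5)[OF i'(1)] .
    then show ?thesis
      unfolding H.e_star_a_e_star_a_e_star[OF i] by (rule H.smult_e_star_inject[OF i'(1)])
  qed
  \<comment> \<open>Start from \<open>b 0 = th 0\<close> and \<open>c 0 = 0\<close>. Given
    \<open>b i\<close>, which is nonzero for i < d, the product determines \<open>c (i + 1)\<close>,
    and the diagonal entry then determines \<open>b (i + 1)\<close>.\<close>
  have bc: "b' i = b i \<and> c' i = c i" if "i \<le> d" for i
    using that
  proof (induction i)
    case 0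
    then show ?case using G.c_0 H.c_0 G.b_0 H.b_0 th0 by simp
  next
    case (Suc i)
    then have "b' i = b i" "b i \<noteq> 0" using G.b_nz[of i] by auto
    then have "c' (Suc i) = c (Suc i)"
      using offdiagonal[of i] Suc.prems by simp
    then show ?case
      using diagonal[OF Suc.prems] th0 by simp
  qed
  show "b' r = b r" "c' r = c r" "Q' 1 r = Q 1 r"
    using bc[OF r] Q1[OF r] by auto
qed

section \<open>Distance-regular graphs\<close>

lemma distance_regularD:
  assumes "distance_regular G"
  shows "graph G" "connected G"
  using assms by (auto simp: distance_regular_def)

locale connected_graph = graph G for G :: "('a, 'e) pre_digraph" +
  assumes conn: "connected G"
begin

lemma verts_nonempty: "verts G \<noteq> {}"
  using conn by (auto simp: connected_def strongly_connected_def)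

lemma dominates_sym: "y \<rightarrow>\<^bsub>G\<^esub> z \<longleftrightarrow> z \<rightarrow>\<^bsub>G\<^esub> y"
  using arcs_ends_symmetric[OF sym_arcs] by blast

lemma dominates_verts: "y \<rightarrow>\<^bsub>G\<^esub> z \<Longrightarrow> y \<in> verts G \<and> z \<in> verts G"
  by (auto simp: arcs_ends_conv)

lemma ex_awalk: assumes "x \<in> verts G" "y \<in> verts G" shows "\<exists>p. awalk x p y"
proof -
  have "strongly_connected G"
    using symmetric_connected_imp_strongly_connected[OF sym_arcs conn] .
  then show ?thesis using assms by (auto simp: reachable_awalk)
qed

lemma gdist_awalk: assumes "x \<in> verts G" "y \<in> verts G" obtains p where "awalk x p y" "length p = gdist G x y"
proof -
  have "\<exists>n p. awalk x p y \<and> length p = n" using ex_awalk[OF assms] by blast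
  from LeastI_ex[OF this] show ?thesis using that by (auto simp: gdist_def)
qed

lemma gdist_le_length: "awalk x p y \<Longrightarrow> gdist G x y \<le> length p"
  unfolding gdist_def by (rule Least_le) blast

lemma awalk_reverse: "awalk x p y \<Longrightarrow> \<exists>q. awalk y q x \<and> length q = length p"
proof (induction p arbitrary: x)
  case Nil
  then show ?case by (auto simp: awalk_Nil_iff)
next
  case (Cons e es)
  then have e: "e \<in> arcs G" "x = tail G e" "awalk (head G e) es y"
    by (auto simp: awalk_Cons_iff)
  then obtain q where q: "awalk y q (head G e)" "length q = length es"
    using Cons.IH by blast
  obtain e' where "e' \<in> arcs G" "tail G e' = head G e" "head G e' = tail G e"
    using sym_arcs e(1) unfolding symmetric_conv by metis
  then have "awalk (head G e) [e'] x"
    using e by (auto simp: awalk_Cons_iff awalk_Nil_iff)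
  then have "awalk y (q @ [e']) x"
    by (rule awalk_appendI[OF q(1)])
  then show ?case
    using q(2) by (intro exI[of _ "q @ [e']"]) simp
qed

lemma gdist_sym: assumes "x \<in> verts G" "y \<in> verts G" shows "gdist G x y = gdist G y x"
proof -
  have le: "gdist G v u \<le> gdist G u v" if uv: "u \<in> verts G" "v \<in> verts G" for u v
  proof -
    obtain p where p: "awalk u p v" "length p = gdist G u v" by (rule gdist_awalk[OF uv])
    obtain q where "awalk v q u" "length q = length p" using awalk_reverse[OF p(1)] by blast
    then show ?thesis using gdist_le_length[of v q u] p(2) by simp
  qed
  show ?thesis by (rule le_antisym[OF le[OF assms(2,1)] le[OF assms]])
qed

lemma gdist_eq_0: assumes "x \<in> verts G" "y \<in> verts G" shows "gdist G x y = 0 \<longleftrightarrow> x = y"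
proof
  assume "gdist G x y = 0"
  moreover obtain p where "awalk x p y" "length p = gdist G x y" by (rule gdist_awalk[OF assms])
  ultimately show "x = y" by (auto simp: awalk_Nil_iff)
next
  assume "x = y"
  then have "awalk x [] y" using assms by (simp add: awalk_Nil_iff)
  from gdist_le_length[OF this] show "gdist G x y = 0" by simp
qed

lemma dominates_awalk: assumes "y \<rightarrow>\<^bsub>G\<^esub> z" obtains e where "awalk y [e] z"
proof -
  obtain e where "e \<in> arcs G" "tail G e = y" "head G e = z"
    using assms by (auto simp: arcs_ends_conv)
  then have "awalk y [e] z" by (auto simp: awalk_Cons_iff awalk_Nil_iff)
  then show ?thesis by (rule that)
qed

lemma gdist_step:
  assumes "x \<in> verts G" "y \<rightarrow>\<^bsub>G\<^esub> z" shows "gdist G x z \<le> gdist G x y + 1"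
proof -
  obtain p where p: "awalk x p y" "length p = gdist G x y"
    using gdist_awalk assms dominates_verts by metis
  obtain e where "awalk y [e] z" by (rule dominates_awalk[OF assms(2)])
  from gdist_le_length[OF awalk_appendI[OF p(1) this]] show ?thesis using p(2) by simp
qed

lemma gdist_eq_1: assumes "y \<in> verts G" "z \<in> verts G" shows "gdist G y z = 1 \<longleftrightarrow> y \<rightarrow>\<^bsub>G\<^esub> z"
proof
  assume "gdist G y z = 1"
  moreover obtain p where "awalk y p z" "length p = gdist G y z" by (rule gdist_awalk[OF assms])
  ultimately obtain e where "awalk y [e] z" by (auto simp: length_Suc_conv)
  then show "y \<rightarrow>\<^bsub>G\<^esub> z" by (auto simp: awalk_Cons_iff awalk_Nil_iff arcs_ends_conv)
next
  assume yz: "y \<rightarrow>\<^bsub>G\<^esub> z"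
  then have "y \<noteq> z" using no_loops by (auto simp: arcs_ends_conv)
  then have "gdist G y z \<noteq> 0" using gdist_eq_0[OF assms] by simp
  moreover have "gdist G y z \<le> 1"
    using gdist_step[OF assms(1) yz] gdist_eq_0[OF assms(1,1)] by simp
  ultimately show "gdist G y z = 1" by simp
qed

lemma gdist_pred:
  assumes "x \<in> verts G" "y \<in> verts G" "gdist G x y = Suc n"
  obtains z where "z \<in> verts G" "y \<rightarrow>\<^bsub>G\<^esub> z" "gdist G x z = n"
proof -
  obtain p where p: "awalk y p x" "length p = Suc n"
    using gdist_awalk[OF assms(2,1)] gdist_sym[OF assms(1,2)] assms(3) by metis
  then obtain e es where e: "p = e # es" "length es = n" by (auto simp: length_Suc_conv)
  define z where "z = head G e"
  have w: "awalk z es x" and yz: "y \<rightarrow>\<^bsub>G\<^esub> z"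
    using p(1) e by (auto simp: awalk_Cons_iff z_def arcs_ends_conv)
  have z: "z \<in> verts G" using dominates_verts[OF yz] by simp
  have "gdist G x z \<le> n"
    using gdist_le_length[OF w] gdist_sym[OF z assms(1)] e by simp
  moreover have "gdist G x y \<le> gdist G x z + 1"
    using gdist_step[OF assms(1)] yz dominates_sym by blast
  ultimately show ?thesis using that z yz assms(3) by simp
qed

lemma gdist_finite: "finite {gdist G x y | x y. x \<in> verts G \<and> y \<in> verts G}"
proof -
  have "{gdist G x y | x y. x \<in> verts G \<and> y \<in> verts G} = (\<lambda>(x, y). gdist G x y) ` (verts G \<times> verts G)"
    by auto
  then show ?thesis by simp
qed

lemma gdist_le_gdiam: "\<lbrakk>x \<in> verts G; y \<in> verts G\<rbrakk> \<Longrightarrow> gdist G x y \<le> gdiam G"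
  unfolding gdiam_def by (rule Max_ge[OF gdist_finite]) blast

lemma gdiam_attained: obtains x y where "x \<in> verts G" "y \<in> verts G" "gdist G x y = gdiam G"
proof -
  have "gdiam G \<in> {gdist G x y | x y. x \<in> verts G \<and> y \<in> verts G}"
    unfolding gdiam_def using verts_nonempty by (intro Max_in[OF gdist_finite]) blast
  then show ?thesis using that by auto
qed

lemma gdist_below:
  assumes "x \<in> verts G" "y \<in> verts G" "i \<le> gdist G x y"
  shows "\<exists>z\<in>verts G. gdist G x z = i"
  using assms
proof (induction "gdist G x y" arbitrary: y)
  case 0
  then show ?case by auto
next
  case (Suc n)
  show ?case
  proof (cases "i = Suc n")
    case False
    obtain z where "z \<in> verts G" "gdist G x z = n"
      using gdist_pred[OF Suc.prems(1,2) Suc.hyps(2)[symmetric]] by metis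
    then show ?thesis using Suc.hyps(1)[of z] Suc.prems Suc.hyps(2) False by auto
  qed (use Suc in auto)
qed

end

locale drg = connected_graph G for G :: "('a, 'e) pre_digraph" +
  fixes b c :: "nat \<Rightarrow> nat"
  assumes b_card: "\<lbrakk>x \<in> verts G; y \<in> verts G\<rbrakk> \<Longrightarrow>
      card {z \<in> verts G. y \<rightarrow>\<^bsub>G\<^esub> z \<and> gdist G x z = gdist G x y + 1} = b (gdist G x y)"
    and c_card: "\<lbrakk>x \<in> verts G; y \<in> verts G\<rbrakk> \<Longrightarrow>
      card {z \<in> verts G. y \<rightarrow>\<^bsub>G\<^esub> z \<and> gdist G x z + 1 = gdist G x y} = c (gdist G x y)"
begin

abbreviation "d \<equiv> gdiam G"
abbreviation "X \<equiv> verts G"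
abbreviation "D \<equiv> gdist G"

lemma b_last: "b d = 0"
proof -
  obtain x y where xy: "x \<in> X" "y \<in> X" "D x y = d" by (rule gdiam_attained)
  have empty: "{z \<in> X. y \<rightarrow>\<^bsub>G\<^esub> z \<and> D x z = D x y + 1} = {}"
    using gdist_le_gdiam[OF xy(1)] xy(3) by force
  show ?thesis using b_card[OF xy(1,2)] xy(3) unfolding empty by simp
qed

lemma c_first: "c 0 = 0"
proof -
  obtain x where x: "x \<in> X" using verts_nonempty by blast
  then show ?thesis using c_card[OF x x] gdist_eq_0[OF x x] by simp
qed

lemma b_pos: assumes "r < d" shows "b r \<noteq> 0"
proof -
  obtain x y where xy: "x \<in> X" "y \<in> X" "D x y = d" by (rule gdiam_attained)
  then obtain u where u: "u \<in> X" "D x u = Suc r"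
    using gdist_below[of x y "Suc r"] assms by auto
  then obtain v where v: "v \<in> X" "u \<rightarrow>\<^bsub>G\<^esub> v" "D x v = r"
    using gdist_pred[OF xy(1) u] by metis
  have "u \<in> {z \<in> X. v \<rightarrow>\<^bsub>G\<^esub> z \<and> D x z = D x v + 1}"
    using u v dominates_sym by auto
  then have "card {z \<in> X. v \<rightarrow>\<^bsub>G\<^esub> z \<and> D x z = D x v + 1} \<noteq> 0"
    by (subst card_0_eq) auto
  then have "b (D x v) \<noteq> 0" unfolding b_card[OF xy(1) v(1)] .
  then show ?thesis using v(3) by simp
qed

text \<open>The numbers \<open>b r\<close> were shown to be nonzero along one pair at maximal
  distance. As they do not depend on the pair, it is possible to move outwards from every
  vertex.\<close>

lemma gdist_any: assumes "x \<in> X" "i \<le> d" shows "\<exists>y\<in>X. D y x = i"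
  using assms(2)
proof (induction i)
  case 0
  then show ?case using assms(1) gdist_eq_0 by blast
next
  case (Suc i)
  then obtain y where y: "y \<in> X" "D y x = i" by auto
  have xy: "D x y = i" using gdist_sym[OF assms(1) y(1)] y(2) by simp
  have "{z \<in> X. y \<rightarrow>\<^bsub>G\<^esub> z \<and> D x z = D x y + 1} \<noteq> {}"
  proof
    assume empty: "{z \<in> X. y \<rightarrow>\<^bsub>G\<^esub> z \<and> D x z = D x y + 1} = {}"
    have "b (D x y) = 0" using b_card[OF assms(1) y(1)] unfolding empty by simp
    then show False using b_pos[of i] Suc.prems xy by simp
  qed
  then obtain z where z: "z \<in> X" "D x z = Suc i" using xy by auto
  then have "D z x = Suc i" using gdist_sym[OF assms(1) z(1)] by simp
  then show ?case using z(1) by blast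
qed

lemma c_pos: assumes "1 \<le> r" "r \<le> d" shows "c r \<noteq> 0"
proof -
  obtain x where x: "x \<in> X" using verts_nonempty by blast
  obtain y where "y \<in> X" "D y x = r" using gdist_any[OF x assms(2)] by blast
  then have y: "y \<in> X" "D x y = r" using gdist_sym[OF x] by simp_all
  obtain z where z: "z \<in> X" "y \<rightarrow>\<^bsub>G\<^esub> z" "D x z = r - 1"
    using gdist_pred[OF x y(1), of "r - 1"] y(2) assms(1) by auto
  then have "z \<in> {z \<in> X. y \<rightarrow>\<^bsub>G\<^esub> z \<and> D x z + 1 = D x y}"
    using y assms(1) by auto
  then have "card {z \<in> X. y \<rightarrow>\<^bsub>G\<^esub> z \<and> D x z + 1 = D x y} \<noteq> 0"
    by (subst card_0_eq) auto
  then have "c (D x y) \<noteq> 0" unfolding c_card[OF x y(1)] .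
  then show ?thesis using y(2) by simp
qed

lemma c_second: assumes "1 \<le> d" shows "c 1 = 1"
proof -
  obtain x where x: "x \<in> X" using verts_nonempty by blast
  obtain y where "y \<in> X" "D y x = 1" using gdist_any[OF x assms] by blast
  then have y: "y \<in> X" "D x y = 1" using gdist_sym[OF x] by simp_all
  have "{z \<in> X. y \<rightarrow>\<^bsub>G\<^esub> z \<and> D x z + 1 = D x y} = {x}"
    using gdist_eq_0[OF x] gdist_eq_1[OF x y(1)] dominates_sym x y by auto
  then show ?thesis using c_card[OF x y(1)] y(2) by simp
qed

text \<open>The operator \<open>T\<close> before eigenvalues are available: the valency
  \<open>b 0\<close> takes the place of \<open>th 0\<close>.\<close>

definition shift :: "(nat \<Rightarrow> complex) \<Rightarrow> nat \<Rightarrow> complex" where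
  "shift f r = of_nat (c r) * f (r - 1) + (of_nat (b 0) - of_nat (b r) - of_nat (c r)) * f r + of_nat (b r) * f (r + 1)"

text \<open>A neighbour of y is at most one step closer to or farther from z than y is. Two of the
  three classes are counted by \<open>b\<close> and \<open>c\<close>, the third by what remains of
  the valency.\<close>

lemma neighbour_sum:
  assumes y: "y \<in> X" and z: "z \<in> X"
  shows "(\<Sum>u\<in>X. dist_mat G 1 y u * f (D u z)) = shift f (D y z)"
proof -
  define N where "N = {u \<in> X. y \<rightarrow>\<^bsub>G\<^esub> u}"
  define r where "r = D y z"
  define Np where "Np = {u \<in> X. y \<rightarrow>\<^bsub>G\<^esub> u \<and> D z u = D z y + 1}"
  define Nm where "Nm = {u \<in> X. y \<rightarrow>\<^bsub>G\<^esub> u \<and> D z u + 1 = D z y}"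
  define N0 where "N0 = {u \<in> X. y \<rightarrow>\<^bsub>G\<^esub> u \<and> D z u = D z y}"
  have fin: "finite N" "finite Np" "finite Nm" "finite N0" by (auto simp: N_def Np_def Nm_def N0_def)
  have r: "D z y = r" using gdist_sym[OF y z] by (simp add: r_def)
  have sub: "u \<in> Np \<or> u \<in> Nm \<or> u \<in> N0" if "u \<in> N" for u
  proof -
    have u: "u \<in> X" "y \<rightarrow>\<^bsub>G\<^esub> u" "u \<rightarrow>\<^bsub>G\<^esub> y" using that dominates_sym by (auto simp: N_def)
    have "D z u \<le> D z y + 1" "D z y \<le> D z u + 1"
      using gdist_step[OF z u(2)] gdist_step[OF z u(3)] by auto
    then show ?thesis using u by (auto simp: Np_def Nm_def N0_def)
  qed
  have N: "N = Np \<union> (Nm \<union> N0)" "Np \<inter> (Nm \<union> N0) = {}" "Nm \<inter> N0 = {}"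
    using sub by (auto simp: N_def Np_def Nm_def N0_def)
  have cards: "card Np = b r" "card Nm = c r"
    using b_card[OF z y] c_card[OF z y] by (simp_all add: Np_def Nm_def r)
  have "N = {u \<in> X. y \<rightarrow>\<^bsub>G\<^esub> u \<and> D y u = D y y + 1}"
    using gdist_eq_1[OF y] gdist_eq_0[OF y y] by (auto simp: N_def)
  then have "card N = b 0"
    using b_card[OF y y] gdist_eq_0[OF y y] by simp
  moreover have "card N = card Np + (card Nm + card N0)"
    using N fin by (metis card_Un_disjoint finite_Un)
  ultimately have "b 0 = b r + (c r + card N0)"
    using cards by simp
  then have "(of_nat (b 0) :: complex) = of_nat (b r) + (of_nat (c r) + of_nat (card N0))"
    by simp
  then have k: "of_nat (card N0) = of_nat (b 0) - of_nat (b r) - (of_nat (c r) :: complex)"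
    by simp
  have "(\<Sum>u\<in>X. dist_mat G 1 y u * f (D u z)) = (\<Sum>u\<in>X. if u \<in> N then f (D u z) else 0)"
    using y gdist_eq_1[OF y] by (intro sum.cong) (auto simp: dist_mat_def N_def)
  also have "\<dots> = (\<Sum>u\<in>N. f (D u z))"
    by (subst sum.inter_restrict[symmetric]) (auto simp: N_def Int_def intro!: sum.cong)
  also have "\<dots> = (\<Sum>u\<in>N. f (D z u))"
    using gdist_sym[OF _ z] by (intro sum.cong) (auto simp: N_def)
  also have "\<dots> = (\<Sum>u\<in>Np. f (D z u)) + ((\<Sum>u\<in>Nm. f (D z u)) + (\<Sum>u\<in>N0. f (D z u)))"
    unfolding N(1) using fin N(2,3) by (simp add: sum.union_disjoint)
  also have "(\<Sum>u\<in>Np. f (D z u)) = of_nat (b r) * f (r + 1)"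
    using cards by (simp add: Np_def r)
  also have "(\<Sum>u\<in>Nm. f (D z u)) = (\<Sum>u\<in>Nm. f (r - 1))"
    by (intro sum.cong) (auto simp: Nm_def r)
  also have "\<dots> = of_nat (c r) * f (r - 1)"
    using cards by simp
  also have "(\<Sum>u\<in>N0. f (D z u)) = of_nat (card N0) * f r"
    by (simp add: N0_def r)
  finally show ?thesis
    unfolding k shift_def r_def[symmetric] by (simp add: algebra_simps)
qed

end

lemma distance_regular_drg:
  assumes "distance_regular G" obtains b c where "drg G b c"
proof -
  obtain b c where bc: "\<forall>x\<in>verts G. \<forall>y\<in>verts G.
        card {z \<in> verts G. y \<rightarrow>\<^bsub>G\<^esub> z \<and> gdist G x z = gdist G x y + 1} = b (gdist G x y) \<and>
        card {z \<in> verts G. y \<rightarrow>\<^bsub>G\<^esub> z \<and> gdist G x z + 1 = gdist G x y} = c (gdist G x y)"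
    using assms unfolding distance_regular_def by blast
  have "connected_graph G"
    using distance_regularD[OF assms] by (simp add: connected_graph_def connected_graph_axioms_def)
  then have "drg G b c"
    using bc by (auto simp: drg_def drg_axioms_def)
  then show ?thesis by (rule that)
qed

section \<open>The Bose-Mesner algebra and its idempotents\<close>

context drg
begin

definition rmat :: "(nat \<Rightarrow> complex) \<Rightarrow> 'a cmat" where
  "rmat a = (\<lambda>x y. if x \<in> X \<and> y \<in> X then a (D x y) else 0)"

definition mult_on :: "'a cmat \<Rightarrow> 'a cmat \<Rightarrow> 'a cmat" (infixl "\<star>" 70) where
  "M \<star> N = (\<lambda>x y. \<Sum>z\<in>X. M x z * N z y)"

lemma rmat_eq: "rmat a = rmat e \<longleftrightarrow> (\<forall>i\<le>d. a i = e i)"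
proof
  assume *: "rmat a = rmat e"
  obtain x where x: "x \<in> X" using verts_nonempty by blast
  show "\<forall>i\<le>d. a i = e i"
  proof (intro allI impI)
    fix i assume "i \<le> d"
    then obtain y where "y \<in> X" "D y x = i" using gdist_any[OF x] by blast
    then show "a i = e i" using fun_cong[OF fun_cong[OF *, of y], of x] x by (simp add: rmat_def)
  qed
next
  assume "\<forall>i\<le>d. a i = e i"
  then show "rmat a = rmat e" by (auto simp: rmat_def gdist_le_gdiam intro!: ext)
qed

lemma dist_mat_rmat: "dist_mat G i = rmat (unit_fun i)"
  by (intro ext) (simp add: dist_mat_def rmat_def unit_fun_def)

lemma rmat_linear:
  "(\<lambda>x y. rmat a x y + rmat e x y) = rmat (\<lambda>r. a r + e r)" "(\<lambda>x y. t * rmat a x y) = rmat (\<lambda>r. t * a r)"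
  "(\<lambda>x y. rmat a x y - rmat e x y) = rmat (\<lambda>r. a r - e r)" "rmat (\<lambda>r. 0) = (\<lambda>x y. 0)"
  by (auto simp: rmat_def intro!: ext)

lemma rmat_sum: "(\<lambda>x y. \<Sum>i\<in>I. u i * rmat (a i) x y) = rmat (\<lambda>r. \<Sum>i\<in>I. u i * a i r)"
  by (auto simp: rmat_def intro!: ext)

lemma rmat_sym: "rmat a x y = rmat a y x"
  using gdist_sym[of x y] by (auto simp: rmat_def)

lemma bose_mesner_rmat: "bose_mesner G = range rmat"
proof -
  have "(\<lambda>x y. \<Sum>i\<le>d. u i * dist_mat G i x y) = rmat u" for u
    unfolding dist_mat_rmat rmat_sum rmat_eq
    by (simp add: unit_fun_def if_distrib[of "\<lambda>z. _ * z"] cong: if_cong)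
  then show ?thesis
    unfolding bose_mesner_def mat_span_def by auto
qed

lemma shift_unit_fun:
  assumes "i < d"
  shows "shift (unit_fun i) r = of_nat (c (i + 1)) * unit_fun (i + 1) r
    + (of_nat (b 0) - of_nat (b i) - of_nat (c i)) * unit_fun i r
    + (if i = 0 then 0 else of_nat (b (i - 1)) * unit_fun (i - 1) r)"
  using c_first by (cases r; cases i) (auto simp: shift_def unit_fun_def)

text \<open>Multiplication of the j-th distance matrix by the adjacency matrix gives the (j + 1)-th
  one with the nonzero factor \<open>c (j + 1)\<close>, up to the two preceding ones. Hence the
  claim for i follows from those for i - 1 and i - 2.\<close>

lemma dist_mat_mult_radial:
  assumes "i \<le> d"
  shows "\<exists>e. \<forall>x\<in>X. \<forall>y\<in>X. (\<Sum>z\<in>X. dist_mat G i x z * a (D z y)) = e (D x y)"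
  using assms
proof (induction i rule: less_induct)
  case (less i)
  show ?case
  proof (cases i)
    case 0
    have "(\<Sum>z\<in>X. dist_mat G 0 x z * a (D z y)) = a (D x y)" if "x \<in> X" "y \<in> X" for x y
    proof -
      have "(\<Sum>z\<in>X. dist_mat G 0 x z * a (D z y)) = (\<Sum>z\<in>X. if x = z then a (D x y) else 0)"
        using that gdist_eq_0 by (intro sum.cong) (auto simp: dist_mat_def)
      then show ?thesis using that by simp
    qed
    then show ?thesis unfolding 0 by blast
  next
    case (Suc j)
    then have j: "j < d" "j < i" "j \<le> d" using less.prems by auto
    obtain e where e: "\<And>x y. \<lbrakk>x \<in> X; y \<in> X\<rbrakk> \<Longrightarrow> (\<Sum>z\<in>X. dist_mat G j x z * a (D z y)) = e (D x y)"
      using less.IH[OF j(2,3)] by blast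
    obtain e' where e': "\<And>x y. \<lbrakk>x \<in> X; y \<in> X\<rbrakk> \<Longrightarrow> (\<Sum>z\<in>X. dist_mat G (j - 1) x z * a (D z y)) = e' (D x y)"
    proof -
      have "j - 1 < i" "j - 1 \<le> d" using j by auto
      from less.IH[OF this] show thesis using that by blast
    qed
    define f where "f r = (shift e r - (of_nat (b 0) - of_nat (b j) - of_nat (c j)) * e r
        - (if j = 0 then 0 else of_nat (b (j - 1)) * e' r)) / of_nat (c (j + 1))" for r
    have cj: "(of_nat (c (j + 1)) :: complex) \<noteq> 0"
      using c_pos[of "j + 1"] j by simp
    have "(\<Sum>z\<in>X. dist_mat G i x z * a (D z y)) = f (D x y)" if x: "x \<in> X" and y: "y \<in> X" for x y
    proof -
      have "shift e (D x y) = (\<Sum>u\<in>X. dist_mat G 1 x u * e (D u y))"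
        using neighbour_sum[OF x y] by simp
      also have "\<dots> = (\<Sum>u\<in>X. dist_mat G 1 x u * (\<Sum>z\<in>X. dist_mat G j u z * a (D z y)))"
        using e y by (intro sum.cong) auto
      also have "\<dots> = (\<Sum>z\<in>X. (\<Sum>u\<in>X. dist_mat G 1 x u * dist_mat G j u z) * a (D z y))"
        unfolding sum_distrib_left sum_distrib_right by (subst sum.swap) (simp add: mult_ac)
      also have "\<dots> = (\<Sum>z\<in>X. (of_nat (c (j + 1)) * dist_mat G i x z
          + (of_nat (b 0) - of_nat (b j) - of_nat (c j)) * dist_mat G j x z
          + (if j = 0 then 0 else of_nat (b (j - 1)) * dist_mat G (j - 1) x z)) * a (D z y))"
      proof (intro sum.cong refl)
        fix z assume z: "z \<in> X"
        have "(\<Sum>u\<in>X. dist_mat G 1 x u * dist_mat G j u z) = (\<Sum>u\<in>X. dist_mat G 1 x u * unit_fun j (D u z))"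
          using z by (intro sum.cong) (auto simp: dist_mat_def unit_fun_def)
        also have "\<dots> = shift (unit_fun j) (D x z)" by (rule neighbour_sum[OF x z])
        finally show "(\<Sum>u\<in>X. dist_mat G 1 x u * dist_mat G j u z) * a (D z y)
          = (of_nat (c (j + 1)) * dist_mat G i x z
            + (of_nat (b 0) - of_nat (b j) - of_nat (c j)) * dist_mat G j x z
            + (if j = 0 then 0 else of_nat (b (j - 1)) * dist_mat G (j - 1) x z)) * a (D z y)"
          using x z Suc unfolding shift_unit_fun[OF j(1)] dist_mat_rmat rmat_def by simp
      qed
      also have "\<dots> = of_nat (c (j + 1)) * (\<Sum>z\<in>X. dist_mat G i x z * a (D z y))
          + (of_nat (b 0) - of_nat (b j) - of_nat (c j)) * (\<Sum>z\<in>X. dist_mat G j x z * a (D z y))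
          + (if j = 0 then 0 else of_nat (b (j - 1)) * (\<Sum>z\<in>X. dist_mat G (j - 1) x z * a (D z y)))"
        by (simp add: distrib_right sum.distrib sum_distrib_left mult.assoc)
      finally show ?thesis
        using cj unfolding e[OF x y] e'[OF x y] f_def by (simp add: field_simps)
    qed
    then show ?thesis by blast
  qed
qed

lemma rmat_mult: "\<exists>e. rmat a \<star> rmat a' = rmat e"
proof -
  define e where "e i = (SOME e. \<forall>x\<in>X. \<forall>y\<in>X. (\<Sum>z\<in>X. dist_mat G i x z * a' (D z y)) = e (D x y))" for i
  have e: "(\<Sum>z\<in>X. dist_mat G i x z * a' (D z y)) = e i (D x y)" if "i \<le> d" "x \<in> X" "y \<in> X" for i x y
    using someI_ex[OF dist_mat_mult_radial[OF that(1), of a']] that(2,3) unfolding e_def by blast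
  have "(rmat a \<star> rmat a') x y = rmat (\<lambda>r. \<Sum>i\<le>d. a i * e i r) x y" for x y
  proof (cases "x \<in> X \<and> y \<in> X")
    case True
    have "(\<Sum>z\<in>X. rmat a x z * rmat a' z y) = (\<Sum>z\<in>X. (\<Sum>i\<le>d. a i * dist_mat G i x z) * a' (D z y))"
    proof (intro sum.cong refl)
      fix z assume z: "z \<in> X"
      then have "(\<Sum>i\<le>d. a i * dist_mat G i x z) = a (D x z)"
        using True gdist_le_gdiam by (simp add: dist_mat_def if_distrib[of "\<lambda>z. _ * z"] cong: if_cong)
      then show "rmat a x z * rmat a' z y = (\<Sum>i\<le>d. a i * dist_mat G i x z) * a' (D z y)"
        using True z by (simp add: rmat_def)
    qed
    also have "\<dots> = (\<Sum>i\<le>d. a i * (\<Sum>z\<in>X. dist_mat G i x z * a' (D z y)))"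
      unfolding sum_distrib_left sum_distrib_right by (subst sum.swap) (simp add: mult_ac)
    also have "\<dots> = (\<Sum>i\<le>d. a i * e i (D x y))"
      using True e by (intro sum.cong) auto
    finally show ?thesis using True by (simp add: rmat_def mult_on_def)
  qed (auto simp: rmat_def mult_on_def)
  then show ?thesis by (intro exI ext)
qed

text \<open>Two symmetric matrices with a symmetric product commute, and products of radial matrices
  are radial.\<close>

lemma rmat_commute: "rmat a \<star> rmat a' = rmat a' \<star> rmat a"
proof (intro ext)
  fix x y
  obtain e where e: "rmat a \<star> rmat a' = rmat e" using rmat_mult by blast
  have "(rmat a \<star> rmat a') x y = (rmat a \<star> rmat a') y x"
    unfolding e by (rule rmat_sym)
  also have "\<dots> = (rmat a' \<star> rmat a) x y"
    unfolding mult_on_def using rmat_sym[of a y] rmat_sym[of a' _ x] by (simp add: mult.commute)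
  finally show "(rmat a \<star> rmat a') x y = (rmat a' \<star> rmat a) x y" .
qed

lemma mult_assoc: "(L \<star> M) \<star> N = L \<star> (M \<star> N)"
  unfolding mult_on_def sum_distrib_left sum_distrib_right
  by (intro ext, subst sum.swap) (simp add: mult.assoc)

text \<open>For a primitive idempotent A and an idempotent B commuting with it, A splits into the
  orthogonal idempotents \<open>A \<star> B\<close> and its complement in A, so
  \<open>A \<star> B\<close> is 0 or A. Applied both ways, a nonzero product would equal both M and
  N.\<close>

lemma primitive_idempotents_orthogonal:
  assumes M: "M \<in> primitive_idempotents (mat_algebra X) (bose_mesner G)"
    and N: "N \<in> primitive_idempotents (mat_algebra X) (bose_mesner G)" and "M \<noteq> N"
  shows "M \<star> N = (\<lambda>x y. 0)"
proof -
  have alg: "monoid.mult (mat_algebra X) = (\<star>)" "zero (mat_algebra X) = (\<lambda>x y. 0)"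
    "add (mat_algebra X) = (\<lambda>M N x y. M x y + N x y)"
    by (simp_all add: mat_algebra_def mult_on_def[abs_def])
  have idem: "M \<star> M = M" "N \<star> N = N" and range: "M \<in> range rmat" "N \<in> range rmat"
    using M N unfolding primitive_idempotents_def alg bose_mesner_rmat by auto
  have comm: "A \<star> B = B \<star> A" if "A \<in> range rmat" "B \<in> range rmat" for A B
    using that rmat_commute by blast
  have split: "A \<star> B = (\<lambda>x y. 0) \<or> A \<star> B = A"
    if A: "A \<in> primitive_idempotents (mat_algebra X) (range rmat)" and B: "B \<in> range rmat" "B \<star> B = B" for A B
  proof -
    have A': "A \<in> range rmat" "A \<star> A = A" using A unfolding primitive_idempotents_def alg by auto
    define f where "f = A \<star> B"
    define g where "g = (\<lambda>x y. A x y - f x y)"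
    have f: "f \<in> range rmat" 
    proof -
      obtain a e where "A = rmat a" "B = rmat e" using A'(1) B(1) by blast
      then show ?thesis using rmat_mult[of a e] unfolding f_def by auto
    qed
    have g: "g \<in> range rmat" using A'(1) f unfolding g_def by (auto simp: rmat_linear)
    have ff: "f \<star> f = f"
    proof -
      have "f \<star> f = A \<star> (B \<star> (A \<star> B))" unfolding f_def by (simp only: mult_assoc)
      also have "B \<star> (A \<star> B) = A \<star> B"
        unfolding mult_assoc[symmetric] comm[OF B(1) A'(1)] unfolding mult_assoc B(2) ..
      also have "A \<star> (A \<star> B) = f" unfolding mult_assoc[symmetric] A'(2) f_def ..
      finally show ?thesis .
    qed
    have Af: "A \<star> f = f" unfolding f_def mult_assoc[symmetric] A'(2) ..
    have fA: "f \<star> A = f" using comm[OF f A'(1)] Af by simp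
    have diff: "(\<lambda>x y. P x y - R x y) \<star> S = (\<lambda>x y. (P \<star> S) x y - (R \<star> S) x y)"
      "S \<star> (\<lambda>x y. P x y - R x y) = (\<lambda>x y. (S \<star> P) x y - (S \<star> R) x y)" for P R S :: "'a cmat"
      by (simp_all add: mult_on_def left_diff_distrib right_diff_distrib sum_subtractf)
    have gf: "g \<star> f = (\<lambda>x y. 0)" unfolding g_def diff(1) Af ff by simp
    have fg: "f \<star> g = (\<lambda>x y. 0)" unfolding g_def diff(2) fA ff by simp
    have gA: "g \<star> A = g" unfolding g_def diff(1) A'(2) fA ..
    have gg: "g \<star> g = g"
    proof -
      have "g \<star> g = (\<lambda>x y. (g \<star> A) x y - (g \<star> f) x y)" by (subst (2) g_def, rule diff(2))
      then show ?thesis unfolding gA gf by simp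
    qed
    have "A = (\<lambda>x y. f x y + g x y)" by (simp add: g_def)
    then have "f = (\<lambda>x y. 0) \<or> g = (\<lambda>x y. 0)"
      using A f g ff gg fg gf unfolding primitive_idempotents_def alg by blast
    moreover have "f = A" if "g = (\<lambda>x y. 0)"
      using that by (auto simp: g_def fun_eq_iff)
    ultimately show ?thesis unfolding f_def by blast
  qed
  have 1: "M \<star> N = (\<lambda>x y. 0) \<or> M \<star> N = M"
    using split M range idem unfolding bose_mesner_rmat by blast
  have 2: "N \<star> M = (\<lambda>x y. 0) \<or> N \<star> M = N"
    using split N range idem unfolding bose_mesner_rmat by blast
  show ?thesis
    using 1 2 \<open>M \<noteq> N\<close> unfolding comm[OF range(2,1)] by metis
qed

text \<open>\<open>b s\<close> is nonzero for s < d, so row s determines the value at s + 1 from the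
  previous ones. Eigenspaces are therefore at most one-dimensional.\<close>

lemma shift_eigenfunction_zero:
  assumes "\<And>r. r \<le> d \<Longrightarrow> shift f r = t * f r" and "f 0 = 0" and "r \<le> d"
  shows "f r = 0"
  using assms(3)
proof (induction r rule: less_induct)
  case (less r)
  show ?case
  proof (cases r)
    case (Suc s)
    then have s: "s < d" "f s = 0" "f (s - 1) = 0" using less by auto
    have "of_nat (b s) * f (s + 1) = 0"
      using assms(1)[of s] s by (simp add: shift_def)
    then show ?thesis using b_pos[OF s(1)] Suc by simp
  qed (simp add: assms(2))
qed

text \<open>Shared by a graph and an induced subgraph. For the latter only the spans of the initial
  segments of the ordering are given, which is why polynomial dependence on \<open>E 1\<close> is
  assumed instead of the recurrence for entrywise products.\<close>

theorem drg_dataI: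
  assumes d: "1 \<le> d"
    and E: "bij_betw E {..d} (primitive_idempotents (mat_algebra X) (bose_mesner G))"
    and E0: "E 0 = (\<lambda>x y. if x \<in> X \<and> y \<in> X then 1 / of_nat (card X) else 0)"
    and poly: "\<And>i. i \<le> d \<Longrightarrow> \<exists>p. degree p = i \<and>
      (\<forall>x\<in>X. \<forall>y\<in>X. of_nat (card X) * E i x y = poly p (of_nat (card X) * E 1 x y))"
  shows "\<exists>Q th. drg_data d (\<lambda>r. of_nat (b r)) (\<lambda>r. of_nat (c r)) Q th G E"
proof -
  define n :: complex where "n = of_nat (card X)"
  have n: "n \<noteq> 0" using verts_nonempty by (simp add: n_def)
  obtain x0 where x0: "x0 \<in> X" using verts_nonempty by blast
  have alg: "monoid.mult (mat_algebra X) = (\<star>)" "zero (mat_algebra X) = (\<lambda>x y. 0)"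
    by (simp_all add: mat_algebra_def mult_on_def[abs_def])
  have prim: "E i \<in> primitive_idempotents (mat_algebra X) (bose_mesner G)" if "i \<le> d" for i
    using E that by (auto simp: bij_betw_def)
  define q where "q i = (SOME a. E i = rmat a)" for i
  have q: "E i = rmat (q i)" if "i \<le> d" for i
  proof -
    have "\<exists>a. E i = rmat a"
      using prim[OF that] unfolding primitive_idempotents_def bose_mesner_rmat by blast
    from someI_ex[OF this] show ?thesis unfolding q_def .
  qed
  have idem: "E i \<star> E i = E i" and nonzero: "E i \<noteq> (\<lambda>x y. 0)" if "i \<le> d" for i
    using prim[OF that] unfolding primitive_idempotents_def alg by blast+
  have orth: "E i \<star> E j = (if i = j then E i else (\<lambda>x y. 0))" if "i \<le> d" "j \<le> d" for i j
  proof (cases "i = j")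
    case False
    then have "E i \<noteq> E j" using E that by (auto simp: bij_betw_def inj_on_def)
    then show ?thesis using primitive_idempotents_orthogonal prim that False by simp
  qed (use idem that in simp)
  define Q where "Q i r = n * q i r" for i r
  have EQ: "E i x y = Q i (D x y) / n" if "i \<le> d" "x \<in> X" "y \<in> X" for i x y
    using that n by (simp add: q rmat_def Q_def)
  have sum_mult: "(\<lambda>x y. \<Sum>i\<le>d. u i * E i x y) \<star> E j = (\<lambda>x y. u j * E j x y)" if "j \<le> d" for u j
  proof (intro ext)
    fix x y
    have "(\<Sum>z\<in>X. (\<Sum>i\<le>d. u i * E i x z) * E j z y) = (\<Sum>i\<le>d. u i * (E i \<star> E j) x y)"
      unfolding mult_on_def sum_distrib_left sum_distrib_right by (subst sum.swap) (simp add: mult_ac)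
    also have "\<dots> = (\<Sum>i\<le>d. if i = j then u j * E j x y else 0)"
      using that by (intro sum.cong) (auto simp: orth)
    also have "\<dots> = u j * E j x y" using that by simp
    finally show "((\<lambda>x y. \<Sum>i\<le>d. u i * E i x y) \<star> E j) x y = u j * E j x y" unfolding mult_on_def .
  qed
  have E_sum: "(\<lambda>x y. \<Sum>i\<le>d. u i * E i x y) = rmat (\<lambda>r. \<Sum>i\<le>d. u i * q i r)" for u
  proof -
    have "(\<lambda>x y. \<Sum>i\<le>d. u i * E i x y) = (\<lambda>x y. \<Sum>i\<le>d. u i * rmat (q i) x y)"
      using q by simp
    then show ?thesis unfolding rmat_sum .
  qed
  \<comment> \<open>Multiplication of a combination of the idempotents by \<open>E j\<close>
    isolates its j-th coefficient.\<close>
  have indep: "\<forall>i\<le>d. u i = 0" if "\<forall>r\<le>d. (\<Sum>i\<le>d. u i * q i r) = 0" for u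
  proof (intro allI impI)
    fix j assume j: "j \<le> d"
    have "(\<lambda>x y. \<Sum>i\<le>d. u i * E i x y) = rmat (\<lambda>r. 0)"
      unfolding E_sum rmat_eq using that by simp
    then have "(\<lambda>x y. u j * E j x y) = (\<lambda>x y. 0)"
      using sum_mult[OF j, of u] by (simp add: rmat_linear mult_on_def)
    then show "u j = 0"
      using nonzero[OF j] by (auto simp: fun_eq_iff)
  qed
  have expand: "\<exists>u. \<forall>r\<le>d. f r = (\<Sum>i\<le>d. u i * q i r)" for f
    using square_system_solvable[of d q f] indep by metis
  \<comment> \<open>The identity matrix is some combination of the idempotents; multiplying it by
    \<open>E j\<close> shows that the j-th coefficient is 1.\<close>
  have Q_sum: "(\<Sum>l\<le>d. Q l r) = (if r = 0 then n else 0)" if r: "r \<le> d" for r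
  proof -
    obtain u where u: "\<And>r. r \<le> d \<Longrightarrow> unit_fun 0 r = (\<Sum>i\<le>d. u i * q i r)"
      using expand[of "unit_fun 0"] by blast
    have U: "(\<lambda>x y. \<Sum>i\<le>d. u i * E i x y) = dist_mat G 0"
      unfolding E_sum dist_mat_rmat rmat_eq using u by simp
    have "u j = 1" if j: "j \<le> d" for j
    proof -
      have "dist_mat G 0 \<star> E j = E j"
      proof (intro ext)
        fix x y
        have "(\<Sum>z\<in>X. dist_mat G 0 x z * E j z y) = (\<Sum>z\<in>X. if x = z then E j x y else 0)"
          using gdist_eq_0 q[OF j] by (intro sum.cong) (auto simp: dist_mat_def rmat_def)
        then show "(dist_mat G 0 \<star> E j) x y = E j x y"
          using q[OF j] by (auto simp: rmat_def mult_on_def)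
      qed
      then have "(\<lambda>x y. u j * E j x y) = E j"
        using sum_mult[OF j, of u] unfolding U by simp
      moreover obtain x y where "E j x y \<noteq> 0" using nonzero[OF j] by (auto simp: fun_eq_iff)
      ultimately show ?thesis by (metis mult_cancel_right1)
    qed
    then have "(\<Sum>l\<le>d. q l r) = unit_fun 0 r" using u[OF r] by simp
    then show ?thesis by (simp add: Q_def sum_distrib_left[symmetric] unit_fun_def)
  qed
  obtain u1 where u1: "\<And>r. r \<le> d \<Longrightarrow> unit_fun 1 r = (\<Sum>i\<le>d. u1 i * q i r)"
    using expand[of "unit_fun 1"] by blast
  \<comment> \<open>The eigenvalues of the graph are the coordinates of the adjacency matrix in the
    basis of idempotents.\<close>
  define th where "th = u1"
  have A: "(\<lambda>x y. \<Sum>i\<le>d. th i * E i x y) = dist_mat G 1"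
    unfolding E_sum dist_mat_rmat rmat_eq th_def using u1 by simp
  have eig: "shift (Q i) r = th i * Q i r" if i: "i \<le> d" and r: "r \<le> d" for i r
  proof -
    obtain y where y: "y \<in> X" "D y x0 = r" using gdist_any[OF x0 r] by blast
    have "(\<Sum>z\<in>X. dist_mat G 1 y z * E i z x0) = th i * E i y x0"
      using fun_cong[OF fun_cong[OF sum_mult[OF i, of th], of y], of x0] unfolding A mult_on_def .
    moreover have "(\<Sum>z\<in>X. dist_mat G 1 y z * E i z x0) = (\<Sum>z\<in>X. dist_mat G 1 y z * (Q i (D z x0) / n))"
      using EQ[OF i _ x0] by (intro sum.cong) auto
    moreover have "\<dots> = shift (\<lambda>r. Q i r / n) r"
      using neighbour_sum[OF y(1) x0, of "\<lambda>r. Q i r / n"] y(2) by simp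
    ultimately have "shift (\<lambda>r. Q i r / n) r = th i * (Q i r / n)"
      using EQ[OF i y(1) x0] y(2) by simp
    moreover have "shift (\<lambda>r. Q i r / n) r = shift (Q i) r / n"
      by (simp add: shift_def add_divide_distrib)
    ultimately show ?thesis using n by simp
  qed
  have Q0: "Q 0 r = 1" if r: "r \<le> d" for r
  proof -
    obtain y where y: "y \<in> X" "D y x0 = r" using gdist_any[OF x0 r] by blast
    then have "Q 0 r / n = 1 / n" using EQ[of 0 y x0] x0 by (simp add: E0 n_def)
    then show ?thesis using n by simp
  qed
  have th0: "th 0 = of_nat (b 0)"
    using eig[of 0 0] Q0[of 0] Q0[of 1] d by (simp add: shift_def c_first)
  \<comment> \<open>For equal eigenvalues, the combination f of \<open>Q i\<close> and
    \<open>Q j\<close> that vanishes at 0 is an eigenfunction, hence zero; this contradicts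
    \<open>indep\<close>.\<close>
  have th_inj: "inj_on th {..d}"
  proof (rule inj_onI)
    fix i j assume "i \<in> {..d}" "j \<in> {..d}" and eq: "th i = th j"
    then have ij: "i \<le> d" "j \<le> d" by auto
    define f where "f r = Q j 0 * Q i r - Q i 0 * Q j r" for r
    have "shift f r = th i * f r" if "r \<le> d" for r
    proof -
      have "shift f r = Q j 0 * shift (Q i) r - Q i 0 * shift (Q j) r"
        by (simp add: f_def shift_def algebra_simps)
      then show ?thesis using eig[OF _ that] ij eq by (simp add: f_def algebra_simps)
    qed
    then have f: "f r = 0" if "r \<le> d" for r
      by (rule shift_eigenfunction_zero) (simp_all add: f_def that)
    have Qi0: "Q i 0 \<noteq> 0"
    proof
      assume "Q i 0 = 0"
      then have "Q i r = 0" if "r \<le> d" for r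
        using shift_eigenfunction_zero[of "Q i" "th i" r] eig[OF ij(1)] that by simp
      then have "rmat (q i) = rmat (\<lambda>r. 0)" unfolding rmat_eq using n by (simp add: Q_def)
      then show False using nonzero[OF ij(1)] q[OF ij(1)] by (simp add: rmat_linear)
    qed
    show "i = j"
    proof (rule ccontr)
      assume neq: "i \<noteq> j"
      define u where "u l = (if l = i then Q j 0 else if l = j then - Q i 0 else 0)" for l
      have "(\<Sum>l\<le>d. u l * q l r) = 0" if r: "r \<le> d" for r
      proof -
        have "(\<Sum>l\<le>d. u l * q l r) = (\<Sum>l\<in>{i, j}. u l * q l r)"
          using ij by (intro sum.mono_neutral_right) (auto simp: u_def)
        also have "\<dots> = f r / n" using neq n by (simp add: u_def f_def Q_def diff_divide_distrib)
        finally show ?thesis using f[OF r] by simp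
      qed
      then have "u j = 0" using indep[of u] ij by blast
      then show False using neq Qi0 by (simp add: u_def)
    qed
  qed
  have Q_poly: "\<exists>p. degree p = i \<and> (\<forall>r\<le>d. Q i r = poly p (Q 1 r))" if i: "i \<le> d" for i
  proof -
    obtain p where p: "degree p = i" "\<And>x y. \<lbrakk>x \<in> X; y \<in> X\<rbrakk> \<Longrightarrow> n * E i x y = poly p (n * E 1 x y)"
      using poly[OF i] unfolding n_def by blast
    have "Q i r = poly p (Q 1 r)" if r: "r \<le> d" for r
    proof -
      obtain y where y: "y \<in> X" "D y x0 = r" using gdist_any[OF x0 r] by blast
      then show ?thesis using p(2)[OF y(1) x0] EQ[OF i y(1) x0] EQ[OF d y(1) x0] n by simp
    qed
    then show ?thesis using p(1) by blast
  qed
  \<comment> \<open>Equal values of \<open>Q 1\<close> at r and s would give equal values of all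
    \<open>Q i\<close>, hence of all functions, among them \<open>unit_fun r\<close>.\<close>
  have x_inj: "inj_on (Q 1) {..d}"
  proof (rule inj_onI)
    fix r s assume "r \<in> {..d}" "s \<in> {..d}" and eq: "Q 1 r = Q 1 s"
    then have rs: "r \<le> d" "s \<le> d" by auto
    have qrs: "q i r = q i s" if i: "i \<le> d" for i
    proof -
      obtain p where "\<forall>r\<le>d. Q i r = poly p (Q 1 r)" using Q_poly[OF i] by blast
      then have "Q i r = Q i s" using rs eq by simp
      then show ?thesis using n by (simp add: Q_def)
    qed
    obtain u where u: "\<And>t. t \<le> d \<Longrightarrow> unit_fun r t = (\<Sum>i\<le>d. u i * q i t)"
      using expand[of "unit_fun r"] by blast
    have "unit_fun r r = (\<Sum>i\<le>d. u i * q i r)" by (rule u[OF rs(1)])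
    also have "\<dots> = (\<Sum>i\<le>d. u i * q i s)" by (intro sum.cong) (simp_all add: qrs)
    also have "\<dots> = unit_fun r s" by (rule u[OF rs(2), symmetric])
    finally have "unit_fun r r = unit_fun r s" .
    then show "r = s" by (simp add: unit_fun_def split: if_splits)
  qed
  have LD: "leonard_data d (\<lambda>r. of_nat (b r)) (\<lambda>r. of_nat (c r)) (Q 1) Q th"
  proof
    fix i r assume "i \<le> d" "r \<le> d"
    then show "of_nat (c r) * Q i (r - 1) + (th 0 - of_nat (b r) - of_nat (c r)) * Q i r + of_nat (b r) * Q i (r + 1) = th i * Q i r"
      using eig[of i r] th0 by (simp add: shift_def)
  qed (use b_pos b_last c_first c_pos x_inj th_inj Q0 Q_poly in auto)
  interpret leonard_data d "\<lambda>r. of_nat (b r)" "\<lambda>r. of_nat (c r)" "Q 1" Q th by (rule LD)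
  have T: "T f r = shift f r" for f r
    by (simp add: T_def shift_def th0)
  have "drg_data d (\<lambda>r. of_nat (b r)) (\<lambda>r. of_nat (c r)) Q th G E"
  proof
    show "finite X" "1 \<le> d" "gdiam G = d" using d by simp_all
    show "D y z \<le> d" if "y \<in> X" "z \<in> X" for y z using gdist_le_gdiam that .
    show "\<exists>y\<in>X. D y z = i" if "z \<in> X" "i \<le> d" for z i using gdist_any that .
    show "D y z = 0 \<longleftrightarrow> y = z" if "y \<in> X" "z \<in> X" for y z using gdist_eq_0 that .
    show "(\<Sum>u\<in>X. dist_mat G 1 y u * f (D u z)) = T f (D y z)" if "y \<in> X" "z \<in> X" for y z f
      unfolding T using neighbour_sum[OF that] .
    show "E i y z = Q i (D y z) / of_nat (card X)" if "i \<le> d" "y \<in> X" "z \<in> X" for i y z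
      using EQ[OF that] unfolding n_def .
    show "E i y z = 0" if "i \<le> d" "y \<notin> X \<or> z \<notin> X" for i y z
      using that by (auto simp: q rmat_def)
    show "(\<Sum>u\<in>X. E i y u * E j u z) = (if i = j then E i y z else 0)"
      if "i \<le> d" "j \<le> d" "y \<in> X" "z \<in> X" for i j y z
      using fun_cong[OF fun_cong[OF orth[OF that(1,2)], of y], of z] unfolding mult_on_def by (cases "i = j") simp_all
    show "(\<Sum>l\<le>d. Q l r) = (if r = 0 then of_nat (card X) else 0)" if "r \<le> d" for r
      using Q_sum[OF that] unfolding n_def .
    show "of_nat (b 0) = th 0" by (simp add: th0)
    show "of_nat (c 1) = (1 :: complex)" using c_second[OF d] by simp
  qed
  then show ?thesis by blast
qed

end

text \<open>Solving the recurrence for \<open>E (j + 1)\<close> expresses it by a polynomial of one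
  degree more, because \<open>c' (j + 1)\<close> is nonzero. The induction also carries that p is
  nonzero, without which multiplication by the variable need not raise the degree of a
  constant.\<close>

theorem Q_polynomial_drg_data:
  fixes G :: "('a, 'e) pre_digraph"
  assumes "drg G b c" and d: "1 \<le> gdiam G" and Q: "Q_polynomial G E"
  shows "\<exists>Q th. drg_data (gdiam G) (\<lambda>r. of_nat (b r)) (\<lambda>r. of_nat (c r)) Q th G E"
proof -
  interpret drg G b c by fact
  define n :: complex where "n = of_nat (card X)"
  have n: "n \<noteq> 0" using verts_nonempty by (simp add: n_def)
  obtain a' b' c' :: "nat \<Rightarrow> complex" where rec: "\<forall>i\<in>{1..d}. b' (i - 1) * c' i \<noteq> 0"
    "\<forall>i\<le>d. \<forall>x\<in>X. \<forall>y\<in>X. E 1 x y * E i x y =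
       1 / of_nat (card X) * ((if i = 0 then 0 else b' (i - 1) * E (i - 1) x y) + a' i * E i x y
                   + (if i = d then 0 else c' (i + 1) * E (i + 1) x y))"
    and bij: "bij_betw E {..d} (primitive_idempotents (mat_algebra X) (bose_mesner G))"
    and E0: "E 0 = (\<lambda>x y. if x \<in> X \<and> y \<in> X then 1 / of_nat (card X) else 0)"
    using Q unfolding Q_polynomial_def Let_def by blast
  have poly: "\<exists>p. degree p = i \<and> p \<noteq> 0 \<and> (\<forall>x\<in>X. \<forall>y\<in>X. n * E i x y = poly p (n * E 1 x y))" if "i \<le> d" for i
    using that
  proof (induction i rule: less_induct)
    case (less i)
    show ?case
    proof (cases i)
      case 0
      then show ?thesis
        using n by (intro exI[of _ "[:1:]"]) (auto simp: E0 n_def)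
    next
      case (Suc j)
      obtain p where p: "degree p = j" "p \<noteq> 0" "\<And>x y. \<lbrakk>x \<in> X; y \<in> X\<rbrakk> \<Longrightarrow> n * E j x y = poly p (n * E 1 x y)"
        using less.IH[of j] less.prems Suc by auto
      define e where "e = (if j = 0 then 0 else b' (j - 1))"
      obtain p' where p': "degree p' \<le> j" "\<And>x y. \<lbrakk>x \<in> X; y \<in> X\<rbrakk> \<Longrightarrow> e * (n * E (j - 1) x y) = poly p' (n * E 1 x y)"
      proof (cases "j = 0")
        case True
        then show thesis by (intro that[of 0]) (auto simp: e_def)
      next
        case False
        obtain p' where "degree p' = j - 1" "\<And>x y. \<lbrakk>x \<in> X; y \<in> X\<rbrakk> \<Longrightarrow> n * E (j - 1) x y = poly p' (n * E 1 x y)"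
        proof -
          have "j - 1 < i" "j - 1 \<le> d" using less.prems Suc by auto
          from less.IH[OF this] show thesis using that by blast
        qed
        then show thesis
          using False by (intro that[of "Polynomial.smult e p'"]) (auto intro: order.trans[OF degree_smult_le])
      qed
      have cj: "c' (j + 1) \<noteq> 0"
        using rec(1)[rule_format, of "j + 1"] less.prems Suc by auto
      define g where "g = - (Polynomial.smult (a' j) p + p')"
      define f where "f = Polynomial.smult (1 / c' (j + 1)) (pCons 0 p + g)"
      have "degree g \<le> j"
        unfolding g_def degree_minus using p(1) p'(1)
        by (intro degree_add_le) (auto intro: order.trans[OF degree_smult_le])
      then have "degree (pCons 0 p + g) = Suc j"
        using p(1,2) by (subst degree_add_eq_left) auto
      then have f: "degree f = i"
        using cj Suc by (simp add: f_def)
      moreover have "f \<noteq> 0" using f Suc by auto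
      moreover have "n * E i x y = poly f (n * E 1 x y)" if xy: "x \<in> X" "y \<in> X" for x y
      proof -
        have j: "j \<le> d" "j \<noteq> d" using less.prems Suc by auto
        have "E 1 x y * E j x y * n = (if j = 0 then 0 else b' (j - 1) * E (j - 1) x y) + a' j * E j x y
            + c' (j + 1) * E (j + 1) x y"
          using rec(2)[rule_format, OF j(1) xy] j(2) n by (simp add: n_def)
        also have "\<dots> = e * E (j - 1) x y + a' j * E j x y + c' (j + 1) * E i x y"
          using Suc by (simp add: e_def)
        finally have "c' (j + 1) * (n * E i x y) = (n * E 1 x y) * (n * E j x y) - a' j * (n * E j x y) - e * (n * E (j - 1) x y)"
          by (simp add: algebra_simps)
        also have "\<dots> = poly (pCons 0 p + g) (n * E 1 x y)"
          unfolding p(3)[OF xy] p'(2)[OF xy] by (simp add: g_def)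
        finally show ?thesis
          using cj by (simp add: f_def field_simps)
      qed
      ultimately show ?thesis by blast
    qed
  qed
  show ?thesis
  proof (rule drg_dataI[OF d bij E0])
    fix i assume "i \<le> d"
    from poly[OF this] show "\<exists>p. degree p = i \<and>
        (\<forall>x\<in>X. \<forall>y\<in>X. of_nat (card X) * E i x y = poly p (of_nat (card X) * E 1 x y))"
      unfolding n_def by blast
  qed
qed

text \<open>The weights \<open>k r\<close> are positive because \<open>b\<close> and
  \<open>c\<close> are natural numbers, so \<open>T\<close> is symmetric for a positive definite
  hermitian form and the eigenvalues are real. The conjugate of \<open>Q i\<close> is then a
  multiple of \<open>Q i\<close>.\<close>

lemma (in drg_data) E_real:
  assumes bc: "\<And>r. b r = of_nat (b' r)" "\<And>r. c r = of_nat (c' r)" and i: "i \<le> d"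
  shows "cnj (E i y z) = E i y z"
proof -
  define f where "f i r = cnj (Q i r)" for i r
  have th0: "cnj (th 0) = th 0" using b_0 bc(1)[of 0] by (metis complex_cnj_of_nat)
  have Tf: "T (f i) r = cnj (th i) * f i r" if "i \<le> d" "r \<le> d" for i r
    using arg_cong[OF T_Q[OF that], of cnj] by (simp add: T_def f_def bc th0)
  have "\<exists>u. \<forall>r\<le>d. f i r = u * Q i r" if i: "i \<le> d" for i
  proof -
    have "th i * form (Q i) (f i) = form (T (Q i)) (f i)"
      unfolding form_scale_left[symmetric] using i by (intro form_cong) (auto simp: T_Q)
    also have "\<dots> = form (T (f i)) (Q i)"
      by (simp add: T_self_adjoint form_sym[of "Q i"])
    also have "\<dots> = cnj (th i) * form (f i) (Q i)"
      unfolding form_scale_left[symmetric] using i by (intro form_cong) (auto simp: Tf)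
    finally have eq: "th i * form (Q i) (f i) = cnj (th i) * form (Q i) (f i)"
      by (simp add: form_sym[of "Q i"])
    \<comment> \<open>As f conjugates, this is the sum of the numbers
      \<open>m r * (cmod (Q i r))^2\<close> with positive \<open>m r\<close>.\<close>
    have "form (Q i) (f i) \<noteq> 0"
    proof
      assume *: "form (Q i) (f i) = 0"
      define m where "m r = (\<Prod>s<r. real (b' s) / real (c' (Suc s)))" for r
      have k: "k r = of_real (m r)" for r by (simp add: k_def m_def bc)
      have m: "0 < m r" if "r \<le> d" for r
        unfolding m_def
      proof (intro prod_pos ballI)
        fix s assume "s \<in> {..<r}"
        then have "b s \<noteq> 0" "c (Suc s) \<noteq> 0" using that b_nz[of s] c_nz[of "Suc s"] by auto
        then show "0 < real (b' s) / real (c' (Suc s))" by (simp add: bc)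
      qed
      have "form (Q i) (f i) = of_real (\<Sum>r\<le>d. m r * (cmod (Q i r))^2)"
        unfolding form_def of_real_sum
        by (intro sum.cong refl) (simp add: k f_def mult.assoc flip: complex_norm_square)
      then have "(\<Sum>r\<le>d. m r * (cmod (Q i r))^2) = 0"
        using * by (metis of_real_eq_0_iff)
      moreover have "0 \<le> m r * (cmod (Q i r))^2" if "r \<le> d" for r
        using m[OF that] by (intro mult_nonneg_nonneg) auto
      ultimately have "\<forall>r\<le>d. m r * (cmod (Q i r))^2 = 0"
        by (subst (asm) sum_nonneg_eq_0_iff) auto
      then have "Q i r = 0" if "r \<le> d" for r
        using m[OF that] that by force
      then show False using Q_nonzero[OF i] by blast
    qed
    then have thi: "cnj (th i) = th i" using eq by simp
    define u where "u j = coef j (f i)" for j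
    have u: "f i r = (\<Sum>j\<le>d. u j * Q j r)" if "r \<le> d" for r
      unfolding u_def by (rule coef_expand[OF that])
    have "\<forall>r\<le>d. (\<Sum>j\<le>d. (u j * (th j - th i)) * Q j r) = 0"
    proof (intro allI impI)
      fix r assume r: "r \<le> d"
      have "(\<Sum>j\<le>d. u j * th j * Q j r) = th i * (\<Sum>j\<le>d. u j * Q j r)"
      proof -
        have "(\<Sum>j\<le>d. u j * th j * Q j r) = T (f i) r"
          using T_expand[where f = "f i" and n = d and u = u and r = r] u r by simp
        also have "\<dots> = th i * f i r" unfolding Tf[OF i r] thi ..
        also have "\<dots> = th i * (\<Sum>j\<le>d. u j * Q j r)" unfolding u[OF r] ..
        finally show ?thesis .
      qed
      then show "(\<Sum>j\<le>d. (u j * (th j - th i)) * Q j r) = 0"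
        by (simp add: sum_distrib_left algebra_simps sum_subtractf)
    qed
    from Q_indep[OF order.refl this] have ut: "u j * (th j - th i) = 0" if "j \<le> d" for j
      using that by simp
    have "u j = 0" if "j \<le> d" "j \<noteq> i" for j
      using ut[OF that(1)] inj_on_eq_iff[OF th_inj, of j i] that i by auto
    then have "(\<Sum>j\<le>d. u j * Q j r) = (\<Sum>j\<le>d. if j = i then u i * Q i r else 0)" for r
      by (intro sum.cong) auto
    then have "\<forall>r\<le>d. f i r = u i * Q i r" using u i by simp
    then show ?thesis by blast
  qed
  note ex = this
  define u where "u i = (SOME u. \<forall>r\<le>d. f i r = u * Q i r)" for i
  have u: "f i r = u i * Q i r" if "i \<le> d" "r \<le> d" for i r
  proof -
    have "\<forall>r\<le>d. f i r = u i * Q i r"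
      using someI_ex[OF ex[OF that(1)]] unfolding u_def .
    then show ?thesis using that(2) by simp
  qed
  \<comment> \<open>The sum of all \<open>Q l\<close> is real, so conjugating it and comparing
    coefficients makes every factor \<open>u l\<close> equal to 1.\<close>
  have "\<forall>r\<le>d. (\<Sum>l\<le>d. (u l - 1) * Q l r) = 0"
  proof (intro allI impI)
    fix r assume r: "r \<le> d"
    have "(\<Sum>l\<le>d. u l * Q l r) = cnj (\<Sum>l\<le>d. Q l r)"
      unfolding cnj_sum
    proof (intro sum.cong refl)
      fix l assume "l \<in> {..d}"
      then have "f l r = u l * Q l r" by (intro u r) simp
      then show "u l * Q l r = cnj (Q l r)" unfolding f_def by (rule sym)
    qed
    also have "\<dots> = (\<Sum>l\<le>d. Q l r)" unfolding Q_sum[OF r] by simp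
    finally show "(\<Sum>l\<le>d. (u l - 1) * Q l r) = 0"
      by (simp add: left_diff_distrib sum_subtractf)
  qed
  from Q_indep[OF order.refl this] have "u i = 1" using i by simp
  then have "cnj (Q i r) = Q i r" if "r \<le> d" for r
    using u[OF i that] by (simp add: f_def)
  then show ?thesis
    using i gdist_le by (cases "y \<in> verts G \<and> z \<in> verts G") (auto simp: E_eq E_outside)
qed

section \<open>Products with \<open>Q j\<close>, and restrictions to an initial segment\<close>

context leonard_data
begin

text \<open>Multiplication by \<open>x\<close> lowers the index by at most one. The bound on the
  lowest component is what meets the condition on the dual width in
  \<open>E_Y_E_zero\<close>.\<close>

lemma poly_mult_Q:
  assumes "degree p \<le> n" and j: "j \<le> d"
  shows "\<exists>u. (\<forall>r\<le>d. poly p (x r) * Q j r = (\<Sum>l\<le>d. u l * Q l r)) \<and> (\<forall>l\<le>d. l + n < j \<longrightarrow> u l = 0)"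
  using assms(1)
proof (induction n arbitrary: p)
  case 0
  then obtain a where "p = [:a:]" by (meson degree_eq_zeroE le_zero_eq)
  then show ?case
    using j by (intro exI[of _ "\<lambda>l. if l = j then a else 0"]) (auto simp: if_distrib[of "\<lambda>z. z * _"] cong: if_cong)
next
  case (Suc n)
  obtain a p' where p: "p = pCons a p'" by (rule pCons_cases)
  have "degree p' \<le> n" using Suc.prems by (auto simp: p degree_pCons_eq_if split: if_splits)
  then obtain u where u: "\<And>r. r \<le> d \<Longrightarrow> poly p' (x r) * Q j r = (\<Sum>l\<le>d. u l * Q l r)"
    "\<And>l. \<lbrakk>l \<le> d; l + n < j\<rbrakk> \<Longrightarrow> u l = 0"
    using Suc.IH by blast
  obtain h where h: "\<And>i r. \<lbrakk>i \<le> d; r \<le> d\<rbrakk> \<Longrightarrow> x r * Q i r = (\<Sum>j\<le>d. h i j * Q j r)"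
    "\<And>i j. \<lbrakk>i \<le> d; j \<le> d; j + 1 < i \<or> i + 1 < j\<rbrakk> \<Longrightarrow> h i j = 0"
    by (rule three_term) blast
  define v where "v l = (if l = j then a else 0) + (\<Sum>i\<le>d. u i * h i l)" for l
  have "poly p (x r) * Q j r = (\<Sum>l\<le>d. v l * Q l r)" if r: "r \<le> d" for r
  proof -
    have "x r * (poly p' (x r) * Q j r) = (\<Sum>i\<le>d. u i * (x r * Q i r))"
      unfolding u(1)[OF r] by (simp add: sum_distrib_left mult_ac)
    also have "\<dots> = (\<Sum>i\<le>d. u i * (\<Sum>l\<le>d. h i l * Q l r))"
      using h(1)[OF _ r] by (intro sum.cong) auto
    also have "\<dots> = (\<Sum>l\<le>d. (\<Sum>i\<le>d. u i * h i l) * Q l r)"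
      unfolding sum_distrib_left sum_distrib_right by (subst sum.swap) (simp add: mult_ac)
    finally have "x r * (poly p' (x r) * Q j r) = (\<Sum>l\<le>d. (\<Sum>i\<le>d. u i * h i l) * Q l r)" .
    moreover have "(\<Sum>l\<le>d. (if l = j then a else 0) * Q l r) = a * Q j r"
      using j by (simp add: if_distrib[of "\<lambda>z. z * _"] cong: if_cong)
    ultimately show ?thesis
      by (simp add: p v_def distrib_right sum.distrib mult.assoc)
  qed
  moreover have "v l = 0" if "l \<le> d" "l + Suc n < j" for l
  proof -
    have "u i * h i l = 0" if "i \<le> d" for i
      using u(2)[OF that] h(2)[OF that \<open>l \<le> d\<close>] \<open>l + Suc n < j\<close> by (cases "i + n < j") auto
    then have "(\<Sum>i\<le>d. u i * h i l) = 0" by (intro sum.neutral) auto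
    then show ?thesis using that by (simp add: v_def)
  qed
  ultimately show ?case by (intro exI[of _ v]) simp
qed

text \<open>The recurrence is run downwards from d. Each step adds at most one to the degree,
  because the entry \<open>h i (i - 1)\<close> can be divided out.\<close>

lemma Q_top:
  assumes "s \<le> d"
  shows "\<exists>p. degree p \<le> s \<and> (\<forall>r\<le>d. Q (d - s) r = Q d r * poly p (x r))"
  using assms
proof (induction s rule: less_induct)
  case (less s)
  show ?case
  proof (cases s)
    case 0
    then show ?thesis by (intro exI[of _ 1]) auto
  next
    case (Suc t)
    define i where "i = d - t"
    have i: "1 \<le> i" "i \<le> d" "d - s = i - 1" using less.prems Suc by (auto simp: i_def)
    obtain h where h: "\<And>i r. \<lbrakk>i \<le> d; r \<le> d\<rbrakk> \<Longrightarrow> x r * Q i r = (\<Sum>j\<le>d. h i j * Q j r)"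
      "\<And>i j. \<lbrakk>i \<le> d; j \<le> d; j + 1 < i \<or> i + 1 < j\<rbrakk> \<Longrightarrow> h i j = 0"
      "\<And>i j. \<lbrakk>i \<le> d; j \<le> d; j + 1 = i \<or> i + 1 = j\<rbrakk> \<Longrightarrow> h i j \<noteq> 0"
      by (rule three_term) blast
    obtain p where p: "degree p \<le> t" "\<And>r. r \<le> d \<Longrightarrow> Q i r = Q d r * poly p (x r)"
      using less.IH[of t] less.prems Suc by (auto simp: i_def)
    obtain p' where p': "degree p' \<le> t" "\<And>r. r \<le> d \<Longrightarrow> (if i < d then h i (i + 1) * Q (i + 1) r else 0) = Q d r * poly p' (x r)"
    proof (cases "t = 0")
      case True
      then show thesis using i by (intro that[of 0]) (auto simp: i_def)
    next
      case False
      then have "t - 1 < s" "t - 1 \<le> d" using less.prems Suc by auto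
      from less.IH[OF this] obtain f where f: "degree f \<le> t - 1"
        "\<And>r. r \<le> d \<Longrightarrow> Q (d - (t - 1)) r = Q d r * poly f (x r)" by blast
      have "d - (t - 1) = i + 1" using False less.prems Suc by (auto simp: i_def)
      moreover have "i < d" using False less.prems Suc by (auto simp: i_def)
      moreover have "degree (Polynomial.smult (h i (i + 1)) f) \<le> t"
        using f(1) degree_smult_le[of "h i (i + 1)" f] by simp
      ultimately show thesis
        using f(2) by (intro that[of "Polynomial.smult (h i (i + 1)) f"]) auto
    qed
    define g where "g = Polynomial.smult (1 / h i (i - 1)) (pCons 0 p - Polynomial.smult (h i i) p - p')"
    have hi: "h i (i - 1) \<noteq> 0" using h(3)[OF i(2), of "i - 1"] i by auto
    have "Q (d - s) r = Q d r * poly g (x r)" if r: "r \<le> d" for r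
    proof -
      have "x r * Q i r = (\<Sum>j\<le>d. h i j * Q j r)" by (rule h(1)[OF i(2) r])
      also have "\<dots> = (\<Sum>j\<in>{i - 1, i} \<union> (if i < d then {i + 1} else {}). h i j * Q j r)"
      proof (intro sum.mono_neutral_right ballI)
        fix j assume "j \<in> {..d} - ({i - 1, i} \<union> (if i < d then {i + 1} else {}))"
        then have "j \<le> d" "j + 1 < i \<or> i + 1 < j" using i by (auto split: if_splits)
        from h(2)[OF i(2) this] show "h i j * Q j r = 0" by simp
      qed (use i in auto)
      also have "\<dots> = h i (i - 1) * Q (i - 1) r + h i i * Q i r + (if i < d then h i (i + 1) * Q (i + 1) r else 0)"
        using i(1) by (auto simp: sum.insert_if)
      finally have "h i (i - 1) * Q (i - 1) r = x r * Q i r - h i i * Q i r - Q d r * poly p' (x r)"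
        unfolding p'(2)[OF r] by simp
      also have "\<dots> = Q d r * poly (pCons 0 p - Polynomial.smult (h i i) p - p') (x r)"
        unfolding p(2)[OF r] by (simp add: algebra_simps)
      finally show ?thesis using hi by (simp add: g_def i(3) field_simps)
    qed
    moreover have "degree g \<le> s"
    proof -
      have "degree (pCons 0 p - Polynomial.smult (h i i) p - p') \<le> Suc t"
        using p(1) p'(1) degree_smult_le[of "h i i" p]
        by (intro degree_diff_le) (auto simp: degree_pCons_eq_if)
      then show ?thesis
        using degree_smult_le[of "1 / h i (i - 1)" "pCons 0 p - Polynomial.smult (h i i) p - p'"] Suc
        unfolding g_def by linarith
    qed
    ultimately show ?thesis by blast
  qed
qed

lemma poly_zero_part:
  assumes "degree p \<le> w" "w \<le> d" and "\<And>r. r \<le> w \<Longrightarrow> poly p (x r) = 0"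
  shows "p = 0"
proof (rule ccontr)
  assume p: "p \<noteq> 0"
  have inj: "inj_on x {..w}" using assms(2) by (intro inj_on_subset[OF x_inj]) auto
  have "card (x ` {..w}) \<le> card {y. poly p y = 0}"
    using assms p by (intro card_mono poly_roots_finite) auto
  also have "\<dots> \<le> degree p" using p by (rule poly_roots_degree)
  finally show False using assms(1) card_image[OF inj] by simp
qed

text \<open>A combination of \<open>Q 0, \<dots>, Q w\<close>, or of \<open>Q (d - w), \<dots>, Q d\<close>, that vanishes on
  \<open>{..w}\<close> is trivial: it is a polynomial of degree at most \<open>w\<close> in \<open>x\<close>, times \<open>Q d\<close> in the second
  case.\<close>

lemma bottom_indep:
  assumes w: "w \<le> d" and 0: "\<And>r. r \<le> w \<Longrightarrow> (\<Sum>i\<le>w. u i * Q i r) = 0" and i: "i \<le> w"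
  shows "u i = 0"
proof -
  define p where "p = (\<Sum>i\<le>w. Polynomial.smult (u i) (P i))"
  have p: "poly p (x r) = (\<Sum>i\<le>w. u i * Q i r)" if "r \<le> d" for r
    unfolding p_def poly_sum using P(2)[OF _ that] w by (intro sum.cong) auto
  have "degree p \<le> w"
    unfolding p_def
  proof (intro degree_sum_le)
    fix i assume "i \<in> {..w}"
    then show "degree (Polynomial.smult (u i) (P i)) \<le> w"
      using P(1)[of i] w degree_smult_le[of "u i" "P i"] by simp
  qed simp
  then have "p = 0" using p 0 w by (intro poly_zero_part[OF _ w]) auto
  then have "\<forall>r\<le>d. (\<Sum>i\<le>w. u i * Q i r) = 0" using p by simp
  from Q_indep[OF w this] show ?thesis using i by blast
qed

lemma top_indep:
  assumes w: "w \<le> d" and 0: "\<And>r. r \<le> w \<Longrightarrow> (\<Sum>i\<le>w. u i * Q (d - w + i) r) = 0" and i: "i \<le> w"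
  shows "u i = 0"
proof -
  define R where "R s = (SOME p. degree p \<le> s \<and> (\<forall>r\<le>d. Q (d - s) r = Q d r * poly p (x r)))" for s
  have R: "degree (R s) \<le> s" "r \<le> d \<Longrightarrow> Q (d - s) r = Q d r * poly (R s) (x r)" if "s \<le> d" for s r
    using someI_ex[OF Q_top[OF that]] unfolding R_def[symmetric] by auto
  define p where "p = (\<Sum>i\<le>w. Polynomial.smult (u i) (R (w - i)))"
  have p: "Q d r * poly p (x r) = (\<Sum>i\<le>w. u i * Q (d - w + i) r)" if r: "r \<le> d" for r
    unfolding p_def poly_sum sum_distrib_left
  proof (intro sum.cong refl)
    fix i assume i: "i \<in> {..w}"
    then have "d - (w - i) = d - w + i" using w by auto
    then show "Q d r * poly (Polynomial.smult (u i) (R (w - i))) (x r) = u i * Q (d - w + i) r"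
      using R(2)[of "w - i" r] w r by simp
  qed
  have "degree p \<le> w"
    unfolding p_def
  proof (intro degree_sum_le)
    fix i
    have "w - i \<le> d" using w by simp
    from R(1)[OF this] have "degree (R (w - i)) \<le> w" by linarith
    then show "degree (Polynomial.smult (u i) (R (w - i))) \<le> w"
      by (rule order.trans[OF degree_smult_le])
  qed simp
  moreover have "poly p (x r) = 0" if r: "r \<le> w" for r
  proof -
    have "r \<le> d" using r w by simp
    then show ?thesis using p[of r] 0[OF r] Q_d_nz[of r] by (metis mult_eq_0_iff)
  qed
  ultimately have "p = 0" by (rule poly_zero_part[OF _ w])
  then have zero: "(\<Sum>i\<le>w. u i * Q (d - w + i) r) = 0" if "r \<le> d" for r using p[OF that] by simp
  define v where "v j = (if j < d - w then 0 else u (j - (d - w)))" for j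
  have "\<forall>r\<le>d. (\<Sum>j\<le>d. v j * Q j r) = 0"
  proof (intro allI impI)
    fix r assume r: "r \<le> d"
    have "(\<Sum>j\<le>d. v j * Q j r) = (\<Sum>j\<in>{d - w..d}. v j * Q j r)"
      by (intro sum.mono_neutral_right) (auto simp: v_def)
    also have "\<dots> = (\<Sum>i\<le>w. u i * Q (d - w + i) r)"
      using w by (intro sum.reindex_bij_witness[of _ "\<lambda>i. d - w + i" "\<lambda>j. j - (d - w)"]) (auto simp: v_def)
    finally show "(\<Sum>j\<le>d. v j * Q j r) = 0" using zero[OF r] by simp
  qed
  from Q_indep[OF order.refl this] have "v (d - w + i) = 0" using i w by auto
  then show ?thesis by (simp add: v_def)
qed

end

section \<open>Descendents\<close>

text \<open>Distances are those of G; their agreement with distances inside the induced subgraph is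
  only derived later, in \<open>induced_dist\<close>. The assumption \<open>dual\<close> is the form
  in which the dual width \<open>d - w\<close> enters.\<close>

locale descendent_data = drg_data d b c Q th G E
  for d :: nat and b c :: "nat \<Rightarrow> complex" and Q :: "nat \<Rightarrow> nat \<Rightarrow> complex" and th :: "nat \<Rightarrow> complex"
    and G :: "('a, 'e) pre_digraph" and E :: "nat \<Rightarrow> 'a cmat" +
  fixes Y :: "'a set" and w :: nat
  assumes dist_sym: "\<lbrakk>y \<in> verts G; z \<in> verts G\<rbrakk> \<Longrightarrow> gdist G y z = gdist G z y"
    and real: "i \<le> d \<Longrightarrow> cnj (E i y z) = E i y z"
    and Y: "Y \<subseteq> verts G" and w: "w < d"
    and width_le: "\<lbrakk>y \<in> Y; z \<in> Y\<rbrakk> \<Longrightarrow> gdist G y z \<le> w"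
    and width_ex: "i \<le> w \<Longrightarrow> \<exists>y\<in>Y. \<exists>z\<in>Y. gdist G y z = i"
    and dual: "\<lbrakk>i \<le> d; d - w < i\<rbrakk> \<Longrightarrow> (\<Sum>y\<in>Y. \<Sum>z\<in>Y. E i y z) = 0"
begin

abbreviation "X \<equiv> verts G"
abbreviation "D \<equiv> gdist G"

lemma finite_Y: "finite Y"
  using Y finite_verts by (rule finite_subset)

lemma card_nz: "of_nat (card X) \<noteq> (0 :: complex)"
proof -
  have "X \<noteq> {}" using width_ex[of 0] Y by auto
  then show ?thesis using finite_verts by simp
qed

lemma Q_real: assumes "i \<le> d" "r \<le> d" shows "cnj (Q i r) = Q i r"
proof -
  obtain z where z: "z \<in> X" using width_ex[of 0] Y by auto
  obtain y where y: "y \<in> X" "D y z = r" using gdist_ex[OF z assms(2)] by blast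
  show ?thesis
    using real[OF assms(1), of y z] E_eq[OF assms(1) y(1) z] y(2) card_nz by simp
qed

lemma E_sym: assumes "i \<le> d" shows "E i y z = E i z y"
  using E_eq[OF assms] E_outside[OF assms] dist_sym by (cases "y \<in> X \<and> z \<in> X") auto

text \<open>An entry of a matrix product taken over Y only. A priori it depends on the pair y, z and
  not just on their distance.\<close>

definition conv :: "(nat \<Rightarrow> complex) \<Rightarrow> (nat \<Rightarrow> complex) \<Rightarrow> 'a \<Rightarrow> 'a \<Rightarrow> complex" where
  "conv f g y z = (\<Sum>u\<in>Y. f (D y u) * g (D u z))"

lemma conv_commute: assumes "y \<in> Y" "z \<in> Y" shows "conv f g y z = conv g f z y"
  unfolding conv_def
proof (intro sum.cong refl)
  fix u assume "u \<in> Y"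
  then have "D y u = D u y" "D u z = D z u" using assms Y by (auto intro!: dist_sym)
  then show "f (D y u) * g (D u z) = g (D z u) * f (D u y)" by (simp add: mult.commute)
qed

lemma conv_cong:
  assumes "\<And>r. r \<le> w \<Longrightarrow> f r = f' r" "\<And>r. r \<le> w \<Longrightarrow> g r = g' r" "y \<in> Y" "z \<in> Y"
  shows "conv f g y z = conv f' g' y z"
  unfolding conv_def using assms width_le by (intro sum.cong) auto

lemma conv_sum_left: "conv (\<lambda>r. \<Sum>k\<in>K. u k * f k r) g y z = (\<Sum>k\<in>K. u k * conv (f k) g y z)"
  unfolding conv_def sum_distrib_left sum_distrib_right by (subst sum.swap) (simp add: mult_ac)

lemma conv_sum_right: "conv g (\<lambda>r. \<Sum>k\<in>K. u k * f k r) y z = (\<Sum>k\<in>K. u k * conv g (f k) y z)"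
  unfolding conv_def sum_distrib_left sum_distrib_right by (subst sum.swap) (simp add: mult_ac)

text \<open>The Frobenius norm of \<open>E i \<Delta> E j\<close>, \<open>\<Delta>\<close> the diagonal matrix of \<open>Y\<close>, is a sum over
  \<open>Y \<times> Y\<close> of the entries of \<open>E i \<circ> E j\<close>, which is a combination of the \<open>E h\<close> with \<open>h > d - w\<close>.\<close>

lemma E_Y_E_zero:
  assumes ij: "i \<le> d" "j \<le> d" "i + (d - w) < j" and xy: "x \<in> X" "y \<in> X"
  shows "(\<Sum>z\<in>Y. E i x z * E j z y) = 0"
proof -
  define N where "N x y = (\<Sum>z\<in>Y. E i x z * E j z y)" for x y
  have cnj_N: "cnj (N x y) = N x y" for x y
    unfolding N_def cnj_sum using real ij by (intro sum.cong) auto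
  have "(\<Sum>x\<in>X. \<Sum>y\<in>X. N x y * N x y) = (\<Sum>z\<in>Y. \<Sum>z'\<in>Y. E i z z' * E j z z')"
  proof -
    have "(\<Sum>x\<in>X. \<Sum>y\<in>X. N x y * N x y)
        = (\<Sum>x\<in>X. \<Sum>y\<in>X. \<Sum>z\<in>Y. \<Sum>z'\<in>Y. (E i z x * E i x z') * (E j z y * E j y z'))"
    proof (intro sum.cong refl)
      fix x y
      have "N x y * N x y = (\<Sum>z\<in>Y. \<Sum>z'\<in>Y. (E i x z * E j z y) * (E i x z' * E j z' y))"
        unfolding N_def by (rule sum_product)
      also have "\<dots> = (\<Sum>z\<in>Y. \<Sum>z'\<in>Y. (E i z x * E i x z') * (E j z y * E j y z'))"
        using E_sym[OF ij(1), of x] E_sym[OF ij(2), of _ y] by (simp add: mult_ac)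
      finally show "N x y * N x y = (\<Sum>z\<in>Y. \<Sum>z'\<in>Y. (E i z x * E i x z') * (E j z y * E j y z'))" .
    qed
    also have "\<dots> = (\<Sum>x\<in>X. \<Sum>z\<in>Y. \<Sum>z'\<in>Y. \<Sum>y\<in>X. (E i z x * E i x z') * (E j z y * E j y z'))"
      by (subst sum.swap, subst (2) sum.swap, rule refl)
    also have "\<dots> = (\<Sum>z\<in>Y. \<Sum>z'\<in>Y. \<Sum>x\<in>X. \<Sum>y\<in>X. (E i z x * E i x z') * (E j z y * E j y z'))"
      by (subst sum.swap, subst (2) sum.swap, rule refl)
    also have "\<dots> = (\<Sum>z\<in>Y. \<Sum>z'\<in>Y. (\<Sum>x\<in>X. E i z x * E i x z') * (\<Sum>y\<in>X. E j z y * E j y z'))"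
      by (simp only: sum_product)
    also have "\<dots> = (\<Sum>z\<in>Y. \<Sum>z'\<in>Y. E i z z' * E j z z')"
    proof (intro sum.cong refl)
      fix z z' assume "z \<in> Y" "z' \<in> Y"
      then have z: "z \<in> X" "z' \<in> X" using Y by auto
      show "(\<Sum>x\<in>X. E i z x * E i x z') * (\<Sum>y\<in>X. E j z y * E j y z') = E i z z' * E j z z'"
        using E_mult[OF ij(1,1) z] E_mult[OF ij(2,2) z] by simp
    qed
    finally show ?thesis .
  qed
  also have "\<dots> = 0"
  proof -
    obtain u where u: "\<And>r. r \<le> d \<Longrightarrow> poly (P i) (Q 1 r) * Q j r = (\<Sum>l\<le>d. u l * Q l r)"
      "\<And>l. \<lbrakk>l \<le> d; l + i < j\<rbrakk> \<Longrightarrow> u l = 0"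
      using poly_mult_Q[of "P i" i j] P(1)[OF ij(1)] ij by auto
    let ?n = "of_nat (card X) :: complex"
    have "(\<Sum>z\<in>Y. \<Sum>z'\<in>Y. E i z z' * E j z z') = (\<Sum>z\<in>Y. \<Sum>z'\<in>Y. \<Sum>l\<le>d. (u l / ?n) * E l z z')"
    proof (intro sum.cong refl)
      fix z z' assume "z \<in> Y" "z' \<in> Y"
      then have z: "z \<in> X" "z' \<in> X" using Y by auto
      have r: "D z z' \<le> d" by (rule gdist_le[OF z])
      have "E i z z' * E j z z' = (Q i (D z z') * Q j (D z z')) / (?n * ?n)"
        using E_eq[OF ij(1) z] E_eq[OF ij(2) z] by simp
      also have "Q i (D z z') * Q j (D z z') = (\<Sum>l\<le>d. u l * Q l (D z z'))"
        using P(2)[OF ij(1) r] u(1)[OF r] by simp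
      also have "\<dots> / (?n * ?n) = (\<Sum>l\<le>d. (u l / ?n) * E l z z')"
        unfolding sum_divide_distrib using z by (intro sum.cong) (auto simp: E_eq)
      finally show "E i z z' * E j z z' = (\<Sum>l\<le>d. (u l / ?n) * E l z z')" .
    qed
    also have "\<dots> = (\<Sum>l\<le>d. (u l / ?n) * (\<Sum>z\<in>Y. \<Sum>z'\<in>Y. E l z z'))"
    proof -
      have "(\<Sum>z\<in>Y. \<Sum>z'\<in>Y. \<Sum>l\<le>d. (u l / ?n) * E l z z') = (\<Sum>z\<in>Y. \<Sum>l\<le>d. \<Sum>z'\<in>Y. (u l / ?n) * E l z z')"
        by (intro sum.cong refl sum.swap)
      also have "\<dots> = (\<Sum>l\<le>d. \<Sum>z\<in>Y. \<Sum>z'\<in>Y. (u l / ?n) * E l z z')"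
        by (rule sum.swap)
      finally show ?thesis by (simp only: sum_distrib_left)
    qed
    also have "\<dots> = 0"
    proof (intro sum.neutral ballI)
      fix l assume "l \<in> {..d}"
      then show "(u l / ?n) * (\<Sum>z\<in>Y. \<Sum>z'\<in>Y. E l z z') = 0"
        using u(2)[of l] dual[of l] ij by (cases "l + i < j") auto
    qed
    finally show ?thesis .
  qed
  finally have "(\<Sum>x\<in>X. \<Sum>y\<in>X. N x y * N x y) = 0" .
  moreover have "N x y * N x y = of_real ((cmod (N x y))^2)" for x y
    using complex_norm_square[of "N x y"] cnj_N[of x y] by simp
  ultimately have "of_real (\<Sum>x\<in>X. \<Sum>y\<in>X. (cmod (N x y))^2) = (0 :: complex)"
    by (simp only: of_real_sum)
  then have "(\<Sum>x\<in>X. \<Sum>y\<in>X. (cmod (N x y))^2) = 0"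
    by (simp only: of_real_eq_0_iff)
  then have "(\<Sum>y\<in>X. (cmod (N x y))^2) = 0"
    using xy(1) finite_verts by (subst (asm) sum_nonneg_eq_0_iff) (auto intro: sum_nonneg)
  then have "(cmod (N x y))^2 = 0"
    using xy(2) finite_verts by (subst (asm) sum_nonneg_eq_0_iff) auto
  then show ?thesis by (simp add: N_def)
qed

lemma conv_Q_zero:
  assumes ij: "i \<le> d" "j \<le> d" "i + (d - w) < j" and xy: "x \<in> Y" "y \<in> Y"
  shows "conv (Q i) (Q j) x y = 0"
proof -
  let ?n = "of_nat (card X) :: complex"
  have xy': "x \<in> X" "y \<in> X" using xy Y by auto
  have "conv (Q i) (Q j) x y = (\<Sum>z\<in>Y. (?n * ?n) * (E i x z * E j z y))"
    unfolding conv_def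
  proof (intro sum.cong refl)
    fix z assume "z \<in> Y"
    then have "z \<in> X" using Y by auto
    then show "Q i (D x z) * Q j (D z y) = (?n * ?n) * (E i x z * E j z y)"
      using xy' card_nz by (simp add: E_eq ij)
  qed
  then show ?thesis
    using E_Y_E_zero[OF ij xy'] by (simp add: sum_distrib_left[symmetric])
qed

lemma conv_span_zero:
  assumes f: "\<And>r. r \<le> w \<Longrightarrow> f r = (\<Sum>k\<in>K. u k * Q k r)" and g: "\<And>r. r \<le> w \<Longrightarrow> g r = (\<Sum>l\<in>L. v l * Q l r)"
    and KL: "\<And>k l. \<lbrakk>k \<in> K; l \<in> L\<rbrakk> \<Longrightarrow> k \<le> d \<and> l \<le> d \<and> k + (d - w) < l"
    and xy: "x \<in> Y" "y \<in> Y"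
  shows "conv f g x y = 0" and "conv g f x y = 0"
proof -
  have *: "conv f g x y = 0" if xy: "x \<in> Y" "y \<in> Y" for x y
  proof -
    have "conv f g x y = (\<Sum>k\<in>K. u k * (\<Sum>l\<in>L. v l * conv (Q k) (Q l) x y))"
      using conv_cong[OF f g xy] by (simp add: conv_sum_left conv_sum_right)
    also have "\<dots> = 0"
    proof (intro sum.neutral ballI)
      fix k assume k: "k \<in> K"
      have "v l * conv (Q k) (Q l) x y = 0" if "l \<in> L" for l
        using conv_Q_zero[of k l x y] KL[OF k that] xy by simp
      then show "u k * (\<Sum>l\<in>L. v l * conv (Q k) (Q l) x y) = 0"
        by simp
    qed
    finally show ?thesis .
  qed
  show "conv f g x y = 0" by (rule *[OF xy])
  show "conv g f x y = 0" using *[OF xy(2,1)] conv_commute[OF xy, of g f] by simp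
qed

text \<open>The lower part l and the upper part m of the combination cancel on \<open>{..w}\<close>.
  Since functions of the two kinds convolve to zero, l convolves to zero with its own conjugate, and
  positivity gives l = 0. Then m vanishes too, and each part is independent by itself.\<close>

lemma mixed_indep:
  assumes j: "j \<le> w"
    and zero: "\<forall>r\<le>w. (\<Sum>i\<le>w. u i * (if i < j then Q i r else Q (d - w + i) r)) = 0"
  shows "\<forall>i\<le>w. u i = 0"
proof -
  define l where "l r = (\<Sum>i<j. u i * Q i r)" for r
  define m where "m r = (\<Sum>k\<in>{d - w + j..d}. u (k - (d - w)) * Q k r)" for r
  have m_alt: "m r = (\<Sum>i\<in>{j..w}. u i * Q (d - w + i) r)" for r
    unfolding m_def using w
    by (intro sum.reindex_bij_witness[of _ "\<lambda>i. d - w + i" "\<lambda>k. k - (d - w)"]) auto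
  have lm: "l r + m r = 0" if "r \<le> w" for r
  proof -
    have "{..w} = {..<j} \<union> {j..w}" using j by auto
    then have "(\<Sum>i\<le>w. u i * (if i < j then Q i r else Q (d - w + i) r))
        = (\<Sum>i<j. u i * (if i < j then Q i r else Q (d - w + i) r))
          + (\<Sum>i\<in>{j..w}. u i * (if i < j then Q i r else Q (d - w + i) r))"
      by (simp add: sum.union_disjoint ivl_disj_int)
    then show ?thesis
      using zero that by (simp add: l_def m_alt)
  qed
  \<comment> \<open>As the \<open>Q i\<close> are real, conjugation does not leave the lower span;
    it turns the convolution at a diagonal entry into a sum of squared moduli.\<close>
  define l' where "l' r = cnj (l r)" for r
  have l': "l' r = (\<Sum>i<j. cnj (u i) * Q i r)" if "r \<le> w" for r
    unfolding l'_def l_def cnj_sum using that w j Q_real by (intro sum.cong) auto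
  have l0: "l r = 0" if r: "r \<le> w" for r
  proof -
    obtain x y where xy: "x \<in> Y" "y \<in> Y" "D x y = r" using width_ex[OF r] by blast
    have "conv l' m x x = 0"
      by (rule conv_span_zero(1)[OF l' m_def _ xy(1,1)]) (use w j in auto)
    moreover have "conv l' m x x = conv l' (\<lambda>r. - l r) x x"
      using lm by (intro conv_cong[OF _ _ xy(1,1)]) (auto simp: add_eq_0_iff)
    ultimately have "conv l' l x x = 0"
      by (simp add: conv_def sum_negf)
    moreover have "conv l' l x x = of_real (\<Sum>z\<in>Y. (cmod (l (D x z)))^2)"
      unfolding conv_def of_real_sum
    proof (intro sum.cong refl)
      fix z assume "z \<in> Y"
      then have "D z x = D x z" using dist_sym xy(1) Y by auto
      then show "l' (D x z) * l (D z x) = of_real ((cmod (l (D x z)))^2)"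
        unfolding complex_norm_square l'_def by simp
    qed
    ultimately have "(\<Sum>z\<in>Y. (cmod (l (D x z)))^2) = 0"
      by (metis of_real_eq_0_iff)
    then have "\<forall>z\<in>Y. (cmod (l (D x z)))^2 = 0"
      by (subst (asm) sum_nonneg_eq_0_iff[OF finite_Y]) simp_all
    then have "(cmod (l (D x y)))^2 = 0" using xy(2) by blast
    then show ?thesis using xy(3) by simp
  qed
  have m0: "m r = 0" if "r \<le> w" for r using lm[OF that] l0[OF that] by simp
  have dw: "w \<le> d" using w by simp
  show ?thesis
  proof (intro allI impI)
    fix i assume i: "i \<le> w"
    show "u i = 0"
    proof (cases "i < j")
      case True
      have "(\<Sum>i\<le>w. (if i < j then u i else 0) * Q i r) = l r" for r
        unfolding l_def using j by (intro sum.mono_neutral_cong_right) auto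
      then have "(\<Sum>i\<le>w. (if i < j then u i else 0) * Q i r) = 0" if "r \<le> w" for r
        using l0[OF that] by simp
      from bottom_indep[OF dw this i] True show ?thesis by simp
    next
      case False
      have "(\<Sum>i\<le>w. (if i < j then 0 else u i) * Q (d - w + i) r) = m r" for r
        unfolding m_alt by (intro sum.mono_neutral_cong_right) auto
      then have "(\<Sum>i\<le>w. (if i < j then 0 else u i) * Q (d - w + i) r) = 0" if "r \<le> w" for r
        using m0[OF that] by simp
      from top_indep[OF dw this i] False show ?thesis by simp
    qed
  qed
qed

text \<open>By \<open>mixed_indep\<close> the \<open>Q i\<close> with i < j and the
  \<open>Q (d - w + i)\<close> with i from j to w form a basis of the functions on
  \<open>{..w}\<close>. The witness is the upper part of \<open>Q j\<close> in this basis.\<close>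

lemma ex_F:
  assumes j: "j \<le> w"
  shows "\<exists>f u v. (\<forall>r\<le>w. f r = Q j r - (\<Sum>i<j. u i * Q i r)) \<and>
    (\<forall>r\<le>w. f r = (\<Sum>k\<in>{d - w + j..d}. v k * Q k r))"
proof -
  obtain u where u: "\<And>r. r \<le> w \<Longrightarrow> Q j r = (\<Sum>i\<le>w. u i * (if i < j then Q i r else Q (d - w + i) r))"
  proof (rule square_system_solvable[of w "\<lambda>i r. if i < j then Q i r else Q (d - w + i) r" "Q j"])
    fix u assume "\<forall>r\<le>w. (\<Sum>i\<le>w. u i * (if i < j then Q i r else Q (d - w + i) r)) = 0"
    then show "\<forall>i\<le>w. u i = 0" by (rule mixed_indep[OF j])
  qed (rule that)
  define f where "f r = (\<Sum>k\<in>{d - w + j..d}. u (k - (d - w)) * Q k r)" for r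
  have f_alt: "f r = (\<Sum>i\<in>{j..w}. u i * Q (d - w + i) r)" for r
    unfolding f_def using w
    by (intro sum.reindex_bij_witness[of _ "\<lambda>i. d - w + i" "\<lambda>k. k - (d - w)"]) auto
  have "f r = Q j r - (\<Sum>i<j. u i * Q i r)" if "r \<le> w" for r
  proof -
    have "{..w} = {..<j} \<union> {j..w}" using j by auto
    then have "Q j r = (\<Sum>i<j. u i * (if i < j then Q i r else Q (d - w + i) r))
          + (\<Sum>i\<in>{j..w}. u i * (if i < j then Q i r else Q (d - w + i) r))"
      unfolding u[OF that] by (simp add: sum.union_disjoint ivl_disj_int)
    then show ?thesis by (simp add: f_alt)
  qed
  then show ?thesis
    by (intro exI[of _ f] exI[of _ u] exI[of _ "\<lambda>k. u (k - (d - w))"]) (simp add: f_def)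
qed

text \<open>The functions \<open>F 0, \<dots>, F w\<close> are, up to scalars, the primitive idempotents of the
  association scheme on \<open>Y\<close>.\<close>

definition F :: "nat \<Rightarrow> nat \<Rightarrow> complex" where
  "F j = (SOME f. \<exists>u v. (\<forall>r\<le>w. f r = Q j r - (\<Sum>i<j. u i * Q i r)) \<and>
    (\<forall>r\<le>w. f r = (\<Sum>k\<in>{d - w + j..d}. v k * Q k r)))"

lemma F_bottom:
  assumes "j \<le> w"
  shows "\<exists>u. \<forall>r\<le>w. F j r = Q j r - (\<Sum>i<j. u i * Q i r)"
  using someI_ex[OF ex_F[OF assms]] unfolding F_def[symmetric] by blast

lemma F_top:
  assumes "j \<le> w"
  shows "\<exists>v. \<forall>r\<le>w. F j r = (\<Sum>k\<in>{d - w + j..d}. v k * Q k r)"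
  using someI_ex[OF ex_F[OF assms]] unfolding F_def[symmetric] by blast

lemma F_span:
  assumes j: "j \<le> w" obtains u where "\<And>r. r \<le> w \<Longrightarrow> F j r = (\<Sum>i\<le>j. u i * Q i r)"
proof -
  obtain u where u: "\<And>r. r \<le> w \<Longrightarrow> F j r = Q j r - (\<Sum>i<j. u i * Q i r)"
    using F_bottom[OF j] by blast
  have "F j r = (\<Sum>i\<le>j. (if i = j then 1 else - u i) * Q i r)" if "r \<le> w" for r
  proof -
    have "(\<Sum>i<j. (if i = j then 1 else - u i) * Q i r) = - (\<Sum>i<j. u i * Q i r)"
      unfolding sum_negf[symmetric] by (intro sum.cong) auto
    then show ?thesis using u[OF that] by (simp add: lessThan_Suc_atMost[symmetric])
  qed
  then show ?thesis by (rule that)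
qed

text \<open>For i < j, \<open>F i\<close> involves \<open>Q k\<close> with k at most i, and
  \<open>F j\<close> involves \<open>Q l\<close> with l at least \<open>d - w + j\<close>; such
  functions convolve to zero.\<close>

lemma conv_F_zero:
  assumes ij: "i \<le> w" "j \<le> w" "i \<noteq> j" and xy: "x \<in> Y" "y \<in> Y"
  shows "conv (F i) (F j) x y = 0"
proof -
  have *: "conv (F i) (F j) x y = 0 \<and> conv (F j) (F i) x y = 0" if ij: "i < j" "j \<le> w" for i j
  proof -
    have "i \<le> w" using ij by simp
    then obtain u where u: "\<And>r. r \<le> w \<Longrightarrow> F i r = (\<Sum>k\<le>i. u k * Q k r)"
      using F_span by blast
    obtain v where v: "\<And>r. r \<le> w \<Longrightarrow> F j r = (\<Sum>k\<in>{d - w + j..d}. v k * Q k r)"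
      using F_top[OF ij(2)] by blast
    have KL: "k \<le> d \<and> l \<le> d \<and> k + (d - w) < l" if "k \<in> {..i}" "l \<in> {d - w + j..d}" for k l
      using that ij w by auto
    show ?thesis
      using conv_span_zero[OF u v KL xy] by blast
  qed
  show ?thesis using *[of i j] *[of j i] ij by (cases "i < j") auto
qed

lemma Q_in_F_span:
  assumes "j \<le> w"
  shows "\<exists>a. \<forall>r\<le>w. Q j r = (\<Sum>i\<le>w. a i * F i r)"
  using assms
proof (induction j rule: less_induct)
  case (less j)
  obtain u where u: "\<And>r. r \<le> w \<Longrightarrow> F j r = Q j r - (\<Sum>i<j. u i * Q i r)"
    using F_bottom[OF less.prems] by blast
  define A where "A i = (SOME a. \<forall>r\<le>w. Q i r = (\<Sum>l\<le>w. a l * F l r))" for i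
  have A: "Q i r = (\<Sum>l\<le>w. A i l * F l r)" if "i < j" "r \<le> w" for i r
  proof -
    have "i \<le> w" using less.prems that(1) by simp
    then have "\<forall>r\<le>w. Q i r = (\<Sum>l\<le>w. A i l * F l r)"
      using someI_ex[OF less.IH[OF that(1)]] unfolding A_def by blast
    then show ?thesis using that(2) by blast
  qed
  define a where "a l = (if l = j then 1 else 0) + (\<Sum>i<j. u i * A i l)" for l
  have "Q j r = (\<Sum>l\<le>w. a l * F l r)" if r: "r \<le> w" for r
  proof -
    have "(\<Sum>i<j. u i * Q i r) = (\<Sum>i<j. u i * (\<Sum>l\<le>w. A i l * F l r))"
      using A[OF _ r] by (intro sum.cong) auto
    also have "\<dots> = (\<Sum>l\<le>w. (\<Sum>i<j. u i * A i l) * F l r)"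
      unfolding sum_distrib_left sum_distrib_right by (subst sum.swap) (simp add: mult_ac)
    finally have "Q j r = F j r + (\<Sum>l\<le>w. (\<Sum>i<j. u i * A i l) * F l r)"
      using u[OF r] by simp
    moreover have "F j r = (\<Sum>l\<le>w. (if l = j then 1 else 0) * F l r)"
      using less.prems by (simp add: if_distrib[of "\<lambda>z. z * _"] cong: if_cong)
    ultimately show ?thesis
      by (simp add: a_def distrib_right sum.distrib)
  qed
  then show ?case by blast
qed

lemma F_expand: obtains a where "\<And>r. r \<le> w \<Longrightarrow> f r = (\<Sum>i\<le>w. a i * F i r)"
proof -
  have dw: "w \<le> d" using w by simp
  obtain u where u: "\<And>r. r \<le> w \<Longrightarrow> f r = (\<Sum>i\<le>w. u i * Q i r)"
  proof (rule square_system_solvable[of w Q f])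
    fix u assume 0: "\<forall>r\<le>w. (\<Sum>i\<le>w. u i * Q i r) = 0"
    show "\<forall>i\<le>w. u i = 0"
    proof (intro allI impI)
      fix i assume "i \<le> w"
      from 0 show "u i = 0" by (intro bottom_indep[OF dw _ \<open>i \<le> w\<close>, where u = u]) blast
    qed
  qed (rule that)
  define A where "A i = (SOME a. \<forall>r\<le>w. Q i r = (\<Sum>l\<le>w. a l * F l r))" for i
  have A: "Q i r = (\<Sum>l\<le>w. A i l * F l r)" if "i \<le> w" "r \<le> w" for i r
  proof -
    have "\<forall>r\<le>w. Q i r = (\<Sum>l\<le>w. A i l * F l r)"
      using someI_ex[OF Q_in_F_span[OF that(1)]] unfolding A_def .
    then show ?thesis using that(2) by blast
  qed
  have "f r = (\<Sum>l\<le>w. (\<Sum>i\<le>w. u i * A i l) * F l r)" if r: "r \<le> w" for r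
  proof -
    have "f r = (\<Sum>i\<le>w. u i * (\<Sum>l\<le>w. A i l * F l r))"
      unfolding u[OF r] using A[OF _ r] by (intro sum.cong) auto
    also have "\<dots> = (\<Sum>l\<le>w. (\<Sum>i\<le>w. u i * A i l) * F l r)"
      unfolding sum_distrib_left sum_distrib_right by (subst sum.swap) (simp add: mult_ac)
    finally show ?thesis .
  qed
  then show ?thesis by (rule that)
qed

text \<open>Convolution with \<open>unit_fun 1\<close>, that is, multiplication by the adjacency matrix of \<open>\<Gamma>\<^sub>Y\<close>, acts
  on each \<open>F i\<close> as a scalar.\<close>

lemma local_numbers:
  "\<exists>f'. \<forall>x\<in>Y. \<forall>y\<in>Y. conv (unit_fun 1) f x y = f' (D x y)"
proof -
  obtain e where e: "\<And>r. r \<le> w \<Longrightarrow> unit_fun 0 r = (\<Sum>i\<le>w. e i * F i r)" using F_expand by blast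
  obtain a where a: "\<And>r. r \<le> w \<Longrightarrow> unit_fun 1 r = (\<Sum>i\<le>w. a i * F i r)" using F_expand by blast
  obtain u where u: "\<And>r. r \<le> w \<Longrightarrow> f r = (\<Sum>i\<le>w. u i * F i r)" using F_expand by blast
  have single: "(\<Sum>k\<le>w. v k * conv (F k) (F i) x y) = v i * conv (F i) (F i) x y"
    if "i \<le> w" "x \<in> Y" "y \<in> Y" for v i x y
  proof -
    have "(\<Sum>k\<le>w. v k * conv (F k) (F i) x y) = (\<Sum>k\<le>w. if k = i then v i * conv (F i) (F i) x y else 0)"
      using that by (intro sum.cong) (auto simp: conv_F_zero)
    then show ?thesis using that by simp
  qed
  \<comment> \<open>Convolution with \<open>unit_fun 0\<close> is the identity; in its expansion
    only the term of \<open>F i\<close> survives.\<close>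
  have unit: "F i (D x y) = e i * conv (F i) (F i) x y" if i: "i \<le> w" and xy: "x \<in> Y" "y \<in> Y" for i x y
  proof -
    have "conv (unit_fun 0) (F i) x y = F i (D x y)"
    proof -
      have "conv (unit_fun 0) (F i) x y = (\<Sum>z\<in>Y. if x = z then F i (D x y) else 0)"
        unfolding conv_def
      proof (intro sum.cong refl)
        fix z assume "z \<in> Y"
        then have "D x z = 0 \<longleftrightarrow> x = z" using gdist_0 xy Y by auto
        then show "unit_fun 0 (D x z) * F i (D z y) = (if x = z then F i (D x y) else 0)"
          by (auto simp: unit_fun_def)
      qed
      then show ?thesis using xy finite_Y by simp
    qed
    moreover have "conv (unit_fun 0) (F i) x y = (\<Sum>k\<le>w. e k * conv (F k) (F i) x y)"
      unfolding conv_sum_left[symmetric] using e by (intro conv_cong[OF _ _ xy]) auto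
    ultimately show ?thesis using single[OF i xy] by simp
  qed
  have adj: "conv (unit_fun 1) (F i) x y = (a i / e i) * F i (D x y)" if i: "i \<le> w" and xy: "x \<in> Y" "y \<in> Y" for i x y
  \<comment> \<open>If \<open>e i\<close> is 0, \<open>unit\<close> makes \<open>F i\<close> vanish
    on all distances within Y and both sides are 0; otherwise \<open>unit\<close> can be solved for
    the square of \<open>F i\<close>.\<close>
  proof (cases "e i = 0")
    case True
    have "F i (D z y) = 0" if "z \<in> Y" for z
      using unit[OF i that xy(2)] True by simp
    then show ?thesis using True by (simp add: conv_def)
  next
    case False
    have "conv (unit_fun 1) (F i) x y = (\<Sum>k\<le>w. a k * conv (F k) (F i) x y)"
      unfolding conv_sum_left[symmetric] using a by (intro conv_cong[OF _ _ xy]) auto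
    then show ?thesis using single[OF i xy] unit[OF i xy] False by simp
  qed
  have "conv (unit_fun 1) f x y = (\<Sum>i\<le>w. u i * ((a i / e i) * F i (D x y)))" if xy: "x \<in> Y" "y \<in> Y" for x y
  proof -
    have "conv (unit_fun 1) f x y = (\<Sum>i\<le>w. u i * conv (unit_fun 1) (F i) x y)"
      unfolding conv_sum_right[symmetric] using u by (intro conv_cong[OF _ _ xy]) auto
    then show ?thesis using adj xy by simp
  qed
  then show ?thesis
    by (intro exI[of _ "\<lambda>r. \<Sum>i\<le>w. u i * ((a i / e i) * F i r)"]) blast
qed

end

section \<open>Connected induced subgraphs and the distances occurring in them\<close>

locale induced_connected = G: connected_graph G + S: connected_graph "G \<restriction> Y"
  for G :: "('a, 'e) pre_digraph" and Y :: "'a set" +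
  assumes Y_verts: "Y \<subseteq> verts G"
begin

lemma induced_dominates: "x \<rightarrow>\<^bsub>G \<restriction> Y\<^esub> y \<longleftrightarrow> x \<in> Y \<and> y \<in> Y \<and> x \<rightarrow>\<^bsub>G\<^esub> y"
  by (auto simp: arcs_ends_def arc_to_ends_def induce_subgraph_def)

lemma verts_induced: "verts (G \<restriction> Y) = Y"
  by (simp add: induce_subgraph_def)

text \<open>Along a walk inside Y the distance in G from x changes by at most one per step, so some
  arc of the walk crosses from level r to r + 1.\<close>

lemma induced_crossing:
  assumes x: "x \<in> Y"
  shows "\<lbrakk>y \<in> Y; r < gdist G x y\<rbrakk> \<Longrightarrow>
    \<exists>z\<in>Y. \<exists>u\<in>Y. z \<rightarrow>\<^bsub>G\<^esub> u \<and> gdist G x z = r \<and> gdist G x u = Suc r"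
proof (induction "gdist (G \<restriction> Y) x y" arbitrary: y)
  case 0
  then have "x = y" using S.gdist_eq_0[of x y] x by (simp add: verts_induced)
  moreover have "gdist G x x = 0" using G.gdist_eq_0[of x x] x Y_verts by auto
  ultimately show ?case using 0 by simp
next
  case (Suc n)
  have "x \<in> verts (G \<restriction> Y)" "y \<in> verts (G \<restriction> Y)" using x Suc.prems by (simp_all add: verts_induced)
  from S.gdist_pred[OF this Suc.hyps(2)[symmetric]]
  obtain z where z: "y \<rightarrow>\<^bsub>G \<restriction> Y\<^esub> z" "gdist (G \<restriction> Y) x z = n" by metis
  have zY: "z \<in> Y" and zy: "z \<rightarrow>\<^bsub>G\<^esub> y"
    using z(1) G.dominates_sym by (auto simp: induced_dominates)
  show ?case
  proof (cases "r < gdist G x z")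
    case True
    show ?thesis using Suc.hyps(1)[OF z(2)[symmetric] zY True] .
  next
    case False
    have "x \<in> verts G" using x Y_verts by auto
    from G.gdist_step[OF this zy] have "gdist G x z = r \<and> gdist G x y = Suc r"
      using False Suc.prems(2) by simp
    then show ?thesis using zY zy Suc.prems(1) by blast
  qed
qed

lemma quad_form_char_vec: "quad_form (verts G) M (char_vec Y) = (\<Sum>y\<in>Y. \<Sum>z\<in>Y. M y z)"
proof -
  have "quad_form (verts G) M (char_vec Y) = (\<Sum>y\<in>Y. \<Sum>z\<in>verts G. char_vec Y y * M y z * char_vec Y z)"
    unfolding quad_form_def using Y_verts
    by (intro sum.mono_neutral_right) (auto simp: char_vec_def)
  also have "\<dots> = (\<Sum>y\<in>Y. \<Sum>z\<in>Y. char_vec Y y * M y z * char_vec Y z)"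
    using Y_verts by (intro sum.cong refl sum.mono_neutral_right) (auto simp: char_vec_def)
  finally show ?thesis by (simp add: char_vec_def)
qed

lemma finite_induced: "finite Y"
  using Y_verts by (rule finite_subset) simp

lemma quad_form_dist_mat:
  "quad_form (verts G) (dist_mat G i) (char_vec Y) \<noteq> 0 \<longleftrightarrow> (\<exists>y\<in>Y. \<exists>z\<in>Y. gdist G y z = i)"
proof -
  have "quad_form (verts G) (dist_mat G i) (char_vec Y)
      = of_nat (\<Sum>y\<in>Y. \<Sum>z\<in>Y. if gdist G y z = i then 1 else 0)"
    unfolding quad_form_char_vec of_nat_sum using Y_verts
    by (intro sum.cong refl) (auto simp: dist_mat_def)
  moreover have "(\<Sum>y\<in>Y. \<Sum>z\<in>Y. if gdist G y z = i then 1 else 0) \<noteq> (0 :: nat) \<longleftrightarrow>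
      (\<exists>y\<in>Y. \<exists>z\<in>Y. gdist G y z = i)"
    using finite_induced by (simp add: sum_eq_0_iff)
  ultimately show ?thesis by (simp only: of_nat_eq_0_iff)
qed

lemma width_ge: assumes "y \<in> Y" "z \<in> Y" shows "gdist G y z \<le> width G Y"
  unfolding width_def
proof (rule Max_ge)
  show "gdist G y z \<in> {i. i \<le> gdiam G \<and> quad_form (verts G) (dist_mat G i) (char_vec Y) \<noteq> 0}"
    using assms Y_verts G.gdist_le_gdiam[of y z] by (auto simp: quad_form_dist_mat)
qed simp

lemma width_attained: "\<exists>y\<in>Y. \<exists>z\<in>Y. gdist G y z = width G Y"
proof -
  obtain y where y: "y \<in> Y" using S.verts_nonempty by (auto simp: verts_induced)
  have "width G Y \<in> {i. i \<le> gdiam G \<and> quad_form (verts G) (dist_mat G i) (char_vec Y) \<noteq> 0}"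
    unfolding width_def
  proof (rule Max_in)
    have "gdist G y y \<le> gdiam G" using y Y_verts by (intro G.gdist_le_gdiam) auto
    then show "{i. i \<le> gdiam G \<and> quad_form (verts G) (dist_mat G i) (char_vec Y) \<noteq> 0} \<noteq> {}"
      using y quad_form_dist_mat[of "gdist G y y"] by blast
  qed simp
  then show ?thesis using quad_form_dist_mat by blast
qed

lemma width_below: assumes "i \<le> width G Y" shows "\<exists>y\<in>Y. \<exists>z\<in>Y. gdist G y z = i"
proof -
  obtain y z where yz: "y \<in> Y" "z \<in> Y" "gdist G y z = width G Y" using width_attained by blast
  show ?thesis
  proof (cases "i = width G Y")
    case False
    then have "i < gdist G y z" using assms yz(3) by simp
    from induced_crossing[OF yz(1,2) this] show ?thesis using yz(1) by blast
  qed (use yz in blast)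
qed

lemma dual_width_zero:
  assumes "dual_width G E Y < i" "i \<le> gdiam G"
  shows "(\<Sum>y\<in>Y. \<Sum>z\<in>Y. E i y z) = 0"
proof (rule ccontr)
  assume "(\<Sum>y\<in>Y. \<Sum>z\<in>Y. E i y z) \<noteq> 0"
  then have "i \<le> dual_width G E Y"
    unfolding dual_width_def using assms(2)
    by (intro Max_ge) (auto simp: quad_form_char_vec)
  then show False using assms(1) by simp
qed

end

locale descendent_subgraph = descendent_data d b c Q th G E Y w + induced_connected G Y
  for d :: nat and b c :: "nat \<Rightarrow> complex" and Q :: "nat \<Rightarrow> nat \<Rightarrow> complex" and th :: "nat \<Rightarrow> complex"
    and G :: "('a, 'e) pre_digraph" and E :: "nat \<Rightarrow> 'a cmat" and Y :: "'a set" and w :: nat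
begin

text \<open>Walks in the subgraph are walks in G. Conversely, the number of neighbours in Y of y at
  distance n from x depends only on the distance of x and y, by \<open>local_numbers\<close>; it is
  nonzero for one pair at distance n + 1, by \<open>induced_crossing\<close>, hence for all, and
  geodesics can be chosen inside Y.\<close>

lemma induced_dist:
  assumes "x \<in> Y" "y \<in> Y"
  shows "gdist (G \<restriction> Y) x y = D x y"
proof (rule le_antisym)
  have "\<forall>x\<in>Y. \<forall>y\<in>Y. gdist (G \<restriction> Y) x y = n \<longrightarrow> D x y \<le> n" for n
  proof (induction n)
    case 0
    show ?case using S.gdist_eq_0 gdist_0 subsetD[OF Y] by (simp add: verts_induced)
  next
    case (Suc n)
    show ?case
    proof (intro ballI impI)
      fix x y assume xy: "x \<in> Y" "y \<in> Y" "gdist (G \<restriction> Y) x y = Suc n"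
      then obtain z where z: "y \<rightarrow>\<^bsub>G \<restriction> Y\<^esub> z" "gdist (G \<restriction> Y) x z = n"
        using S.gdist_pred[of x y n, unfolded verts_induced] by blast
      then have "z \<in> Y" "z \<rightarrow>\<^bsub>G\<^esub> y" using G.dominates_sym by (auto simp: induced_dominates)
      moreover from this have "D x z \<le> n" using Suc.IH xy(1) z(2) by blast
      ultimately show "D x y \<le> Suc n" using G.gdist_step[of x z y] xy(1) Y by fastforce
    qed
  qed
  then show "D x y \<le> gdist (G \<restriction> Y) x y" using assms by blast
next
  have "\<forall>x\<in>Y. \<forall>y\<in>Y. D x y = n \<longrightarrow> gdist (G \<restriction> Y) x y \<le> n" for n
  proof (induction n)
    case 0
    show ?case using S.gdist_eq_0 gdist_0 subsetD[OF Y] by (simp add: verts_induced)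
  next
    case (Suc n)
    show ?case
    proof (intro ballI impI)
      fix x y assume xy: "x \<in> Y" "y \<in> Y" "D x y = Suc n"
      have conv: "conv (unit_fun 1) (unit_fun n) y x = of_nat (card {u \<in> Y. D y u = 1 \<and> D u x = n})"
        if "x \<in> Y" "y \<in> Y" for x y
      proof -
        have "conv (unit_fun 1) (unit_fun n) y x = (\<Sum>u\<in>Y. if D y u = 1 \<and> D u x = n then 1 else 0)"
          unfolding conv_def by (intro sum.cong) (auto simp: unit_fun_def)
        also have "\<dots> = of_nat (card {u \<in> Y. D y u = 1 \<and> D u x = n})"
          using finite_Y by (simp add: sum.If_cases Int_def)
        finally show ?thesis .
      qed
      obtain f' where f': "\<And>x y. \<lbrakk>x \<in> Y; y \<in> Y\<rbrakk> \<Longrightarrow> conv (unit_fun 1) (unit_fun n) x y = f' (D x y)"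
        using local_numbers[of "unit_fun n"] by blast
      have "n < D x y" using xy(3) by simp
      from induced_crossing[OF xy(1,2) this]
      obtain z u where zu: "z \<in> Y" "u \<in> Y" "z \<rightarrow>\<^bsub>G\<^esub> u" "D x z = n" "D x u = Suc n" by blast
      have X: "x \<in> X" "y \<in> X" "z \<in> X" "u \<in> X" using xy zu Y by auto
      have "D u z = 1" using G.gdist_eq_1[OF X(4,3)] G.dominates_sym zu(3) by simp
      then have "z \<in> {v \<in> Y. D u v = 1 \<and> D v x = n}"
        using zu dist_sym[OF X(1,3)] by simp
      then have "card {v \<in> Y. D u v = 1 \<and> D v x = n} \<noteq> 0"
        using finite_Y by (subst card_0_eq) auto
      \<comment> \<open>The pair u, x realises distance n + 1 with a neighbour z of u on a walk
        inside Y; \<open>f'\<close> carries this over to y, x.\<close>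
      then have "f' (Suc n) \<noteq> 0"
        using f'[OF zu(2) xy(1)] conv[OF xy(1) zu(2)] dist_sym[OF X(1,4)] zu(5) by simp
      then have "card {v \<in> Y. D y v = 1 \<and> D v x = n} \<noteq> 0"
        using f'[OF xy(2,1)] conv[OF xy(1,2)] dist_sym[OF X(1,2)] xy(3) by auto
      then have "{v \<in> Y. D y v = 1 \<and> D v x = n} \<noteq> {}"
        by (metis card.empty)
      then obtain v where v: "v \<in> Y" "D y v = 1" "D v x = n"
        by blast
      have vX: "v \<in> X" using v(1) Y by auto
      have "gdist (G \<restriction> Y) x v \<le> n"
        using Suc.IH xy(1) v(1,3) dist_sym[OF X(1) vX] by simp
      moreover have "v \<rightarrow>\<^bsub>G \<restriction> Y\<^esub> y"
        using G.gdist_eq_1[OF X(2) vX] v(1,2) xy(2) G.dominates_sym by (simp add: induced_dominates)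
      ultimately show "gdist (G \<restriction> Y) x y \<le> Suc n"
        using S.gdist_step[of x v y] xy(1) by (simp add: verts_induced)
    qed
  qed
  then show "gdist (G \<restriction> Y) x y \<le> D x y" using assms by blast
qed

lemma gdiam_induced: "gdiam (G \<restriction> Y) = w"
proof (rule le_antisym)
  obtain x y where "x \<in> Y" "y \<in> Y" "gdist (G \<restriction> Y) x y = gdiam (G \<restriction> Y)"
    using S.gdiam_attained[unfolded verts_induced] by blast
  then show "gdiam (G \<restriction> Y) \<le> w" using width_le[of x y] by (simp add: induced_dist)
next
  obtain x y where xy: "x \<in> Y" "y \<in> Y" "D x y = w" using width_ex[of w] by blast
  then show "w \<le> gdiam (G \<restriction> Y)"
    using S.gdist_le_gdiam[of x y] by (simp add: induced_dist verts_induced)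
qed

lemma dist_mat_induced: "dist_mat (G \<restriction> Y) i = principal_submatrix Y (dist_mat G i)"
  using Y by (intro ext) (auto simp: dist_mat_def principal_submatrix_def verts_induced induced_dist)

lemma bose_mesner_induced:
  "bose_mesner (G \<restriction> Y) = mat_span w (\<lambda>i. principal_submatrix Y (dist_mat G i))"
  by (simp add: bose_mesner_def gdiam_induced dist_mat_induced[abs_def])

text \<open>\<open>Q d\<close> kills \<open>Q' 0, \<dots>, Q' (w - 1)\<close>, hence is proportional to \<open>Q' w\<close> on \<open>{..w}\<close>.\<close>

lemma induced_drg_data:
  assumes drg: "drg (G \<restriction> Y) b' c'" and w1: "1 \<le> w"
    and bij: "bij_betw E' {..w} (primitive_idempotents (mat_algebra Y)
        (mat_span w (\<lambda>i. principal_submatrix Y (dist_mat G i))))"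
    and span: "\<And>i. i \<le> w \<Longrightarrow> mat_span i E' = mat_span i (\<lambda>j. principal_submatrix Y (E j))"
  shows "\<exists>Q' th' \<xi> \<zeta> \<mu>. drg_data w (\<lambda>r. of_nat (b' r)) (\<lambda>r. of_nat (c' r)) Q' th' (G \<restriction> Y) E' \<and>
    (\<forall>r\<le>w. Q' 1 r = \<xi> + \<zeta> * Q 1 r) \<and> \<zeta> \<noteq> 0 \<and> (\<forall>r\<le>w. Q d r = \<mu> * Q' w r) \<and> \<mu> \<noteq> 0"
proof -
  interpret S: drg "G \<restriction> Y" b' c' by (rule drg)
  note S_mult = S.mult_on_def[unfolded verts_induced]
  define n where "n = (of_nat (card X) :: complex)"
  define m where "m = (of_nat (card Y) :: complex)"
  have n: "n \<noteq> 0" unfolding n_def by (rule card_nz)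
  have "Y \<noteq> {}" using S.verts_nonempty by (simp add: verts_induced)
  then have m: "m \<noteq> 0" using finite_Y by (simp add: m_def)
  have bij': "bij_betw E' {..w} (primitive_idempotents (mat_algebra (verts (G \<restriction> Y))) (bose_mesner (G \<restriction> Y)))"
    using bij by (simp only: bose_mesner_induced verts_induced)
  have prim: "E' i \<in> primitive_idempotents (mat_algebra (verts (G \<restriction> Y))) (bose_mesner (G \<restriction> Y))" if "i \<le> w" for i
    using bij_betwE[OF bij'] that by simp
  have idem: "S.mult_on (E' i) (E' i) = E' i" "E' i \<noteq> (\<lambda>x y. 0)" if "i \<le> w" for i
    using prim[OF that] by (auto simp: primitive_idempotents_def mat_algebra_def S.mult_on_def)
  have orth: "S.mult_on (E' i) (E' j) = (\<lambda>x y. 0)" if "i \<le> w" "j \<le> w" "i \<noteq> j" for i j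
  proof -
    have "E' i \<noteq> E' j" using bij_betw_imp_inj_on[OF bij'] that by (auto dest: inj_onD)
    then show ?thesis by (rule S.primitive_idempotents_orthogonal[OF prim[OF that(1)] prim[OF that(2)]])
  qed
  have "\<exists>v. \<forall>x\<in>Y. \<forall>y\<in>Y. E' i x y = (\<Sum>k\<le>i. v k * E k x y)" if i: "i \<le> w" for i
  proof -
    have "E' i = (\<lambda>x y. \<Sum>k\<le>i. unit_fun i k * E' k x y)"
      by (simp add: unit_fun_def if_distrib[of "\<lambda>z. z * _"] cong: if_cong)
    then have "E' i \<in> mat_span i E'" unfolding mat_span_def by blast
    then have "E' i \<in> mat_span i (\<lambda>j. principal_submatrix Y (E j))" using span[OF i] by simp
    then obtain v where "E' i = (\<lambda>x y. \<Sum>k\<le>i. v k * principal_submatrix Y (E k) x y)"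
      unfolding mat_span_def by blast
    then have "\<forall>x\<in>Y. \<forall>y\<in>Y. E' i x y = (\<Sum>k\<le>i. v k * E k x y)"
      by (simp add: principal_submatrix_def)
    then show ?thesis by blast
  qed
  note ex_u = this
  define u where "u i = (SOME v. \<forall>x\<in>Y. \<forall>y\<in>Y. E' i x y = (\<Sum>k\<le>i. v k * E k x y))" for i
  have u: "E' i x y = (\<Sum>k\<le>i. u i k * E k x y)" if "i \<le> w" "x \<in> Y" "y \<in> Y" for i x y
    using someI_ex[OF ex_u[OF that(1)]] that(2,3) unfolding u_def[symmetric] by blast
  have outside: "E' i x y = 0" if "i \<le> w" "x \<notin> Y \<or> y \<notin> Y" for i x y
    using prim[OF that(1)] that(2) unfolding primitive_idempotents_def S.bose_mesner_rmat
    by (auto simp: S.rmat_def verts_induced)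
  \<comment> \<open>If the last coefficient were 0, the agreement of spans would put
    \<open>E' i\<close> into the span of its predecessors. It is orthogonal to them, so its square,
    which is \<open>E' i\<close>, would be zero.\<close>
  have lead: "u i i \<noteq> 0" if i: "i \<le> w" for i
  proof
    assume uii: "u i i = 0"
    show False
    proof (cases i)
      case 0
      then have "E' i x y = 0" for x y
        using u[OF i, of x y] outside[OF i, of x y] uii by (cases "x \<in> Y \<and> y \<in> Y") auto
      then show False using idem(2)[OF i] by blast
    next
      case (Suc j)
      then have j: "j \<le> w" using i by simp
      have "E' i x y = (\<Sum>k\<le>j. u i k * principal_submatrix Y (E k) x y)" for x y
        using u[OF i, of x y] outside[OF i, of x y] uii
        by (cases "x \<in> Y \<and> y \<in> Y") (auto simp: Suc principal_submatrix_def)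
      then have "E' i = (\<lambda>x y. \<Sum>k\<le>j. u i k * principal_submatrix Y (E k) x y)" by blast
      then have "E' i \<in> mat_span j E'" unfolding span[OF j] by (auto simp: mat_span_def)
      then obtain v where v: "E' i = (\<lambda>x y. \<Sum>k\<le>j. v k * E' k x y)" by (auto simp: mat_span_def)
      have "E' i x y = 0" for x y
      proof -
        have "E' i x y = (\<Sum>z\<in>Y. E' i x z * E' i z y)"
          using fun_cong[OF fun_cong[OF idem(1)[OF i], of x], of y] by (simp add: S_mult)
        also have "\<dots> = (\<Sum>z\<in>Y. (\<Sum>k\<le>j. v k * E' k x z) * E' i z y)"
          using fun_cong[OF fun_cong[OF v, of x]] by simp
        also have "\<dots> = (\<Sum>k\<le>j. v k * (\<Sum>z\<in>Y. E' k x z * E' i z y))"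
          unfolding sum_distrib_left sum_distrib_right by (subst sum.swap) (simp add: mult_ac)
        also have "\<dots> = 0"
        proof (intro sum.neutral ballI)
          fix k assume "k \<in> {..j}"
          then have "S.mult_on (E' k) (E' i) = (\<lambda>x y. 0)" using Suc i by (intro orth) auto
          from fun_cong[OF fun_cong[OF this, of x], of y]
          show "v k * (\<Sum>z\<in>Y. E' k x z * E' i z y) = 0" by (simp add: S_mult)
        qed
        finally show ?thesis .
      qed
      then show False using idem(2)[OF i] by blast
    qed
  qed
  \<comment> \<open>On Y this expresses \<open>E' i\<close> by a polynomial in \<open>Q 1\<close>;
    by \<open>lead\<close> its degree is exactly i. Division by n turns \<open>Q k\<close> into
    \<open>E k\<close>.\<close>
  define q where "q i = (\<Sum>k\<le>i. Polynomial.smult (u i k / n) (P k))" for i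
  have q: "E' i x y = poly (q i) (Q 1 (D x y))" if i: "i \<le> w" and xy: "x \<in> Y" "y \<in> Y" for i x y
  proof -
    have X: "x \<in> X" "y \<in> X" using xy Y by auto
    show ?thesis
      unfolding u[OF i xy] q_def poly_sum
    proof (intro sum.cong refl)
      fix k assume "k \<in> {..i}"
      then have k: "k \<le> d" using i w by simp
      show "u i k * E k x y = poly (Polynomial.smult (u i k / n) (P k)) (Q 1 (D x y))"
        using E_eq[OF k X] P(2)[OF k gdist_le[OF X]] by (simp add: n_def)
    qed
  qed
  have deg: "degree (q i) = i" if i: "i \<le> w" for i
  proof (rule antisym)
    show "degree (q i) \<le> i"
      unfolding q_def
    proof (intro degree_sum_le)
      fix k assume "k \<in> {..i}"
      then show "degree (Polynomial.smult (u i k / n) (P k)) \<le> i"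
        using P(1)[of k] i w degree_smult_le[of "u i k / n" "P k"] by simp
    qed simp
    have "coeff (q i) i = (\<Sum>k\<le>i. (u i k / n) * coeff (P k) i)"
      by (simp add: q_def coeff_sum)
    also have "\<dots> = (\<Sum>k\<in>{i}. (u i k / n) * coeff (P k) i)"
    proof (intro sum.mono_neutral_right ballI)
      fix k assume "k \<in> {..i} - {i}"
      then have "degree (P k) < i" using P(1)[of k] i w by auto
      then show "u i k / n * coeff (P k) i = 0" by (simp add: coeff_eq_0)
    qed auto
    finally have "coeff (q i) i = (u i i / n) * coeff (P i) i" by simp
    moreover have "coeff (P i) i \<noteq> 0"
    proof -
      have id: "i \<le> d" using i w by simp
      have "P i \<noteq> 0" using P(2)[OF id] Q_nonzero[OF id] by fastforce
      then show ?thesis using P(1)[OF id] leading_coeff_0_iff[of "P i"] by simp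
    qed
    ultimately have "coeff (q i) i \<noteq> 0" using lead[OF i] n by simp
    then show "i \<le> degree (q i)" by (rule le_degree)
  qed
  define \<alpha> where "\<alpha> = coeff (q 1) 0"
  define \<beta> where "\<beta> = coeff (q 1) 1"
  have q1: "poly (q 1) t = \<alpha> + \<beta> * t" for t
    using deg[OF w1] by (simp add: poly_altdef \<alpha>_def \<beta>_def)
  have "q 1 \<noteq> 0" using deg[OF w1] by force
  then have \<beta>: "\<beta> \<noteq> 0"
    using deg[OF w1] leading_coeff_0_iff[of "q 1"] by (simp add: \<beta>_def)
  \<comment> \<open>The polynomial of degree 0 makes \<open>E' 0\<close> a constant s on Y, and
    idempotence reads \<open>m * (s * s) = s\<close>.\<close>
  have E'0: "E' 0 = (\<lambda>x y. if x \<in> verts (G \<restriction> Y) \<and> y \<in> verts (G \<restriction> Y) then 1 / of_nat (card (verts (G \<restriction> Y))) else 0)"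
  proof -
    obtain s where s: "q 0 = [:s:]" using deg[of 0] by (auto elim: degree_eq_zeroE)
    have E'0: "E' 0 x y = (if x \<in> Y \<and> y \<in> Y then s else 0)" for x y
      using q[of 0 x y] outside[of 0 x y] s by auto
    have s0: "s \<noteq> 0" using E'0 idem(2)[of 0] by (auto intro!: ext)
    obtain y where y: "y \<in> Y" using \<open>Y \<noteq> {}\<close> by blast
    have "(\<Sum>z\<in>Y. E' 0 y z * E' 0 z y) = E' 0 y y"
      using fun_cong[OF fun_cong[OF idem(1)[of 0], of y], of y] by (simp add: S_mult)
    then have "m * (s * s) = s" using y by (simp add: E'0 m_def)
    then have "s = 1 / m" using s0 m by (simp add: field_simps)
    then show ?thesis using E'0 by (intro ext) (simp add: verts_induced m_def)
  qed
  have poly: "\<exists>p. degree p = i \<and> (\<forall>x\<in>verts (G \<restriction> Y). \<forall>y\<in>verts (G \<restriction> Y).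
      of_nat (card (verts (G \<restriction> Y))) * E' i x y = poly p (of_nat (card (verts (G \<restriction> Y))) * E' 1 x y))"
    if i: "i \<le> gdiam (G \<restriction> Y)" for i
  proof -
    have i: "i \<le> w" using i by (simp add: gdiam_induced)
    \<comment> \<open>The inner affine polynomial inverts \<open>q1\<close>: it recovers
      \<open>Q 1\<close> from \<open>m * E' 1\<close>.\<close>
    define p where "p = Polynomial.smult m (q i \<circ>\<^sub>p [:- \<alpha> / \<beta>, 1 / (m * \<beta>):])"
    have "degree p = i" using m \<beta> deg[OF i] by (simp add: p_def degree_pcompose)
    moreover have "m * E' i x y = poly p (m * E' 1 x y)" if "x \<in> Y" "y \<in> Y" for x y
    proof -
      have "- \<alpha> / \<beta> + m * E' 1 x y * (1 / (m * \<beta>)) = Q 1 (D x y)"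
        unfolding q[OF w1 that] q1 using m \<beta> by (simp add: field_simps)
      then show ?thesis by (simp add: p_def poly_pcompose q[OF i that])
    qed
    ultimately show ?thesis unfolding verts_induced m_def[symmetric] by blast
  qed
  have w1': "1 \<le> gdiam (G \<restriction> Y)" using w1 by (simp add: gdiam_induced)
  have "bij_betw E' {..gdiam (G \<restriction> Y)} (primitive_idempotents (mat_algebra (verts (G \<restriction> Y))) (bose_mesner (G \<restriction> Y)))"
    unfolding gdiam_induced by (rule bij')
  from S.drg_dataI[OF w1' this E'0 poly] obtain Q' th' where
    data: "drg_data w (\<lambda>r. of_nat (b' r)) (\<lambda>r. of_nat (c' r)) Q' th' (G \<restriction> Y) E'"
    unfolding gdiam_induced by blast
  interpret R: drg_data w "\<lambda>r. of_nat (b' r)" "\<lambda>r. of_nat (c' r)" Q' th' "G \<restriction> Y" E' by (rule data)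
  have Q'E: "Q' i (D x y) = m * E' i x y" if "i \<le> w" "x \<in> Y" "y \<in> Y" for i x y
    using R.E_eq[OF that(1), of x y] that(2,3) m by (simp add: verts_induced induced_dist m_def)
  have Q'1: "Q' 1 r = m * \<alpha> + (m * \<beta>) * Q 1 r" if r: "r \<le> w" for r
  proof -
    obtain x y where xy: "x \<in> Y" "y \<in> Y" "D x y = r" using width_ex[OF r] by blast
    show ?thesis
      using Q'E[OF w1 xy(1,2)] unfolding q[OF w1 xy(1,2)] q1 xy(3) by (simp add: algebra_simps)
  qed
  have Q'_span: "Q' i r = (\<Sum>k\<le>i. (m * u i k / n) * Q k r)" if i: "i \<le> w" and r: "r \<le> w" for i r
  proof -
    obtain x y where xy: "x \<in> Y" "y \<in> Y" "D x y = r" using width_ex[OF r] by blast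
    have X: "x \<in> X" "y \<in> X" using xy Y by auto
    have "Q' i r = m * (\<Sum>k\<le>i. u i k * E k x y)"
      using Q'E[OF i xy(1,2)] unfolding xy(3) u[OF i xy(1,2)] .
    also have "\<dots> = (\<Sum>k\<le>i. (m * u i k / n) * Q k r)"
      unfolding sum_distrib_left
    proof (intro sum.cong refl)
      fix k assume "k \<in> {..i}"
      then have "k \<le> d" using i w by simp
      from E_eq[OF this X] show "m * (u i k * E k x y) = (m * u i k / n) * Q k r"
        by (simp add: xy(3) n_def)
    qed
    finally show ?thesis .
  qed
  have conv_Q': "conv (Q' i) (Q' j) x y = (if i = j then m * Q' i (D x y) else 0)"
    if ij: "i \<le> w" "j \<le> w" and xy: "x \<in> Y" "y \<in> Y" for i j x y
  proof -
    have "conv (Q' i) (Q' j) x y = (\<Sum>z\<in>Y. (m * m) * (E' i x z * E' j z y))"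
      unfolding conv_def using ij xy by (intro sum.cong refl) (simp add: Q'E)
    also have "\<dots> = (m * m) * (\<Sum>z\<in>Y. E' i x z * E' j z y)"
      by (simp add: sum_distrib_left)
    also have "\<dots> = (if i = j then m * Q' i (D x y) else 0)"
      using R.E_mult[OF ij, of x y] xy Q'E[OF ij(1) xy] by (cases "i = j") (simp_all add: verts_induced)
    finally show ?thesis .
  qed
  obtain v where v: "\<And>r. r \<le> w \<Longrightarrow> Q d r = (\<Sum>i\<le>w. v i * Q' i r)" using R.Q_expand[of "Q d"] by blast
  \<comment> \<open>Convolution with \<open>Q' j\<close> extracts \<open>v j * (m * Q' j r)\<close>
    from the expansion of \<open>Q d\<close>, and it is zero because \<open>j + (d - w) < d\<close>;
    r is chosen with \<open>Q' j r\<close> nonzero.\<close>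
  have v0: "v j = 0" if j: "j < w" for j
  proof -
    have jw: "j \<le> w" using j by simp
    obtain r where r: "r \<le> w" "Q' j r \<noteq> 0" using R.Q_nonzero[OF jw] by blast
    obtain x y where xy: "x \<in> Y" "y \<in> Y" "D x y = r" using width_ex[OF r(1)] by blast
    have "conv (Q' j) (Q d) x y = 0"
    proof (rule conv_span_zero(1)[OF Q'_span[OF jw] _ _ xy(1,2)])
      show "Q d s = (\<Sum>l\<in>{d}. 1 * Q l s)" for s by simp
    qed (use j w in auto)
    moreover have "conv (Q' j) (Q d) x y = conv (Q' j) (\<lambda>r. \<Sum>i\<le>w. v i * Q' i r) x y"
      using v by (intro conv_cong[OF _ _ xy(1,2)]) auto
    moreover have "\<dots> = (\<Sum>i\<le>w. v i * (if j = i then m * Q' j r else 0))"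
      unfolding conv_sum_right using conv_Q'[OF jw _ xy(1,2)] xy(3) by (intro sum.cong) auto
    moreover have "\<dots> = v j * (m * Q' j r)"
      using jw by (simp add: if_distrib[of "\<lambda>z. _ * z"] cong: if_cong)
    ultimately show ?thesis using r(2) m by simp
  qed
  have Qd: "Q d r = v w * Q' w r" if "r \<le> w" for r
  proof -
    have "(\<Sum>i\<le>w. v i * Q' i r) = (\<Sum>i\<in>{w}. v i * Q' i r)"
      using v0 by (intro sum.mono_neutral_right) auto
    then show ?thesis using v[OF that] by simp
  qed
  have vw: "v w \<noteq> 0"
    using Qd[of 0] Q_d_nz[of 0] by auto
  show ?thesis
    using Q'1 Qd vw m \<beta> data
    by (intro exI[of _ Q'] exI[of _ th'] exI[of _ "m * \<alpha>"] exI[of _ "m * \<beta>"] exI[of _ "v w"]) simp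
qed

end

lemma induced_connected_subgraph:
  assumes "distance_regular G" "distance_regular (G \<restriction> Y)" "Y \<subseteq> verts G"
  shows "induced_connected G Y"
proof -
  have "connected_graph G" "connected_graph (G \<restriction> Y)"
    using distance_regularD[OF assms(1)] distance_regularD[OF assms(2)]
    by (simp_all add: connected_graph_def connected_graph_axioms_def)
  then show ?thesis
    using assms(3) by (simp add: induced_connected_def induced_connected_axioms_def)
qed

text \<open>Nontriviality places w strictly between 0 and d. The equality for the dual width yields
  the vanishing sums on Y, and connectedness of the subgraph yields every distance up to w within
  Y.\<close>

theorem descendent_drg_data:
  fixes G :: "('a, 'e) pre_digraph"
  assumes G: "distance_regular G" "gdiam G = d" "Q_polynomial G E" and d: "1 \<le> d"
    and sub: "nontrivial_descendent G E Y" "width G Y = w" "distance_regular (G \<restriction> Y)"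
    and E': "induced_ordering G E Y E'"
  shows "\<exists>b c Q th b' c' Q' th' \<xi> \<zeta> \<mu>. drg_data d b c Q th G E \<and> drg_data w b' c' Q' th' (G \<restriction> Y) E' \<and>
    (\<forall>r\<le>w. Q' 1 r = \<xi> + \<zeta> * Q 1 r) \<and> \<zeta> \<noteq> 0 \<and> (\<forall>r\<le>w. Q d r = \<mu> * Q' w r) \<and> \<mu> \<noteq> 0 \<and>
    1 \<le> w \<and> w \<le> d"
proof -
  obtain b c where bc: "drg G b c" by (rule distance_regular_drg[OF G(1)])
  obtain b' c' where bc': "drg (G \<restriction> Y) b' c'" by (rule distance_regular_drg[OF sub(3)])
  have desc: "Y \<noteq> {}" "Y \<subseteq> verts G" "w + dual_width G E Y = d" "w \<noteq> 0" "w \<noteq> d"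
    using sub(1,2) G(2) by (auto simp: nontrivial_descendent_def descendent_def)
  interpret I: induced_connected G Y
    by (rule induced_connected_subgraph[OF G(1) sub(3) desc(2)])
  have "1 \<le> gdiam G" using G(2) d by simp
  from Q_polynomial_drg_data[OF bc this G(3)] obtain Q th where
    data: "drg_data d (\<lambda>r. of_nat (b r)) (\<lambda>r. of_nat (c r)) Q th G E"
    unfolding G(2) by blast
  interpret R: drg_data d "\<lambda>r. of_nat (b r)" "\<lambda>r. of_nat (c r)" Q th G E by (rule data)
  interpret descendent_subgraph d "\<lambda>r. of_nat (b r)" "\<lambda>r. of_nat (c r)" Q th G E Y w
  proof unfold_locales
    show "cnj (E i y z) = E i y z" if "i \<le> d" for i y z
      by (rule R.E_real[OF refl refl that])
    show "(\<Sum>y\<in>Y. \<Sum>z\<in>Y. E i y z) = 0" if "i \<le> d" "d - w < i" for i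
      using that desc(3) G(2) by (intro I.dual_width_zero) auto
  qed (use desc I.width_ge I.width_below I.G.gdist_sym sub(2) in auto)
  have bij: "bij_betw E' {..w} (primitive_idempotents (mat_algebra Y)
      (mat_span w (\<lambda>i. principal_submatrix Y (dist_mat G i))))"
    and span: "\<And>i. i \<le> w \<Longrightarrow> mat_span i E' = mat_span i (\<lambda>j. principal_submatrix Y (E j))"
    using E' unfolding induced_ordering_def Let_def sub(2) by auto
  have w1: "1 \<le> w" and wd: "w \<le> d" using desc by simp_all
  from induced_drg_data[OF bc' w1 bij span] data w1 wd show ?thesis
    by blast
qed

lemma drg_pointI: "\<lbrakk>drg_data d b c Q th G E; p \<in> verts G\<rbrakk> \<Longrightarrow> drg_point d b c Q th G E p"
  by (simp add: drg_point_def drg_point_axioms_def)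

lemma leonard_isomorphic_affineI:
  fixes G :: "('a, 'e) pre_digraph" and H :: "('b, 'f) pre_digraph"
  assumes 1: "drg_data d b c Q th G E" and 2: "drg_data d b' c' Q' th' H F"
    and p: "p \<in> verts G" and q: "q \<in> verts H"
    and bc: "\<And>r. r \<le> d \<Longrightarrow> b' r = b r" "\<And>r. r \<le> d \<Longrightarrow> c' r = c r"
    and affine: "\<And>r. r \<le> d \<Longrightarrow> Q' 1 r = \<xi> + \<zeta> * Q 1 r"
  shows "leonard_isomorphic (graph_leonard G E p) (graph_leonard H F q)"
proof (rule leonard_isomorphicI[OF drg_pointI[OF 1 p] drg_pointI[OF 2 q] bc])
  interpret G: drg_data d b c Q th G E by (rule 1)
  interpret H: drg_data d b' c' Q' th' H F by (rule 2)
  fix l r assume lr: "l \<le> d" "r \<le> d"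
  have n: "of_nat (card (verts G)) \<noteq> (0 :: complex)" using p G.finite_verts by auto
  show "Q' l r = Q l r"
    by (rule leonard_data_equal[OF G.leonard_data_axioms H.leonard_data_axioms G.d_pos bc affine
          G.Q_sum n H.Q_sum lr])
qed auto

theorem mainTheorem4:
  fixes G :: "('a, 'e) pre_digraph" and H :: "('b, 'f) pre_digraph"
    and E E' :: "nat \<Rightarrow> 'a \<Rightarrow> 'a \<Rightarrow> complex" and F F' :: "nat \<Rightarrow> 'b \<Rightarrow> 'b \<Rightarrow> complex"
    and Y :: "'a set" and Z :: "'b set"
    and d w :: nat
    and x y :: 'a and x' y' :: 'b
  assumes "d \<ge> 3"
    and "distance_regular G" and "gdiam G = d" and "Q_polynomial G E"
    and "nontrivial_descendent G E Y" and "width G Y = w"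
    and "distance_regular (G \<restriction> Y)" and "induced_ordering G E Y E'"
    and "x \<in> verts G" and "y \<in> Y"
    and "distance_regular H" and "gdiam H = d" and "Q_polynomial H F"
    and "nontrivial_descendent H F Z" and "width H Z = w"
    and "distance_regular (H \<restriction> Z)" and "induced_ordering H F Z F'"
    and "x' \<in> verts H" and "y' \<in> Z"
  shows "(leonard_isomorphic (graph_leonard G E x) (graph_leonard H F x') \<longrightarrow>
            leonard_isomorphic (graph_leonard (G \<restriction> Y) E' y) (graph_leonard (H \<restriction> Z) F' y')) \<and>
         (w \<ge> 3 \<and>
            leonard_isomorphic (graph_leonard (G \<restriction> Y) E' y) (graph_leonard (H \<restriction> Z) F' y') \<longrightarrow>
            leonard_isomorphic (graph_leonard G E x) (graph_leonard H F x'))"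
proof -
  have d: "1 \<le> d" using assms(1) by simp
  obtain b c Q th bY cY QY thY \<xi> \<zeta> \<mu> where G: "drg_data d b c Q th G E"
    "drg_data w bY cY QY thY (G \<restriction> Y) E'"
    "\<And>r. r \<le> w \<Longrightarrow> QY 1 r = \<xi> + \<zeta> * Q 1 r" "\<zeta> \<noteq> 0"
    "\<And>r. r \<le> w \<Longrightarrow> Q d r = \<mu> * QY w r" "\<mu> \<noteq> 0" "1 \<le> w" "w \<le> d"
    using descendent_drg_data[OF assms(2-4) d assms(5-8)] by blast
  obtain b' c' R th' bZ cZ RZ thZ \<xi>' \<zeta>' \<mu>' where H: "drg_data d b' c' R th' H F"
    "drg_data w bZ cZ RZ thZ (H \<restriction> Z) F'"
    "\<And>r. r \<le> w \<Longrightarrow> RZ 1 r = \<xi>' + \<zeta>' * R 1 r" "\<zeta>' \<noteq> 0"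
    "\<And>r. r \<le> w \<Longrightarrow> R d r = \<mu>' * RZ w r" "\<mu>' \<noteq> 0"
    using descendent_drg_data[OF assms(11-13) d assms(14-17)] by blast
  interpret G: drg_data d b c Q th G E by (rule G(1))
  interpret H: drg_data d b' c' R th' H F by (rule H(1))
  interpret Y: drg_data w bY cY QY thY "G \<restriction> Y" E' by (rule G(2))
  interpret Z: drg_data w bZ cZ RZ thZ "H \<restriction> Z" F' by (rule H(2))
  have y: "y \<in> verts (G \<restriction> Y)" and z: "y' \<in> verts (H \<restriction> Z)"
    using assms(10,19) by (simp_all add: induce_subgraph_def)
  show ?thesis
  proof (intro conjI impI)
    assume iso: "leonard_isomorphic (graph_leonard G E x) (graph_leonard H F x')"
    note eq = leonard_isomorphicD[OF drg_pointI[OF G(1) assms(9)] drg_pointI[OF H(1) assms(18)] iso]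
    \<comment> \<open>Equality of the dual eigenvalues is read as the affine relation with shift 0
      and factor 1.\<close>
    have "R 1 r = 0 + 1 * Q 1 r" if "r \<le> d" for r using eq(3)[OF that] by simp
    from leonard_data_proportional(1)[OF G.leonard_data_axioms H.leonard_data_axioms d eq(1,2) this order.refl]
    obtain \<nu> where \<nu>: "\<And>r. r \<le> d \<Longrightarrow> R d r = \<nu> * Q d r" by blast
    \<comment> \<open>\<open>QY 1\<close> and \<open>RZ 1\<close> are affine in one and the same
      function \<open>Q 1\<close> on \<open>{..w}\<close>, which is eliminated; division by \<zeta>
      is possible as it is nonzero.\<close>
    have affine: "RZ 1 r = (\<xi>' - \<zeta>' * \<xi> / \<zeta>) + (\<zeta>' / \<zeta>) * QY 1 r" if "r \<le> w" for r
      using H(3)[OF that] G(3)[OF that] eq(3)[of r] that G(4,8) by (simp add: field_simps)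
    have "RZ w r = (\<nu> * \<mu> / \<mu>') * QY w r" if "r \<le> w" for r
      using H(5)[OF that] G(5)[OF that] \<nu>[of r] that H(6) G(8) by (simp add: field_simps)
    from leonard_data_determined[OF Y.leonard_data_axioms Z.leonard_data_axioms G(7) affine this Y.c_1 Z.c_1]
    have "bZ r = bY r" "cZ r = cY r" if "r \<le> w" for r using that by blast+
    from leonard_isomorphic_affineI[OF G(2) H(2) y z this affine]
    show "leonard_isomorphic (graph_leonard (G \<restriction> Y) E' y) (graph_leonard (H \<restriction> Z) F' y')" .
  next
    assume *: "3 \<le> w \<and> leonard_isomorphic (graph_leonard (G \<restriction> Y) E' y) (graph_leonard (H \<restriction> Z) F' y')"
    then have w: "3 \<le> w" by simp
    note eq = leonard_isomorphicD[OF drg_pointI[OF G(2) y] drg_pointI[OF H(2) z] conjunct2[OF *]]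
    have "RZ 1 r = 0 + 1 * QY 1 r" if "r \<le> w" for r using eq(3)[OF that] by simp
    from leonard_data_proportional(1)[OF Y.leonard_data_axioms Z.leonard_data_axioms G(7) eq(1,2) this order.refl]
    obtain \<nu> where \<nu>: "\<And>r. r \<le> w \<Longrightarrow> RZ w r = \<nu> * QY w r" by blast
    have affine: "R 1 r = ((\<xi> - \<xi>') / \<zeta>') + (\<zeta> / \<zeta>') * Q 1 r" if "r \<le> w" for r
    proof -
      have "R 1 r * \<zeta>' = (\<xi> - \<xi>') + \<zeta> * Q 1 r"
        using H(3)[OF that] G(3)[OF that] eq(3)[OF that] by (simp add: algebra_simps)
      from eq_divide_imp[OF H(4) this] show ?thesis by (simp add: add_divide_distrib)
    qed
    have proportional: "R d r = (\<mu>' * \<nu> / \<mu>) * Q d r" if "r \<le> w" for r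
      using H(5)[OF that] G(5)[OF that] \<nu>[OF that] G(6) by (simp add: field_simps)
    have "R 1 r = ((\<xi> - \<xi>') / \<zeta>') + (\<zeta> / \<zeta>') * Q 1 r" if "r \<le> 3" for r
      using affine[of r] that w by simp
    \<comment> \<open>The final comparison of all \<open>Q l\<close> takes place on
      \<open>{..d}\<close>, so the affine relation has to be extended beyond w.\<close>
    note affine' = affine_extends[OF G.leonard_data_axioms H.leonard_data_axioms assms(1) this]
    from leonard_data_determined_by_part[OF G.leonard_data_axioms H.leonard_data_axioms w G(8) affine proportional G.c_1 H.c_1]
    have "b' r = b r" "c' r = c r" if "r \<le> d" for r using that by blast+
    from leonard_isomorphic_affineI[OF G(1) H(1) assms(9,18) this affine']
    show "leonard_isomorphic (graph_leonard G E x) (graph_leonard H F x')" .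
  qed
qed

end
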